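(* Let $d_1,d_2\ge 2$ and let $G<\mathrm{GL}_{d_1d_2}(\mathbb{R})\simeq\mathrm{GL}(\mathbb{R}^{d_1}\otimes\mathbb{R}^{d_2})$ denote the group of all linear maps of the form $g\otimes h$ where $g\in\mathrm{GL}_{d_1}(\mathbb{R})$ and $h\in\mathrm{GL}_{d_2}(\mathbb{R})$. Then for all large enough finite sets $\mathcal{I},\mathcal{J}$ there exists a nonempty open set of $(\mathsf{A},\mathsf{B})\in G^{\mathcal{I}}\times G^{\mathcal{J}}$ with the following property: for Lebesgue almost every affine iterated function system $(T_i)_{i\in\mathcal{I}}$ with linearisation $\mathsf{A}$, and for Lebesgue almost every affine iterated function system $(T'_j)_{j\in\mathcal{J}}$ with linearisation $\mathsf{B}$, the attractor $X$ of $(T_i)_{i\in\mathcal{I}}$ and the attractor $Y$ of $(T'_j)_{j\in\mathcal{J}}$ satisfy \[\dim_{\mathsf{H}}(X+Y)<\dim_{\mathsf{H}}X+\dim_{\mathsf{H}}Y<d_1d_2.\]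
   Context: An affine iterated function system (IFS) with linearisation $\mathsf{A}=(A_i)_{i\in\mathcal{I}}\in\mathrm{GL}_d(\mathbb{R})^{\mathcal{I}}$ is a tuple of maps $T_ix=A_ix+u_i$ on $\mathbb{R}^d$, $u_i\in\mathbb{R}^d$; it is part of the definition of an IFS that the $T_i$ are all contracting with respect to some common norm on $\mathbb{R}^d$ (so the open set asserted to exist consists of tuples with this contraction property). Its attractor is the unique nonempty compact $X$ with $X=\bigcup_iT_iX$. "Lebesgue almost every IFS with linearisation $\mathsf{A}$" means for Lebesgue almost every $(u_i)_{i\in\mathcal{I}}\in(\mathbb{R}^d)^{\mathcal{I}}$. Here $d=d_1d_2$, open means open in the usual (Euclidean) topology of $G^{\mathcal{I}}\times G^{\mathcal{J}}$, $X+Y=\{x+y:x\in X,y\in Y\}$, and $\dim_{\mathsf{H}}$ is Hausdorff dimension. *)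

theory Defs
  imports "HOL-Analysis.Analysis"
begin

text \<open>
  The space $R^m \otimes R^n$ is modelled as \<open>real ^ ('m \<times> 'n)\<close>, the elementary tensor of the
  \<open>i\<close>-th and \<open>k\<close>-th standard basis vectors being the standard basis vector with index \<open>(i, k)\<close>.
  The lemma \<open>kronecker_tensor_vec\<close> below is the defining property of $g \otimes h$.
\<close>

definition tensor_vec :: "real ^ 'm \<Rightarrow> real ^ 'n \<Rightarrow> real ^ ('m \<times> 'n)" where
  "tensor_vec x y = (\<chi> p. x $ fst p * y $ snd p)"

definition kronecker ::
  "real ^ 'm ^ 'm \<Rightarrow> real ^ 'n ^ 'n \<Rightarrow> real ^ ('m \<times> 'n) ^ ('m \<times> 'n)" where
  "kronecker g h = (\<chi> p q. g $ fst p $ fst q * h $ snd p $ snd q)"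

lemma kronecker_tensor_vec:
  fixes g :: "real ^ 'm::finite ^ 'm" and h :: "real ^ 'n::finite ^ 'n"
  shows "kronecker g h *v tensor_vec x y = tensor_vec (g *v x) (h *v y)"
  by (simp add: vec_eq_iff kronecker_def tensor_vec_def matrix_vector_mult_def sum_product
      sum.cartesian_product UNIV_Times_UNIV [symmetric] case_prod_unfold mult_ac
      del: UNIV_Times_UNIV)

definition tensor_GL :: "(real ^ ('m::finite \<times> 'n::finite) ^ ('m \<times> 'n)) set" where
  "tensor_GL = {kronecker g h | g h. invertible g \<and> invertible h}"

definition affine_maps ::
  "('i \<Rightarrow> real ^ 'k ^ 'k) \<Rightarrow> ('i \<Rightarrow> real ^ 'k) \<Rightarrow> 'i \<Rightarrow> real ^ 'k \<Rightarrow> real ^ 'k::finite" where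
  "affine_maps A u i x = A i *v x + u i"

definition is_norm :: "('a::real_vector \<Rightarrow> real) \<Rightarrow> bool" where
  "is_norm N \<longleftrightarrow>
     (\<forall>x. 0 \<le> N x) \<and> (\<forall>x. N x = 0 \<longleftrightarrow> x = 0) \<and>
     (\<forall>c x. N (c *\<^sub>R x) = \<bar>c\<bar> * N x) \<and> (\<forall>x y. N (x + y) \<le> N x + N y)"

definition is_ifs :: "'i set \<Rightarrow> ('i \<Rightarrow> 'a::real_vector \<Rightarrow> 'a) \<Rightarrow> bool" where
  "is_ifs I T \<longleftrightarrow>
     (\<exists>N. is_norm N \<and>
       (\<forall>i\<in>I. \<exists>c. 0 \<le> c \<and> c < 1 \<and> (\<forall>x y. N (T i x - T i y) \<le> c * N (x - y))))"

text \<open>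
  Only meaningful if \<open>is_ifs I T\<close> holds and \<open>I\<close> is finite and nonempty, when the described set exists
  and is unique.
\<close>

definition attractor :: "'i set \<Rightarrow> ('i \<Rightarrow> 'a::topological_space \<Rightarrow> 'a) \<Rightarrow> 'a set" where
  "attractor I T = (THE X. compact X \<and> X \<noteq> {} \<and> X = (\<Union>i\<in>I. T i ` X))"

text \<open>
  The covering sets are required to be bounded because \<open>diameter\<close> has an unspecified value on unbounded
  sets. The case \<open>s = 0\<close> is separate because \<open>0 powr 0 = 0\<close>, whereas a point should have
  zero-dimensional measure one.
\<close>

definition diam_power :: "real \<Rightarrow> 'a::metric_space set \<Rightarrow> ennreal" where
  "diam_power s C =
     (if C = {} then 0 else if s = 0 then 1 else ennreal (diameter C powr s))"

definition hausdorff_premeasure :: "real \<Rightarrow> real \<Rightarrow> 'a::metric_space set \<Rightarrow> ennreal" where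
  "hausdorff_premeasure s \<delta> S =
     Inf {(\<Sum>n. diam_power s (C n)) | C :: nat \<Rightarrow> 'a set.
            S \<subseteq> (\<Union>n. C n) \<and> (\<forall>n. bounded (C n) \<and> diameter (C n) \<le> \<delta>)}"

definition hausdorff_measure :: "real \<Rightarrow> 'a::metric_space set \<Rightarrow> ennreal" where
  "hausdorff_measure s S = (SUP \<delta>\<in>{0<..}. hausdorff_premeasure s \<delta> S)"

definition hausdorff_dim :: "'a::metric_space set \<Rightarrow> ennreal" where
  "hausdorff_dim S = Inf {ennreal s | s. 0 \<le> s \<and> hausdorff_measure s S = 0}"

end

theory Submission
  imports Defs
begin

text \<open>
  The linear maps are chosen so that the two attractors are thin in different tensor directions.
  Each $A_i$ is close to a multiple of $P \otimes \mathrm{id}$ and each $B_j$ to a multiple of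
  $\mathrm{id} \otimes P'$, where $P$ and $P'$ are rank one coordinate projections. A product of
  matrices near $P$ is, up to an exponentially small relative error, again of rank one
  (\<open>mprod_near_rank_one\<close>). Hence a product of the $A_i$ maps a ball to a very thin
  neighbourhood of a disc in $v \otimes R^{d_2}$ for some $v$, and a product of the $B_j$ maps it
  to a very thin neighbourhood of a disc in $R^{d_1} \otimes v'$ for some $v'$. Whatever $v$ and
  $v'$ are, these two subspaces meet in the line spanned by $v \otimes v'$. So a sum of two
  cylinders of comparable size is close to a piece of a subspace of dimension $D = d_1 + d_2 - 1$
  only (\<open>cylinder_sum_cover\<close>).

  The number of maps and the contraction rates are matched so that the dimension of $X$ is
  slightly below $d_2$ and that of $Y$ slightly below $d_1$: for almost all translations
  \[ d_2 - 1/4 \le \dim X \le d_2 - 1/16, \qquad d_1 - 1/4 \le \dim Y \le d_1 - 1/16 . \]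
  Then $D < \dim X + \dim Y < D + 1 = d_1 + d_2 \le d_1 d_2$. Suppose that the sums of cylinders
  of radius $r$ are $r^2$ thin. They are covered by about $r^{-D}$ cubes of side $r^2$ each, and
  there are at most about $r^{-(D + 3/4)}$ sums, so exponents $\tau$ with $2 \tau > 2 D + 3/4$
  bound the dimension of $X + Y$ (\<open>hausdorff_dim_sum_le\<close>). The value $\tau = D +
  7/16$ is less than $D + 1/2 \le \dim X + \dim Y$. Only crude bounds for the norms of products
  enter, and they persist under perturbation; this is what makes the set of linearisations open
  (\<open>tensor_box_factors\<close>).

  The upper bounds for $\dim X$ and $\dim Y$ come from the covers by cylinders. The lower bounds
  follow the method of Falconer: for a fixed linearisation, the expectation over the translations
  of the Riesz energy of the points $T_w(0)$, where $w$ runs through the words of length $n$, is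
  bounded in $n$ (\<open>expected_pair_energy_le\<close>). By Fatou's lemma, for almost all
  translations the energies do not tend to infinity, and bounded energies along a sequence of $n$
  force every cover of the compact attractor to be expensive
  (\<open>hausdorff_dim_ge_of_energy\<close>). The integrals are bounded because the difference of
  two such points depends on the translation of the first letter in which the words differ by a
  map close to the identity (\<open>branching_integral_bound\<close>), and because the product
  over the common prefix contracts $d_2$ (respectively $d_1$) coordinates by no more than a
  controlled factor (\<open>kronecker_word_shear\<close>).
\<close>

section \<open>Hausdorff dimension from finite covers\<close>

text \<open>
  The covers may be finite with a common bound for the diameters. A small value of the product
  forces this bound itself to be small, which gives covers of arbitrarily small mesh.
\<close>

lemma hausdorff_dim_le_of_covers:
  fixes S :: "'a::metric_space set"
  assumes s: "0 < s"
    and cov: "\<And>e. e > 0 \<Longrightarrow> \<exists>P \<rho>. finite P \<and> S \<subseteq> \<Union>P \<and> (\<forall>C\<in>P. bounded C \<and> diameter C \<le> \<rho>) \<and>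
                0 < \<rho> \<and> real (card P) * \<rho> powr s < e"
  shows "hausdorff_dim S \<le> ennreal s"
proof -
  have pre: "hausdorff_premeasure s \<delta> S \<le> 0" if \<delta>: "\<delta> > 0" for \<delta>
  proof (rule ennreal_le_epsilon)
    fix e :: real assume e: "0 < e"
    (* The second bound forces the covering sets to have diameter less than the mesh. *)
    define e' where "e' = min e (\<delta> powr s)"
    have "e' > 0" using e \<delta> by (simp add: e'_def)
    from cov[OF this] obtain P \<rho> where P: "finite P" "S \<subseteq> \<Union>P" "\<And>C. C \<in> P \<Longrightarrow> bounded C"
      "\<And>C. C \<in> P \<Longrightarrow> diameter C \<le> \<rho>" "0 < \<rho>" "real (card P) * \<rho> powr s < e'" by blast
    obtain h where h: "bij_betw h {0..<card P} P" using ex_bij_betw_nat_finite[OF P(1)] by blast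
    have hP: "h n \<in> P" if "n < card P" for n using h that by (auto simp: bij_betw_def)
    define C where "C n = (if n < card P then h n else {})" for n
    have "\<Union>P = (\<Union>n. C n)"
    proof -
      have "P = h ` {0..<card P}" using h by (simp add: bij_betw_def)
      then have "\<Union>P = (\<Union>n\<in>{0..<card P}. h n)" by metis
      also have "\<dots> = (\<Union>n. C n)" by (auto simp: C_def split: if_splits)
      finally show ?thesis .
    qed
    then have "S \<subseteq> (\<Union>n. C n)" using P(2) by simp
    moreover have "bounded (C n) \<and> diameter (C n) \<le> \<delta>" for n
    proof (cases "n < card P")
      case True
      then have "1 * \<rho> powr s \<le> real (card P) * \<rho> powr s" by (intro mult_right_mono) auto
      then have "\<rho> powr s < \<delta> powr s" using P(6) by (simp add: e'_def)
      then have "\<rho> < \<delta>" using powr_mono2[of s \<delta> \<rho>] \<delta> s by force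
      then show ?thesis using P(3,4)[OF hP[OF True]] True by (auto simp: C_def)
    next
      case False then show ?thesis using \<delta> by (simp add: C_def)
    qed
    ultimately have "hausdorff_premeasure s \<delta> S \<le> (\<Sum>n. diam_power s (C n))"
      unfolding hausdorff_premeasure_def by (intro Inf_lower) blast
    also have "\<dots> = (\<Sum>n<card P. diam_power s (C n))"
      by (rule suminf_finite) (auto simp: C_def diam_power_def)
    also have "\<dots> \<le> (\<Sum>n<card P. ennreal (\<rho> powr s))"
    proof (rule sum_mono)
      fix n assume "n \<in> {..<card P}"
      then have "C n \<in> P" using hP by (simp add: C_def)
      then have "diameter (C n) powr s \<le> \<rho> powr s"
        using P(3,4) s by (intro powr_mono2 diameter_ge_0) auto
      then show "diam_power s (C n) \<le> ennreal (\<rho> powr s)" using s by (simp add: diam_power_def ennreal_leI)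
    qed
    also have "\<dots> = ennreal (real (card P) * \<rho> powr s)"
      by (simp add: ennreal_mult ennreal_of_nat_eq_real_of_nat)
    also have "\<dots> \<le> ennreal e" using P(6) by (intro ennreal_leI) (simp add: e'_def)
    finally show "hausdorff_premeasure s \<delta> S \<le> 0 + ennreal e" by simp
  qed
  have "hausdorff_measure s S = 0"
    unfolding hausdorff_measure_def using pre by (auto simp: SUP_eq_const intro!: antisym SUP_least)
  then show ?thesis unfolding hausdorff_dim_def using s by (intro Inf_lower) auto
qed

section \<open>Words and attractors\<close>

fun word_map :: "('i \<Rightarrow> 'a \<Rightarrow> 'a) \<Rightarrow> 'i list \<Rightarrow> 'a \<Rightarrow> 'a" where
  "word_map T [] x = x"
| "word_map T (i # w) x = T i (word_map T w x)"

definition words :: "'i set \<Rightarrow> nat \<Rightarrow> 'i list set" where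
  "words I n = {w. set w \<subseteq> I \<and> length w = n}"

lemma finite_words: "finite I \<Longrightarrow> finite (words I n)"
  by (simp add: words_def finite_lists_length_eq)

lemma card_words: "finite I \<Longrightarrow> card (words I n) = card I ^ n"
  by (simp add: words_def card_lists_length_eq)

lemma words_0: "words I 0 = {[]}" by (auto simp: words_def)

lemma words_Suc: "words I (Suc n) = (\<lambda>(i, w). i # w) ` (I \<times> words I n)"
  by (auto simp: words_def image_iff length_Suc_conv)

lemma word_map_lipschitz:
  assumes "\<And>i x y. i \<in> I \<Longrightarrow> dist (T i x) (T i y) \<le> c * dist x y" "0 \<le> c" "w \<in> words I n"
  shows "dist (word_map T w x) (word_map T w y) \<le> c ^ n * dist x y"
  using assms(3)
proof (induction w arbitrary: n)
  case Nil then show ?case by (simp add: words_def)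
next
  case (Cons i w)
  then obtain m where m: "n = Suc m" "w \<in> words I m" "i \<in> I" by (auto simp: words_def)
  have "dist (word_map T (i # w) x) (word_map T (i # w) y) \<le> c * dist (word_map T w x) (word_map T w y)"
    using assms(1)[OF m(3)] by simp
  also have "\<dots> \<le> c * (c ^ m * dist x y)" using Cons.IH[OF m(2)] assms(2) by (intro mult_left_mono) auto
  finally show ?case using m(1) by (simp add: mult_ac)
qed

lemma invariant_set_words:
  assumes "X = (\<Union>i\<in>I. T i ` X)"
  shows "X = (\<Union>w\<in>words I n. word_map T w ` X)"
proof (induction n)
  case 0 show ?case by (simp add: words_0)
next
  case (Suc n)
  have "X = (\<Union>i\<in>I. T i ` (\<Union>w\<in>words I n. word_map T w ` X))" using assms Suc by simp
  also have "\<dots> = (\<Union>w\<in>words I (Suc n). word_map T w ` X)"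
    by (auto simp: words_Suc image_iff) (force, metis)
  finally show ?case .
qed

text \<open>
  Every point of \<open>X\<close> lies in a cylinder of each level \<open>n\<close>, and applying
  the same word to a point of \<open>Y\<close> gives a point of \<open>Y\<close> at distance
  $O(c^n)$. Applied in both directions this shows that the attractor is unique.
\<close>

lemma invariant_subset_of_invariant:
  fixes T :: "'i \<Rightarrow> 'a::metric_space \<Rightarrow> 'a"
  assumes lip: "\<And>i x y. i \<in> I \<Longrightarrow> dist (T i x) (T i y) \<le> c * dist x y" and c: "0 \<le> c" "c < 1"
    and X: "bounded X" "X = (\<Union>i\<in>I. T i ` X)"
    and Y: "closed Y" "Y \<noteq> {}" "Y = (\<Union>i\<in>I. T i ` Y)"
  shows "X \<subseteq> Y"
proof
  fix x assume x: "x \<in> X"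
  obtain y where y: "y \<in> Y" using Y(2) by blast
  obtain B where B: "\<And>x. x \<in> X \<Longrightarrow> dist y x \<le> B" using X(1) bounded_any_center[of X y] by blast
  have "\<exists>z\<in>Y. dist z x < e" if e: "e > 0" for e
  proof -
    have "(\<lambda>n. c ^ n * B) \<longlonglongrightarrow> 0 * B" using c by (intro tendsto_intros LIMSEQ_realpow_zero) auto
    then have "eventually (\<lambda>n. c ^ n * B < e) sequentially" using e by (auto dest: order_tendstoD(2))
    then obtain n where n: "c ^ n * B < e" by (auto simp: eventually_sequentially)
    from x obtain w x' where w: "w \<in> words I n" "x' \<in> X" "x = word_map T w x'"
      using invariant_set_words[OF X(2), of n] by blast
    have "word_map T w y \<in> Y" using invariant_set_words[OF Y(3), of n] y w(1) by blast
    moreover have "dist (word_map T w y) x \<le> c ^ n * dist y x'"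
      unfolding w(3) using lip c(1) w(1) by (rule word_map_lipschitz)
    moreover have "c ^ n * dist y x' \<le> c ^ n * B" using B[OF w(2)] c by (intro mult_left_mono) auto
    ultimately show ?thesis using n by (intro bexI[of _ "word_map T w y"]) linarith+
  qed
  then have "x \<in> closure Y" by (simp add: closure_approachable)
  then show "x \<in> Y" using Y(1) by simp
qed

text \<open>
  A large ball is mapped into itself by all maps, so the iterates of $Z \mapsto \bigcup_i T_i Z$
  on it are nested compact sets. Their intersection is invariant because the index set is finite:
  a point of the intersection has, for one and the same \<open>i\<close>, a preimage under $T_i$
  at every level.
\<close>

lemma invariant_compact_exists:
  fixes T :: "'i \<Rightarrow> 'a::euclidean_space \<Rightarrow> 'a"
  assumes I: "finite I" "I \<noteq> {}"
    and lip: "\<And>i x y. i \<in> I \<Longrightarrow> dist (T i x) (T i y) \<le> c * dist x y" and c: "0 \<le> c" "c < 1"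
  shows "\<exists>X. compact X \<and> X \<noteq> {} \<and> X = (\<Union>i\<in>I. T i ` X)"
proof -
  define F where "F Z = (\<Union>i\<in>I. T i ` Z)" for Z
  have cont: "continuous_on Z (T i)" if "i \<in> I" for i Z
  proof (rule continuous_onI)
    fix x e :: real and z assume e: "e > 0"
    show "\<exists>d>0. \<forall>x'\<in>Z. dist x' z < d \<longrightarrow> dist (T i x') (T i z) \<le> e"
    proof (intro exI[of _ e] conjI e ballI impI)
      fix x' assume "dist x' z < e"
      moreover have "dist (T i x') (T i z) \<le> c * dist x' z" using lip[OF that] .
      moreover have "c * dist x' z \<le> 1 * dist x' z" using c by (intro mult_right_mono) auto
      ultimately show "dist (T i x') (T i z) \<le> e" by linarith
    qed
  qed
  (* The radius solves c R + (sum of the norms of T i 0) = R. *)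
  define R where "R = (\<Sum>i\<in>I. norm (T i 0)) / (1 - c)"
  define K where "K n = (F ^^ n) (cball 0 R)" for n
  have FK: "K (Suc n) = F (K n)" for n by (simp add: K_def)
  have mono: "F Z \<subseteq> F Z'" if "Z \<subseteq> Z'" for Z Z' using that by (auto simp: F_def)
  have comp: "compact (K n)" for n
  proof (induction n)
    case 0 then show ?case by (simp add: K_def)
  next
    case (Suc n)
    then show ?case unfolding FK F_def using I(1) cont by (intro compact_UN compact_continuous_image) auto
  qed
  have R: "0 \<le> R" using c by (auto simp: R_def intro!: divide_nonneg_pos sum_nonneg)
  have step: "K (Suc 0) \<subseteq> K 0"
  proof
    fix y assume "y \<in> K (Suc 0)"
    then obtain i x where ix: "i \<in> I" "norm x \<le> R" "y = T i x" by (auto simp: K_def F_def)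
    have "norm (T i x) \<le> dist (T i x) (T i 0) + norm (T i 0)"
      by (metis add.commute dist_norm norm_triangle_sub)
    also have "\<dots> \<le> c * norm x + (\<Sum>i\<in>I. norm (T i 0))"
      using lip[OF ix(1), of x 0] member_le_sum[OF ix(1), of "\<lambda>i. norm (T i 0)"] I(1)
      by (intro add_mono) auto
    also have "(\<Sum>i\<in>I. norm (T i 0)) = R * (1 - c)" using c by (simp add: R_def)
    also have "c * norm x + R * (1 - c) \<le> c * R + R * (1 - c)"
      using ix(2) c by (intro add_right_mono mult_left_mono) auto
    also have "\<dots> = R" by (simp add: algebra_simps)
    finally show "y \<in> K 0" using ix by (simp add: K_def)
  qed
  have dec: "K (Suc n) \<subseteq> K n" for n
    by (induction n) (use step mono FK in auto)
  have decm: "K m \<subseteq> K n" if "n \<le> m" for n m using lift_Suc_antimono_le[of K, OF dec that] .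
  have ne: "K n \<noteq> {}" for n
  proof (induction n)
    case 0 then show ?case using R by (simp add: K_def)
  next
    case (Suc n) then show ?case using I(2) by (auto simp: FK F_def)
  qed
  define X where "X = (\<Inter>n. K n)"
  have "X \<noteq> {}" unfolding X_def by (rule compact_nest) (use comp ne decm in auto)
  moreover have "compact X" unfolding X_def using comp by (intro compact_Inter) auto
  moreover have "X = F X"
  proof
    show "F X \<subseteq> X"
    proof -
      have "F X \<subseteq> K n" for n
      proof -
        have "F X \<subseteq> F (K n)" by (intro mono) (auto simp: X_def)
        then show ?thesis using dec[of n] FK by blast
      qed
      then show ?thesis by (auto simp: X_def)
    qed
    show "X \<subseteq> F X"
    proof
      fix x assume x: "x \<in> X"
      have "\<exists>i\<in>I. \<forall>n. K n \<inter> T i -` {x} \<noteq> {}"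
      proof (rule ccontr)
        assume "\<not> ?thesis"
        then have "\<forall>i\<in>I. \<exists>n. K n \<inter> T i -` {x} = {}" by blast
        then obtain m where m: "\<And>i. i \<in> I \<Longrightarrow> K (m i) \<inter> T i -` {x} = {}" by metis
        define M where "M = Max (m ` I)"
        have "K M \<subseteq> K (m i)" if "i \<in> I" for i using that I by (intro decm) (simp add: M_def)
        then have "x \<notin> F (K M)" using m by (force simp: F_def)
        moreover have "x \<in> K (Suc M)" using x by (simp add: X_def)
        ultimately show False by (simp add: FK)
      qed
      then obtain i where i: "i \<in> I" "\<And>n. K n \<inter> T i -` {x} \<noteq> {}" by blast
      have "compact (K n \<inter> T i -` {x})" for n
        using closed_vimage[OF closed_singleton cont[OF i(1), of UNIV]] comp[of n] by (intro compact_Int_closed) auto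
      then have "(\<Inter>n. K n \<inter> T i -` {x}) \<noteq> {}" using i(2) by (intro compact_nest) (use decm in blast)+
      then obtain y where "y \<in> X" "T i y = x" by (auto simp: X_def)
      then show "x \<in> F X" using i(1) by (auto simp: F_def)
    qed
  qed
  ultimately show ?thesis unfolding F_def by blast
qed

lemma attractor_properties:
  fixes T :: "'i \<Rightarrow> 'a::euclidean_space \<Rightarrow> 'a"
  assumes I: "finite I" "I \<noteq> {}"
    and lip: "\<And>i x y. i \<in> I \<Longrightarrow> dist (T i x) (T i y) \<le> c * dist x y" and c: "0 \<le> c" "c < 1"
  shows "compact (attractor I T)" "attractor I T \<noteq> {}"
    "attractor I T = (\<Union>i\<in>I. T i ` attractor I T)"
proof -
  let ?P = "\<lambda>X. compact X \<and> X \<noteq> {} \<and> X = (\<Union>i\<in>I. T i ` X)"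
  have "\<exists>!X. ?P X"
  proof (rule ex_ex1I)
    show "\<exists>X. ?P X" using invariant_compact_exists[OF I lip c] .
    fix X Y assume "?P X" "?P Y"
    then have XY: "bounded X" "closed X" "X \<noteq> {}" "X = (\<Union>i\<in>I. T i ` X)"
      "bounded Y" "closed Y" "Y \<noteq> {}" "Y = (\<Union>i\<in>I. T i ` Y)"
      by (auto dest: compact_imp_bounded compact_imp_closed)
    show "X = Y"
      using invariant_subset_of_invariant[of I T c X Y, OF lip c XY(1,4,6,7,8)]
        invariant_subset_of_invariant[of I T c Y X, OF lip c XY(5,8,2,3,4)] by (intro antisym)
  qed
  from theI'[OF this] show "compact (attractor I T)" "attractor I T \<noteq> {}"
    "attractor I T = (\<Union>i\<in>I. T i ` attractor I T)" unfolding attractor_def by blast+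
qed


section \<open>Lower bounds for the dimension from Riesz energies\<close>

text \<open>
  The kernel $t^{-s}$ as an extended number, so that its value at \<open>0\<close> is infinite and
  coinciding points have infinite energy.
\<close>

definition riesz :: "real \<Rightarrow> real \<Rightarrow> ennreal" where
  "riesz s t = inverse (ennreal (t powr s))"

lemma riesz_ge:
  assumes "0 \<le> t" "t \<le> b" "0 < b" "0 \<le> s"
  shows "ennreal (1 / b powr s) \<le> riesz s t"
proof -
  show ?thesis
  proof (cases "t = 0")
    case True then show ?thesis by (simp add: riesz_def)
  next
    case False
    then have "t powr s \<le> b powr s" using assms by (intro powr_mono2) auto
    then show ?thesis unfolding riesz_def using assms False
      by (subst inverse_ennreal) (auto intro!: ennreal_leI simp: divide_simps)
  qed
qed

text \<open>
  Enlarging the covering sets to open balls makes compactness available. The radius is chosen by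
  its \<open>s\<close>-th power, so that a set of diameter zero also gets a positive radius.
\<close>

lemma ball_cover_diam_power:
  fixes C :: "'a::metric_space set"
  assumes "bounded C" "diameter C \<le> 1" "0 \<le> s'" "s' \<le> s" "0 < s" "0 < e"
  shows "\<exists>c d. 0 < d \<and> C \<subseteq> ball c d \<and> ennreal (d powr s) \<le> diam_power s' C + ennreal e"
proof (cases "C = {}")
  case True
  have "(e powr (1 / s)) powr s = e" using assms by (simp add: powr_powr)
  then show ?thesis using True assms by (intro exI[of _ undefined] exI[of _ "e powr (1 / s)"]) auto
next
  case False
  then obtain c where c: "c \<in> C" by blast
  define D where "D = diameter C"
  have D: "0 \<le> D" "D \<le> 1" using assms by (auto simp: D_def diameter_ge_0)
  define d where "d = (D powr s + e) powr (1 / s)"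
  have ds: "d powr s = D powr s + e" using assms by (simp add: d_def powr_powr add_nonneg_pos)
  have d0: "0 < d" using assms by (simp add: d_def) (metis add_nonneg_pos less_irrefl powr_ge_zero)
  have "D < d"
  proof (rule ccontr)
    assume "\<not> D < d"
    then have "d powr s \<le> D powr s" using d0 assms by (intro powr_mono2) auto
    then show False using ds assms by simp
  qed
  have sub: "C \<subseteq> ball c d"
  proof
    fix x assume "x \<in> C"
    then have "dist c x \<le> D" unfolding D_def using diameter_bounded_bound assms(1) c by blast
    then show "x \<in> ball c d" using \<open>D < d\<close> by simp
  qed
  have "ennreal (D powr s) \<le> diam_power s' C"
  proof (cases "s' = 0 \<or> D = 0")
    case True
    then show ?thesis
    proof
      assume "s' = 0"
      have "D powr s \<le> 1 powr s" using D assms by (intro powr_mono2) auto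
      then show ?thesis using \<open>s' = 0\<close> False by (simp add: diam_power_def ennreal_le_1)
    qed simp
  next
    case False2: False
    then have "D powr s \<le> D powr s'" using D assms by (intro powr_mono') auto
    then show ?thesis using False2 False by (simp add: diam_power_def D_def ennreal_leI)
  qed
  then have "ennreal (d powr s) \<le> diam_power s' C + ennreal e"
    using assms by (simp add: ds ennreal_plus add_right_mono)
  then show ?thesis using d0 sub by blast
qed

lemma ball_cover_of_null_measure:
  fixes X :: "'a::metric_space set"
  assumes "hausdorff_measure s' X = 0" "0 \<le> s'" "s' \<le> s" "0 < s" "0 < \<eta>"
  shows "\<exists>c d. (\<forall>n::nat. 0 < d n) \<and> X \<subseteq> (\<Union>n. ball (c n) (d n)) \<and>
     (\<forall>F. finite F \<longrightarrow> (\<Sum>n\<in>F. d n powr s) \<le> \<eta>)"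
proof -
  have "hausdorff_premeasure s' 1 X \<le> hausdorff_measure s' X"
    unfolding hausdorff_measure_def by (intro SUP_upper) auto
  then have "hausdorff_premeasure s' 1 X < ennreal (\<eta> / 2)" using assms by simp
  then obtain C where C: "X \<subseteq> (\<Union>n. C n)" "\<And>n. bounded (C n)" "\<And>n. diameter (C n) \<le> 1"
    "(\<Sum>n. diam_power s' (C n)) < ennreal (\<eta> / 2)"
    unfolding hausdorff_premeasure_def Inf_less_iff by blast
  have "\<exists>c d. 0 < d \<and> C n \<subseteq> ball c d \<and> ennreal (d powr s) \<le> diam_power s' (C n) + ennreal (\<eta> / 2 * (1/2) ^ Suc n)" for n
    using assms C by (intro ball_cover_diam_power) auto
  then obtain c d where cd: "\<And>n. 0 < d n" "\<And>n. C n \<subseteq> ball (c n) (d n)"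
    "\<And>n. ennreal (d n powr s) \<le> diam_power s' (C n) + ennreal (\<eta> / 2 * (1/2) ^ Suc n)" by metis
  have "(\<Sum>n\<in>F. d n powr s) \<le> \<eta>" if F: "finite F" for F
  proof -
    have "ennreal (\<Sum>n\<in>F. d n powr s) = (\<Sum>n\<in>F. ennreal (d n powr s))" by simp
    also have "\<dots> \<le> (\<Sum>n\<in>F. diam_power s' (C n)) + (\<Sum>n\<in>F. ennreal (\<eta> / 2 * (1/2) ^ Suc n))"
      unfolding sum.distrib[symmetric] using cd(3) by (intro sum_mono) auto
    also have "\<dots> \<le> (\<Sum>n. diam_power s' (C n)) + (\<Sum>n. ennreal (\<eta> / 2 * (1/2) ^ Suc n))"
      using F by (intro add_mono sum_le_suminf) auto
    also have "(\<Sum>n. ennreal (\<eta> / 2 * (1/2) ^ Suc n)) = ennreal (\<eta> / 2)"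
    proof -
      have "(\<lambda>n. \<eta> / 2 * (1/2) ^ Suc n) sums (\<eta> / 2 * 1)"
        by (intro sums_mult power_half_series)
      then show ?thesis using assms(5)
        by (subst suminf_ennreal2) (auto simp: sums_iff)
    qed
    also have "(\<Sum>n. diam_power s' (C n)) + ennreal (\<eta> / 2) \<le> ennreal (\<eta> / 2) + ennreal (\<eta> / 2)"
      using C(4) by (intro add_right_mono) auto
    also have "\<dots> = ennreal \<eta>" using assms(5) by (simp add: ennreal_plus[symmetric] del: ennreal_plus)
    finally show ?thesis using assms(5) by (simp add: ennreal_le_iff)
  qed
  moreover have "X \<subseteq> (\<Union>n. ball (c n) (d n))" using C(1) cd(2) by blast
  ultimately show ?thesis using cd(1) by blast
qed

text \<open>
  The energy is not normalised: for \<open>N\<close> points, the energy of the uniform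
  distribution is this sum divided by $N^2$.
\<close>

definition energy :: "real \<Rightarrow> 'w set \<Rightarrow> ('w \<Rightarrow> 'a::metric_space) \<Rightarrow> ennreal" where
  "energy s P x = (\<Sum>w\<in>P. \<Sum>v\<in>P. if w = v then 0 else riesz s (dist (x w) (x v)))"

text \<open>
  At least half of the points have a potential of at most twice the average. Among these points,
  the ones in a ball of radius \<open>d\<close> lie within \<open>2 d\<close> of each other, so
  there can be only about $M N (2 d)^s$ of them. Summing over the balls bounds the total number of
  points.
\<close>

lemma card_le_of_energy:
  fixes x :: "'w \<Rightarrow> 'a::metric_space"
  assumes P: "finite P" "P \<noteq> {}" and M: "0 < M" and s: "0 < s"
    and en: "energy s P x \<le> ennreal (M * (real (card P))^2)"
    and F: "finite F" "\<And>k. k \<in> F \<Longrightarrow> 0 < d k" "x ` P \<subseteq> (\<Union>k\<in>F. ball (c k) (d k))"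
  shows "real (card P) \<le> 2 * (real (card F) + 2 * M * card P * 2 powr s * (\<Sum>k\<in>F. d k powr s))"
proof -
  define N where "N = real (card P)"
  have N: "0 < N" using P by (simp add: N_def card_gt_0_iff)
  define V where "V w = (\<Sum>v\<in>P. if w = v then 0 else riesz s (dist (x w) (x v)))" for w
  define Gd where "Gd = {w\<in>P. V w \<le> ennreal (2 * M * N)}"
  have Gd: "Gd \<subseteq> P" "finite Gd" using P by (auto simp: Gd_def)
  have half: "N \<le> 2 * real (card Gd)"
  proof (rule ccontr)
    assume "\<not> ?thesis"
    then have bad: "N < 2 * real (card (P - Gd))"
      using Gd P card_mono[OF P(1) Gd(1)] by (simp add: card_Diff_subset N_def of_nat_diff)
    have "ennreal (M * N^2) < ennreal (real (card (P - Gd)) * (2 * M * N))"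
      using bad M N by (intro ennreal_lessI) (auto simp: power2_eq_square)
    also have "\<dots> = (\<Sum>w\<in>P - Gd. ennreal (2 * M * N))"
      using M N by (simp add: ennreal_mult ennreal_of_nat_eq_real_of_nat)
    also have "\<dots> \<le> (\<Sum>w\<in>P - Gd. V w)" by (intro sum_mono) (auto simp: Gd_def)
    also have "\<dots> \<le> (\<Sum>w\<in>P. V w)" using P by (intro sum_mono2) auto
    also have "\<dots> \<le> ennreal (M * N^2)" using en by (simp add: energy_def V_def N_def)
    finally show False by simp
  qed
  define G where "G k = {w\<in>Gd. x w \<in> ball (c k) (d k)}" for k
  have GP: "finite (G k)" "G k \<subseteq> P" for k using Gd by (auto simp: G_def)
  have Gk: "real (card (G k)) \<le> 1 + 2 * M * N * 2 powr s * d k powr s" if k: "k \<in> F" for k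
  proof (cases "G k = {}")
    case True then show ?thesis using M N by simp
  next
    case False
    then obtain w where w: "w \<in> G k" by blast
    have dk: "0 < d k" using F k by simp
    have "ennreal (real (card (G k - {w})) * (1 / (2 * d k) powr s)) = (\<Sum>v\<in>G k - {w}. ennreal (1 / (2 * d k) powr s))"
      by (subst ennreal_mult) (auto simp: ennreal_of_nat_eq_real_of_nat)
    also have "\<dots> \<le> (\<Sum>v\<in>G k - {w}. if w = v then 0 else riesz s (dist (x w) (x v)))"
    proof (rule sum_mono)
      fix v assume v: "v \<in> G k - {w}"
      have "dist (x w) (x v) \<le> dist (c k) (x w) + dist (c k) (x v)" by (metis dist_commute dist_triangle2)
      then have "dist (x w) (x v) \<le> 2 * d k" using v w by (auto simp: G_def)
      then show "ennreal (1 / (2 * d k) powr s) \<le> (if w = v then 0 else riesz s (dist (x w) (x v)))"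
        using v dk s by (auto intro!: riesz_ge)
    qed
    also have "\<dots> \<le> V w" unfolding V_def using P GP by (intro sum_mono2) auto
    also have "\<dots> \<le> ennreal (2 * M * N)" using w by (simp add: G_def Gd_def)
    finally have "real (card (G k - {w})) * (1 / (2 * d k) powr s) \<le> 2 * M * N"
      using M N by (simp add: ennreal_le_iff)
    then have "real (card (G k - {w})) \<le> 2 * M * N * (2 * d k) powr s"
      using dk by (simp add: divide_simps)
    moreover have "(2 * d k) powr s = 2 powr s * d k powr s" using dk by (simp add: powr_mult)
    moreover have "real (card (G k)) = 1 + real (card (G k - {w}))"
      using w GP card_Suc_Diff1 by (metis of_nat_Suc)
    ultimately show ?thesis by (simp add: mult_ac)
  qed
  have "Gd \<subseteq> (\<Union>k\<in>F. G k)" using F(3) Gd(1) by (force simp: G_def)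
  then have "card Gd \<le> card (\<Union>k\<in>F. G k)" using F GP by (intro card_mono) auto
  also have "\<dots> \<le> (\<Sum>k\<in>F. card (G k))" using F by (intro card_UN_le)
  finally have "real (card Gd) \<le> (\<Sum>k\<in>F. real (card (G k)))" by (metis of_nat_mono of_nat_sum)
  also have "\<dots> \<le> (\<Sum>k\<in>F. 1 + 2 * M * N * 2 powr s * d k powr s)" by (intro sum_mono Gk)
  also have "\<dots> = real (card F) + 2 * M * N * 2 powr s * (\<Sum>k\<in>F. d k powr s)"
    by (simp add: sum.distrib sum_distrib_left)
  finally show ?thesis using half by (simp add: N_def)
qed

text \<open>
  This is the energy criterion for a lower bound of the dimension, with finite sets of points that
  approach \<open>X\<close> in place of a measure on \<open>X\<close>. If \<open>X\<close> had a
  cheap cover, finitely many of its balls would contain all points of a late set, and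
  \<open>card_le_of_energy\<close> would bound the number of these points.
\<close>

lemma hausdorff_dim_ge_of_energy:
  fixes X :: "'a::metric_space set" and x :: "nat \<Rightarrow> 'w \<Rightarrow> 'a"
  assumes X: "compact X" and s: "0 < s" and fin: "\<And>n. finite (P n)"
    and card: "filterlim (\<lambda>n. card (P n)) at_top sequentially"
    and near: "\<And>U. open U \<Longrightarrow> X \<subseteq> U \<Longrightarrow> eventually (\<lambda>n. x n ` P n \<subseteq> U) sequentially"
    and en: "frequently (\<lambda>n. energy s (P n) (x n) \<le> ennreal (M * (real (card (P n)))^2)) sequentially"
    and M: "0 < M"
  shows "ennreal s \<le> hausdorff_dim X"
  unfolding hausdorff_dim_def
proof (rule Inf_greatest, clarify)
  fix s' :: real assume s': "0 \<le> s'" "hausdorff_measure s' X = 0"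
  show "ennreal s \<le> ennreal s'"
  proof (rule ccontr)
    assume "\<not> ?thesis"
    then have "s' \<le> s" using ennreal_leI by (metis linorder_le_cases)
    (* With this bound the balls can account for at most half of the points. *)
    define \<eta> where "\<eta> = 1 / (8 * M * 2 powr s)"
    have \<eta>: "0 < \<eta>" using M by (simp add: \<eta>_def)
    from ball_cover_of_null_measure[OF s'(2,1) \<open>s' \<le> s\<close> s \<eta>] obtain c d where
      cd: "\<And>n::nat. 0 < d n" "X \<subseteq> (\<Union>n. ball (c n) (d n))"
        "\<And>F. finite F \<Longrightarrow> (\<Sum>n\<in>F. d n powr s) \<le> \<eta>" by blast
    obtain F where F: "finite F" "X \<subseteq> (\<Union>n\<in>F. ball (c n) (d n))"
      using compactE_image[OF X, of UNIV "\<lambda>n. ball (c n) (d n)"] cd(2) by auto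
    have "eventually (\<lambda>n. x n ` P n \<subseteq> (\<Union>n\<in>F. ball (c n) (d n))) sequentially"
      using F by (intro near) auto
    moreover have "eventually (\<lambda>n. 4 * card F + 1 \<le> card (P n)) sequentially"
      using card by (simp add: filterlim_at_top)
    ultimately have "frequently (\<lambda>n. energy s (P n) (x n) \<le> ennreal (M * (real (card (P n)))^2) \<and>
      x n ` P n \<subseteq> (\<Union>n\<in>F. ball (c n) (d n)) \<and> 4 * card F + 1 \<le> card (P n)) sequentially"
      by (intro frequently_eventually_frequently[OF en] eventually_conj)
    then obtain n where n: "energy s (P n) (x n) \<le> ennreal (M * (real (card (P n)))^2)"
      "x n ` P n \<subseteq> (\<Union>n\<in>F. ball (c n) (d n))" "4 * card F + 1 \<le> card (P n)"
      by (metis (no_types, lifting) frequently_ex)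
    have "P n \<noteq> {}" using n(3) by auto
    define N where "N = real (card (P n))"
    have "N \<le> 2 * (real (card F) + 2 * M * N * 2 powr s * (\<Sum>k\<in>F. d k powr s))"
      unfolding N_def using card_le_of_energy[OF fin \<open>P n \<noteq> {}\<close> M s n(1) F(1) cd(1) n(2)] .
    also have "\<dots> \<le> 2 * (real (card F) + 2 * M * N * 2 powr s * \<eta>)"
      using cd(3)[OF F(1)] M by (intro mult_left_mono add_left_mono) (auto simp: N_def)
    also have "2 * M * N * 2 powr s * \<eta> = N / 4" using M by (simp add: \<eta>_def)
    finally have "N \<le> 4 * real (card F)" by simp
    then show False using n(3) unfolding N_def by linarith
  qed
qed

section \<open>Riesz integrals over slabs\<close>

text \<open>
  The cells are the level sets of the rounded coordinates. The set \<open>Z\<close> is arbitrary,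
  so that the same lemma serves for slabs and for sums of cylinders.
\<close>

lemma grid_cover:
  fixes \<phi> :: "'a \<Rightarrow> 'k \<Rightarrow> real"
  assumes S: "finite S" and bd: "\<And>x q. x \<in> Z \<Longrightarrow> q \<in> S \<Longrightarrow> \<bar>\<phi> x q\<bar> \<le> r" and \<rho>: "0 < \<rho>" "\<rho> \<le> r"
  shows "\<exists>P. finite P \<and> Z = \<Union>P \<and> {} \<notin> P \<and> real (card P) \<le> (4 * r / \<rho>) ^ card S \<and>
           (\<forall>C\<in>P. \<forall>x\<in>C. \<forall>y\<in>C. \<forall>q\<in>S. \<bar>\<phi> x q - \<phi> y q\<bar> \<le> \<rho>)"
proof -
  define cell where "cell x = restrict (\<lambda>q. \<lfloor>\<phi> x q / \<rho>\<rfloor>) S" for x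
  define L where "L = \<lfloor>r / \<rho>\<rfloor>"
  define B where "B = S \<rightarrow>\<^sub>E {- L - 1..L}"
  have L: "1 \<le> L" using \<rho> by (simp add: L_def)
  have cellB: "cell x \<in> B" if x: "x \<in> Z" for x
  proof -
    have "\<lfloor>\<phi> x q / \<rho>\<rfloor> \<in> {- L - 1..L}" if q: "q \<in> S" for q
    proof -
      have 1: "\<phi> x q / \<rho> \<le> r / \<rho>" "- (r / \<rho>) \<le> \<phi> x q / \<rho>"
        using bd[OF x q] \<rho> by (auto simp: field_simps abs_le_iff)
      have "\<lfloor>\<phi> x q / \<rho>\<rfloor> \<le> L" using 1 unfolding L_def by (intro floor_mono)
      moreover have "- L - 1 \<le> \<lfloor>\<phi> x q / \<rho>\<rfloor>"
        unfolding le_floor_iff L_def using 1 by simp linarith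
      ultimately show ?thesis by simp
    qed
    then show ?thesis by (auto simp: cell_def B_def)
  qed
  have finB: "finite B" unfolding B_def using S by (intro finite_PiE) auto
  have cardB: "real (card B) \<le> (4 * r / \<rho>) ^ card S"
  proof -
    have "card B = nat (2 * L + 2) ^ card S"
      unfolding B_def using S by (simp add: card_PiE algebra_simps)
    moreover have "real (nat (2 * L + 2)) \<le> 4 * r / \<rho>"
    proof -
      have "real_of_int L \<le> r / \<rho>" by (simp add: L_def)
      moreover have "1 \<le> r / \<rho>" using \<rho> by simp
      ultimately show ?thesis using L by simp
    qed
    ultimately show ?thesis by (simp add: power_mono)
  qed
  define P where "P = (\<lambda>b. {x\<in>Z. cell x = b}) ` (cell ` Z)"
  have sub: "cell ` Z \<subseteq> B" using cellB by blast
  have finP: "finite P" using finite_subset[OF sub finB] by (simp add: P_def)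
  have "card P \<le> card (cell ` Z)" unfolding P_def by (intro card_image_le finite_subset[OF sub finB])
  also have "\<dots> \<le> card B" using sub finB by (intro card_mono)
  finally have "real (card P) \<le> (4 * r / \<rho>) ^ card S" using cardB by linarith
  moreover have "\<bar>\<phi> x q - \<phi> y q\<bar> \<le> \<rho>" if C: "C \<in> P" "x \<in> C" "y \<in> C" "q \<in> S" for C x y q
  proof -
    have "cell x = cell y" using C by (auto simp: P_def)
    then have "\<lfloor>\<phi> x q / \<rho>\<rfloor> = \<lfloor>\<phi> y q / \<rho>\<rfloor>" using C(4) by (metis cell_def restrict_apply')
    then have "\<bar>\<phi> x q / \<rho> - \<phi> y q / \<rho>\<bar> < 1" by linarith
    then have "\<bar>(\<phi> x q - \<phi> y q) / \<rho>\<bar> < 1" by (simp add: diff_divide_distrib)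
    then show ?thesis using \<rho> by (simp add: abs_divide)
  qed
  moreover have "Z = \<Union>P" "{} \<notin> P" by (auto simp: P_def)
  ultimately show ?thesis using finP by blast
qed

lemma norm_le_card_mult:
  fixes x :: "real ^ 'k::finite"
  assumes "\<And>i. \<bar>x $ i\<bar> \<le> t"
  shows "norm x \<le> real CARD('k) * t"
proof -
  have "norm x \<le> (\<Sum>i\<in>UNIV. \<bar>x $ i\<bar>)" by (rule norm_le_l1_cart)
  also have "\<dots> \<le> (\<Sum>i\<in>(UNIV::'k set). t)" by (intro sum_mono assms)
  finally show ?thesis by simp
qed

text \<open>
  The slab is covered by cells of mesh \<open>\<rho>\<close> in the coordinates outside
  \<open>S\<close>. On one cell all coordinates of $\Phi x$ vary by at most $2 \rho$, so the cell
  lies in a ball of radius $O(\rho)$. The constant depends on \<open>\<Phi>\<close> only through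
  the bounds on \<open>\<Phi>\<close> and its inverse.
\<close>

lemma slab_measure:
  fixes S :: "'k::finite set"
  assumes R: "1 \<le> R" and \<kappa>: "1 \<le> \<kappa>"
  shows "\<exists>C\<ge>0. \<forall>\<Phi> c \<rho>. linear \<Phi> \<longrightarrow> (\<forall>x::real^'k. norm x \<le> \<kappa> * norm (\<Phi> x :: real^'k)) \<longrightarrow>
     (\<forall>x. norm (\<Phi> x) \<le> \<kappa> * norm x) \<longrightarrow> 0 < \<rho> \<longrightarrow> \<rho> \<le> 1 \<longrightarrow>
     {x\<in>cball 0 R. \<forall>q\<in>S. \<bar>(\<Phi> x + c) $ q\<bar> \<le> \<rho>} \<in> sets borel \<longrightarrow>
     emeasure lborel {x\<in>cball 0 R. \<forall>q\<in>S. \<bar>(\<Phi> x + c) $ q\<bar> \<le> \<rho>} \<le> ennreal (C * \<rho> ^ card S)"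
proof -
  define d where "d = CARD('k)"
  define V where "V = unit_ball_vol (real DIM(real^'k))"
  define C where "C = (4 * (\<kappa> * R)) ^ card (- S) * (V * (2 * d * \<kappa>) ^ d)"
  have V: "0 \<le> V" by (simp add: V_def)
  have dS: "d = card (- S) + card S" unfolding d_def by (metis Compl_disjoint2 Compl_partition card_Un_disjoint finite sup_commute)
  have "emeasure lborel {x\<in>cball 0 R. \<forall>q\<in>S. \<bar>(\<Phi> x + c) $ q\<bar> \<le> \<rho>} \<le> ennreal (C * \<rho> ^ card S)"
    if lin: "linear \<Phi>" and lo: "\<And>x::real^'k. norm x \<le> \<kappa> * norm (\<Phi> x :: real^'k)"
      and up: "\<And>x. norm (\<Phi> x) \<le> \<kappa> * norm x" and \<rho>: "0 < \<rho>" "\<rho> \<le> 1" for \<Phi> c \<rho>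
  proof -
    define Z where "Z = {x\<in>cball 0 R. \<forall>q\<in>S. \<bar>(\<Phi> x + c) $ q\<bar> \<le> \<rho>}"
    have "\<bar>\<Phi> x $ q\<bar> \<le> \<kappa> * R" if "x \<in> Z" for x q
    proof -
      have "\<bar>\<Phi> x $ q\<bar> \<le> norm (\<Phi> x)" by (rule component_le_norm_cart)
      also have "\<dots> \<le> \<kappa> * norm x" by (rule up)
      also have "\<dots> \<le> \<kappa> * R" using that \<kappa> by (intro mult_left_mono) (auto simp: Z_def)
      finally show ?thesis .
    qed
    moreover have "\<rho> \<le> \<kappa> * R" using \<rho> mult_mono[OF \<kappa> R] \<kappa> by simp
    ultimately obtain P where P: "finite P" "Z = \<Union>P" "{} \<notin> P"
      "real (card P) \<le> (4 * (\<kappa> * R) / \<rho>) ^ card (- S)"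
      "\<And>C x y q. C \<in> P \<Longrightarrow> x \<in> C \<Longrightarrow> y \<in> C \<Longrightarrow> q \<in> - S \<Longrightarrow> \<bar>\<Phi> x $ q - \<Phi> y $ q\<bar> \<le> \<rho>"
      using grid_cover[of "- S" Z "\<lambda>x q. \<Phi> x $ q" "\<kappa> * R" \<rho>] \<rho> by (auto simp: ac_simps)
    define rr where "rr = 2 * d * \<kappa> * \<rho>"
    have rr: "0 \<le> rr" using \<kappa> \<rho> by (simp add: rr_def)
    have "\<exists>z. C \<subseteq> cball z rr" if C: "C \<in> P" for C
    proof -
      obtain z where z: "z \<in> C" using P(3) C by fastforce
      have "C \<subseteq> cball z rr"
      proof
        fix x assume x: "x \<in> C"
        have "\<bar>\<Phi> (z - x) $ q\<bar> \<le> 2 * \<rho>" for q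
        proof (cases "q \<in> S")
          case True
          have "x \<in> Z" "z \<in> Z" using x z C P(2) by auto
          then have "\<bar>(\<Phi> x + c) $ q\<bar> \<le> \<rho>" "\<bar>(\<Phi> z + c) $ q\<bar> \<le> \<rho>" using True by (auto simp: Z_def)
          then show ?thesis by (simp add: linear_diff[OF lin])
        next
          case False
          then show ?thesis using P(5)[OF C z x, of q] \<rho> by (simp add: linear_diff[OF lin])
        qed
        then have "norm (\<Phi> (z - x)) \<le> d * (2 * \<rho>)" unfolding d_def by (rule norm_le_card_mult)
        then have "\<kappa> * norm (\<Phi> (z - x)) \<le> \<kappa> * (d * (2 * \<rho>))" using \<kappa> by (intro mult_left_mono) auto
        then show "x \<in> cball z rr" using lo[of "z - x"] by (simp add: dist_norm rr_def mult_ac)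
      qed
      then show ?thesis ..
    qed
    then obtain z where z: "\<And>C. C \<in> P \<Longrightarrow> C \<subseteq> cball (z C) rr" by metis
    have "emeasure lborel Z \<le> emeasure lborel (\<Union>C\<in>P. cball (z C) rr)"
      using z P by (intro emeasure_mono) (auto intro!: sets.finite_UN)
    also have "\<dots> \<le> (\<Sum>C\<in>P. emeasure lborel (cball (z C) rr))"
      using P by (intro emeasure_subadditive_finite) auto
    also have "\<dots> = ennreal (real (card P) * (V * rr ^ d))"
      using rr V by (simp add: emeasure_cball V_def d_def ennreal_mult ennreal_of_nat_eq_real_of_nat)
    also have "\<dots> \<le> ennreal (C * \<rho> ^ card S)"
    proof (rule ennreal_leI)
      have "real (card P) * (V * rr ^ d) \<le> (4 * (\<kappa> * R) / \<rho>) ^ card (- S) * (V * rr ^ d)"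
        using P(4) V rr by (intro mult_right_mono) auto
      also have "\<dots> = C * \<rho> ^ card S"
      proof -
        have "rr ^ d = (2 * d * \<kappa>) ^ d * (\<rho> ^ card (- S) * \<rho> ^ card S)"
          unfolding rr_def power_mult_distrib[of _ \<rho>] power_add[symmetric] dS[symmetric] ..
        then show ?thesis using \<rho> by (simp add: C_def power_divide field_simps)
      qed
      finally show "real (card P) * (V * rr ^ d) \<le> C * \<rho> ^ card S" .
    qed
    finally show ?thesis unfolding Z_def .
  qed
  moreover have "0 \<le> C" using \<kappa> R V by (simp add: C_def)
  ultimately show ?thesis by blast
qed

lemma riesz_le_dyadic:
  assumes "0 < s" "0 \<le> t"
  shows "riesz s t \<le> 1 + (\<Sum>j. ennreal (2 powr (s * Suc j)) * indicator {..(1/2)^j} t)"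
proof -
  let ?f = "\<lambda>j. ennreal (2 powr (s * Suc j)) * indicator {..(1/2::real)^j} t"
  consider "t = 0" | "1 \<le> t" | "0 < t" "t < 1" using assms by linarith
  then show ?thesis
  proof cases
    case 1
    have "of_nat n \<le> (\<Sum>j. ?f j)" for n
    proof -
      have "of_nat n = (\<Sum>j<n. 1::ennreal)" by simp
      also have "\<dots> \<le> (\<Sum>j<n. ?f j)"
      proof (rule sum_mono)
        fix j
        have "1 \<le> 2 powr (s * Suc j)" using assms by (intro ge_one_powr_ge_zero) auto
        then have "ennreal 1 \<le> ennreal (2 powr (s * Suc j))" by (rule ennreal_leI)
        then show "1 \<le> ?f j" using 1 by simp
      qed
      also have "\<dots> \<le> (\<Sum>j. ?f j)" by (intro sum_le_suminf) auto
      finally show ?thesis .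
    qed
    then have "(SUP n. of_nat n) \<le> (\<Sum>j. ?f j)" by (intro SUP_least)
    then show ?thesis by (simp add: ennreal_SUP_of_nat_eq_top top_unique)
  next
    case 2
    then have "1 \<le> t powr s" using assms by (intro ge_one_powr_ge_zero) auto
    then have "riesz s t \<le> ennreal 1" unfolding riesz_def
      by (subst inverse_ennreal) (auto simp: divide_simps intro!: ennreal_leI simp del: ennreal_1)
    then show ?thesis by (simp add: add_increasing2)
  next
    case 3
    define j where "j = nat \<lfloor>- log 2 t\<rfloor>"
    have "0 \<le> - log 2 t" using 3 by (simp add: log_def divide_simps)
    then have j: "real j \<le> - log 2 t" "- log 2 t < real (Suc j)" by (auto simp: j_def) linarith+
    have t: "2 powr (log 2 t) = t" using 3 by (intro powr_log_cancel) auto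
    have "t \<le> 2 powr (- real j)" using j(1) powr_mono[of "log 2 t" "- real j" 2] t by simp
    then have tj: "t \<le> (1/2)^j" by (simp only: powr_minus_divide powr_realpow zero_less_numeral power_one_over)
    have "2 powr (- real (Suc j)) \<le> t" using j(2) powr_mono[of "- real (Suc j)" "log 2 t" 2] t by simp
    then have "(2 powr (- real (Suc j))) powr s \<le> t powr s" using assms by (intro powr_mono2) auto
    then have "2 powr (- (s * real (Suc j))) \<le> t powr s" by (simp only: powr_powr mult.commute mult_minus_left mult_minus_right)
    then have "inverse (t powr s) \<le> 2 powr (s * real (Suc j))"
      using 3 by (simp add: powr_minus inverse_eq_divide divide_simps mult.commute)
    then have "riesz s t \<le> ennreal (2 powr (s * Suc j))" unfolding riesz_def
      using 3 by (subst inverse_ennreal) (auto intro!: ennreal_leI)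
    also have "\<dots> = ?f j" using tj by simp
    also have "\<dots> \<le> (\<Sum>j. ?f j)"
    proof -
      have "h j \<le> (\<Sum>j. h j)" for h :: "nat \<Rightarrow> ennreal" using sum_le_suminf[of h "{j}"] by simp
      then show ?thesis .
    qed
    finally show ?thesis by (simp add: add_increasing)
  qed
qed

text \<open>
  The sets on which \<open>f\<close> is at most \<open>2 ^ (- j)\<close> have measure $O(2^{-j
  |S|})$ by \<open>slab_measure\<close>, while the kernel is of order $2^{j s}$ there. The
  resulting series converges because $s < |S|$.
\<close>

lemma riesz_integral_bound:
  fixes S :: "'k::finite set" and s :: real
  assumes R: "1 \<le> R" and \<kappa>: "1 \<le> \<kappa>" and s: "0 < s" "s < card S"
  shows "\<exists>C\<ge>0. \<forall>\<Phi> c f. linear \<Phi> \<longrightarrow> (\<forall>x::real^'k. norm x \<le> \<kappa> * norm (\<Phi> x :: real^'k)) \<longrightarrow>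
     (\<forall>x. norm (\<Phi> x) \<le> \<kappa> * norm x) \<longrightarrow> f \<in> borel_measurable borel \<longrightarrow>
     (\<forall>x. 0 \<le> f x) \<longrightarrow> (\<forall>x. \<forall>q\<in>S. \<bar>(\<Phi> x + c) $ q\<bar> \<le> f x) \<longrightarrow>
     (\<integral>\<^sup>+x. indicator (cball 0 R) x * riesz s (f x) \<partial>lborel) \<le> ennreal C"
proof -
  obtain C0 where C0: "0 \<le> C0"
   "\<And>\<Phi> c \<rho>. linear \<Phi> \<Longrightarrow> (\<forall>x::real^'k. norm x \<le> \<kappa> * norm (\<Phi> x :: real^'k)) \<Longrightarrow>
     (\<forall>x. norm (\<Phi> x) \<le> \<kappa> * norm x) \<Longrightarrow> 0 < \<rho> \<Longrightarrow> \<rho> \<le> 1 \<Longrightarrow>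
     {x\<in>cball 0 R. \<forall>q\<in>S. \<bar>(\<Phi> x + c) $ q\<bar> \<le> \<rho>} \<in> sets borel \<Longrightarrow>
     emeasure lborel {x\<in>cball 0 R. \<forall>q\<in>S. \<bar>(\<Phi> x + c) $ q\<bar> \<le> \<rho>} \<le> ennreal (C0 * \<rho> ^ card S)"
    using slab_measure[OF R \<kappa>, of S] by blast
  define V where "V = measure lborel (cball (0::real^'k) R)"
  define \<theta> where "\<theta> = 2 powr (s - card S)"
  have "2 powr (s - real (card S)) < 2 powr 0" using s(2) by (intro powr_less_mono) auto
  then have \<theta>: "0 < \<theta>" "\<theta> < 1" by (simp_all only: \<theta>_def powr_zero_eq_one) auto
  define C where "C = V + 2 powr s * C0 * (1 / (1 - \<theta>))"
  have V: "emeasure lborel (cball (0::real^'k) R) = ennreal V" "0 \<le> V"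
    using emeasure_lborel_cball_finite[of "0::real^'k" R]
    by (auto simp: V_def emeasure_eq_ennreal_measure)
  have "(\<integral>\<^sup>+x. indicator (cball 0 R) x * riesz s (f x) \<partial>lborel) \<le> ennreal C"
    if hyp: "linear \<Phi>" "\<forall>x::real^'k. norm x \<le> \<kappa> * norm (\<Phi> x :: real^'k)"
     "\<forall>x. norm (\<Phi> x) \<le> \<kappa> * norm x" "f \<in> borel_measurable borel"
     "\<forall>x. 0 \<le> f x" "\<forall>x. \<forall>q\<in>S. \<bar>(\<Phi> x + c) $ q\<bar> \<le> f x" for \<Phi> c f
  proof -
    note hyp(4)[measurable]
    define a where "a j = ennreal (2 powr (s * Suc j))" for j :: nat
    define E where "E j = {x\<in>cball 0 R. f x \<le> (1/2::real)^j}" for j :: nat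
    have Em[measurable]: "E j \<in> sets borel" for j unfolding E_def by measurable
    have "indicator (cball 0 R) x * riesz s (f x) \<le> indicator (cball 0 R) x + (\<Sum>j. a j * indicator (E j) x)" for x
    proof -
      have "indicator (cball 0 R) x * riesz s (f x) \<le>
        indicator (cball 0 R) x * (1 + (\<Sum>j. a j * indicator {..(1/2)^j} (f x)))"
        unfolding a_def using hyp(5) s by (intro mult_left_mono riesz_le_dyadic) auto
      also have "\<dots> = indicator (cball 0 R) x + (\<Sum>j. a j * indicator (E j) x)"
        by (auto simp: indicator_def E_def)
      finally show ?thesis .
    qed
    then have "(\<integral>\<^sup>+x. indicator (cball 0 R) x * riesz s (f x) \<partial>lborel) \<le>
       (\<integral>\<^sup>+x. indicator (cball 0 R) x + (\<Sum>j. a j * indicator (E j) x) \<partial>lborel)"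
      by (intro nn_integral_mono)
    also have "\<dots> = ennreal V + (\<Sum>j. a j * emeasure lborel (E j))"
      by (subst nn_integral_add) (auto simp: nn_integral_suminf nn_integral_cmult V intro!: borel_measurable_indicator)
    also have "\<dots> \<le> ennreal V + (\<Sum>j. ennreal (2 powr s * C0 * \<theta> ^ j))"
    proof (intro add_left_mono suminf_le)
      fix j
      let ?Z = "{x\<in>cball 0 R. \<forall>q\<in>S. \<bar>(\<Phi> x + c) $ q\<bar> \<le> (1/2)^j}"
      have "\<Phi> \<in> borel_measurable borel"
        using hyp(1) by (intro borel_measurable_continuous_onI linear_continuous_on) (simp add: linear_linear)
      then have "(\<lambda>x. (\<Phi> x + c) $ q) \<in> borel_measurable borel" for q
        by (intro measurable_compose[OF _ borel_measurable_nth] borel_measurable_add) auto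
      note this[measurable]
      have Z: "?Z \<in> sets borel" by measurable
      have "emeasure lborel (E j) \<le> emeasure lborel ?Z"
      proof (rule emeasure_mono)
        show "E j \<subseteq> ?Z"
        proof
          fix x assume x: "x \<in> E j"
          then have "\<bar>(\<Phi> x + c) $ q\<bar> \<le> (1/2)^j" if "q \<in> S" for q
            using hyp(6) that order_trans[of "\<bar>(\<Phi> x + c) $ q\<bar>" "f x"] unfolding E_def by blast
          then show "x \<in> ?Z" using x by (simp add: E_def)
        qed
      qed (use Z in simp)
      also have "\<dots> \<le> ennreal (C0 * ((1/2)^j) ^ card S)"
        by (rule C0(2)[OF hyp(1,2,3) _ _ Z]) (simp_all add: power_le_one)
      finally have "a j * emeasure lborel (E j) \<le> a j * ennreal (C0 * ((1/2)^j) ^ card S)"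
        by (intro mult_left_mono) auto
      also have "\<dots> = ennreal (2 powr (s * Suc j) * (C0 * ((1/2)^j) ^ card S))"
        unfolding a_def by (rule ennreal_mult[symmetric]) (use C0(1) in auto)
      also have "2 powr (s * Suc j) * (C0 * ((1/2)^j) ^ card S) = 2 powr s * C0 * \<theta> ^ j"
      proof -
        have "((1/2::real)^j) ^ card S = 1 / 2 ^ (j * card S)" by (metis power_mult power_one_over)
        also have "\<dots> = 2 powr (- (real (j * card S)))"
          by (simp only: powr_minus_divide powr_realpow zero_less_numeral)
        finally have "((1/2::real)^j) ^ card S = 2 powr (- real j * card S)" by simp
        moreover have "\<theta> ^ j = 2 powr ((s - card S) * j)"
          using powr_realpow[OF \<theta>(1), of j] unfolding \<theta>_def powr_powr by simp
        ultimately show ?thesis by (simp add: powr_add[symmetric] algebra_simps)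
      qed
      finally show "a j * emeasure lborel (E j) \<le> ennreal (2 powr s * C0 * \<theta> ^ j)" .
    qed auto
    also have "(\<Sum>j. ennreal (2 powr s * C0 * \<theta> ^ j)) = ennreal (2 powr s * C0 * (1 / (1 - \<theta>)))"
      using \<theta> C0(1) geometric_sums[of \<theta>]
      by (subst suminf_ennreal2) (auto intro!: sums_mult simp: sums_iff suminf_mult summable_mult)
    also have "ennreal V + ennreal (2 powr s * C0 * (1 / (1 - \<theta>))) = ennreal C"
      unfolding C_def using V C0(1) \<theta> by (intro ennreal_plus[symmetric]) auto
    finally show ?thesis .
  qed
  moreover have "0 \<le> C" unfolding C_def using V C0(1) \<theta> by auto
  ultimately show ?thesis by blast
qed

section \<open>Cylinder points as functions of the translations\<close>

fun mprod :: "('i \<Rightarrow> real^'k^'k) \<Rightarrow> 'i list \<Rightarrow> real^'k^'k" where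
  "mprod A [] = mat 1"
| "mprod A (i # w) = A i ** mprod A w"

abbreviation pt :: "('i \<Rightarrow> real^'k^'k) \<Rightarrow> ('i \<Rightarrow> real^'k) \<Rightarrow> 'i list \<Rightarrow> real^'k::finite" where
  "pt A u w \<equiv> word_map (affine_maps A u) w 0"

lemma word_map_affine: "word_map (affine_maps A u) w x = mprod A w *v x + pt A u w"
  by (induction w) (auto simp: affine_maps_def matrix_vector_mul_assoc[symmetric] matrix_vector_right_distrib)

lemma mprod_snoc: "mprod A (p @ [i]) = mprod A p ** A i"
  by (induction p) (auto simp: matrix_mul_assoc)

text \<open>
  The linear part of the dependence of the point $T_w(0)$ on the translation with index
  \<open>i\<close>, see \<open>pt_update\<close>.
\<close>

fun influence :: "('i \<Rightarrow> real^'k^'k) \<Rightarrow> 'i \<Rightarrow> 'i list \<Rightarrow> real^'k \<Rightarrow> real^'k" where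
  "influence A i [] x = 0"
| "influence A i (a # w) x = A a *v influence A i w x + (if a = i then x else 0)"

lemma pt_update: "pt A (u(i := x)) w = pt A (u(i := 0)) w + influence A i w x"
  by (induction w) (auto simp: affine_maps_def matrix_vector_right_distrib)

lemma linear_influence: "linear (influence A i w)"
proof (induction w)
  case Nil then show ?case by (simp add: linear_iff)
next
  case (Cons a w)
  then show ?case by (auto simp: linear_iff matrix_vector_right_distrib matrix_vector_mult_scaleR scaleR_add_right)
qed

text \<open>
  The letter \<open>i\<close> contributes at most one term per position, and the contributions
  decay like powers of 1/8; their sum is 8/7.
\<close>

lemma norm_influence:
  assumes "\<And>i x. i \<in> I \<Longrightarrow> norm (A i *v x) \<le> norm x / 8" "set w \<subseteq> I"
  shows "norm (influence A i w x) \<le> 8 / 7 * norm x"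
  using assms(2)
proof (induction w)
  case (Cons a w)
  have "norm (influence A i (a # w) x) \<le> norm (A a *v influence A i w x) + norm (if a = i then x else 0)"
    by (simp only: influence.simps norm_triangle_ineq)
  also have "\<dots> \<le> (8 / 7 * norm x) / 8 + norm x"
    using Cons assms(1)[of a "influence A i w x"] by (intro add_mono) auto
  finally show ?case by simp
qed simp

lemma measurable_pt[measurable]:
  assumes "set w \<subseteq> I"
  shows "(\<lambda>u. pt A u w) \<in> borel_measurable (\<Pi>\<^sub>M i\<in>I. lborel)"
  using assms
proof (induction w)
  case (Cons a w)
  have [measurable]: "(*v) (A a) \<in> borel_measurable borel"
    by (intro borel_measurable_continuous_onI matrix_vector_mult_linear_continuous_on)
  have [measurable]: "(\<lambda>u. u a) \<in> borel_measurable (\<Pi>\<^sub>M i\<in>I. lborel)"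
    using Cons.prems measurable_component_singleton[of a I "\<lambda>_. lborel"] by simp
  have "(\<lambda>u. pt A u w) \<in> borel_measurable (\<Pi>\<^sub>M i\<in>I. lborel)" using Cons by simp
  note this[measurable]
  have "(\<lambda>u. A a *v pt A u w + u a) \<in> borel_measurable (\<Pi>\<^sub>M i\<in>I. lborel)"
    by (intro borel_measurable_add measurable_compose[where f = "\<lambda>u. pt A u w" and g = "(*v) (A a)"]) measurable
  moreover have "(\<lambda>u. pt A u (a # w)) = (\<lambda>u. A a *v pt A u w + u a)" by (rule ext) (simp add: affine_maps_def)
  ultimately show ?case by simp
qed simp

lemma borel_measurable_riesz[measurable]: "riesz s \<in> borel_measurable borel"
  unfolding riesz_def[abs_def] by measurable

text \<open>
  After a change of coordinates \<open>G\<close> with uniform bounds, the product along a word of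
  length \<open>k\<close> contracts the coordinates in \<open>S\<close> by no more than the factor
  $r^k$. For $s \le |S|$ this replaces the singular value function $\varphi^s$ by the simpler
  lower bound $r^{k s}$.
\<close>

definition minor_bounded_below :: "('i \<Rightarrow> real^'k^'k) \<Rightarrow> 'i set \<Rightarrow> 'k::finite set \<Rightarrow> real \<Rightarrow> real \<Rightarrow> bool" where
  "minor_bounded_below A I S r \<kappa> \<longleftrightarrow> (\<forall>p. set p \<subseteq> I \<longrightarrow>
     (\<exists>G. linear G \<and> (\<forall>x. norm x \<le> \<kappa> * norm (G x)) \<and> (\<forall>x. norm (G x) \<le> \<kappa> * norm x) \<and>
        (\<forall>x. \<forall>q\<in>S. r ^ length p * \<bar>G x $ q\<bar> \<le> norm (mprod A p *v x))))"

lemma riesz_scale: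
  assumes "0 < a" "0 \<le> t"
  shows "riesz s (a * t) = ennreal (1 / a powr s) * riesz s t"
proof (cases "t = 0")
  case True
  then show ?thesis using assms by (simp add: riesz_def ennreal_mult_top)
next
  case False
  then show ?thesis using assms
    by (simp add: riesz_def inverse_ennreal powr_mult ennreal_mult[symmetric] divide_simps)
qed

lemma measurable_pair_kernel:
  assumes "set v \<subseteq> I" "set w \<subseteq> I"
  shows "(\<lambda>u. riesz s (norm (mprod A p *v (pt A u v - pt A u w)))) \<in> borel_measurable (\<Pi>\<^sub>M i\<in>I. lborel)"
proof -
  have "(\<lambda>u. pt A u v - pt A u w) \<in> borel_measurable (\<Pi>\<^sub>M i\<in>I. lborel)"
    using assms by (intro borel_measurable_diff measurable_pt)
  moreover have "(*v) (mprod A p) \<in> borel_measurable borel"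
    by (intro borel_measurable_continuous_onI matrix_vector_mult_linear_continuous_on)
  ultimately have 1: "(\<lambda>u. mprod A p *v (pt A u v - pt A u w)) \<in> borel_measurable (\<Pi>\<^sub>M i\<in>I. lborel)"
    by (rule measurable_compose)
  show ?thesis by (rule measurable_compose[OF measurable_compose[OF 1 borel_measurable_norm] borel_measurable_riesz])
qed

lemma measurable_box_indicator:
  assumes "finite I"
  shows "(\<lambda>u. \<Prod>l\<in>I. indicator (cball 0 R) (u l) :: ennreal) \<in> borel_measurable (\<Pi>\<^sub>M i\<in>I. (lborel :: (real^'k::finite) measure))"
proof (intro borel_measurable_prod_ennreal)
  fix l assume "l \<in> I"
  then have "(\<lambda>u. u l) \<in> borel_measurable (\<Pi>\<^sub>M i\<in>I. (lborel :: (real^'k) measure))"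
    using measurable_component_singleton[of l I "\<lambda>_. lborel"] by simp
  then show "(\<lambda>u. indicator (cball 0 R) (u l) :: ennreal) \<in> borel_measurable (\<Pi>\<^sub>M i\<in>I. (lborel :: (real^'k) measure))"
    by (rule measurable_compose) (auto intro!: borel_measurable_indicator)
qed

lemma powr_power_commute:
  fixes a s :: real
  assumes "0 < a"
  shows "(a powr s) ^ n = (a ^ n) powr s"
proof -
  have "(a ^ n) powr s = a powr (real n * s)" using assms by (metis powr_powr powr_realpow)
  also have "\<dots> = (a powr s) powr real n" by (simp add: powr_powr mult.commute)
  also have "\<dots> = (a powr s) ^ n" using assms by (simp add: powr_realpow)
  finally show ?thesis by simp
qed

text \<open>
  The words $p i v$ and $p j w$ branch after the prefix \<open>p\<close>. In the difference of the
  two points behind the prefix, the translation of \<open>i\<close> enters through $\Psi$, which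
  is close to the identity since all deeper occurrences are contracted by 1/8. So the integral
  over this translation is of the form of \<open>riesz_integral_bound\<close> with $\Phi = G \circ
  \Psi$. The remaining translations contribute the volume of a product of balls.
\<close>

lemma branching_integral_bound:
  fixes A :: "'i \<Rightarrow> real^'k::finite^'k" and s :: real
  assumes I: "finite I" and A: "\<And>i x. i \<in> I \<Longrightarrow> norm (A i *v x) \<le> norm x / 8"
    and S: "0 < s" "s < card S" and em: "minor_bounded_below A I S r \<kappa>" and r: "0 < r" and \<kappa>: "1 \<le> \<kappa>"
    and R: "1 \<le> R"
  shows "\<exists>C\<ge>0. \<forall>p i j v w. set p \<subseteq> I \<longrightarrow> i \<in> I \<longrightarrow> j \<in> I \<longrightarrow> i \<noteq> j \<longrightarrow> set v \<subseteq> I \<longrightarrow> set w \<subseteq> I \<longrightarrow>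
    (\<integral>\<^sup>+u. (\<Prod>l\<in>I. indicator (cball 0 R) (u l)) *
        riesz s (norm (mprod A p *v (pt A u (i # v) - pt A u (j # w)))) \<partial>(\<Pi>\<^sub>M i\<in>I. lborel))
     \<le> ennreal (C * (1 / r powr s) ^ length p)"
proof -
  define \<kappa>' where "\<kappa>' = 2 * \<kappa>"
  have \<kappa>': "1 \<le> \<kappa>'" using \<kappa> by (simp add: \<kappa>'_def)
  obtain C where C: "0 \<le> C" "\<And>\<Phi> c f. linear \<Phi> \<Longrightarrow> (\<forall>x::real^'k. norm x \<le> \<kappa>' * norm (\<Phi> x :: real^'k)) \<Longrightarrow>
     (\<forall>x. norm (\<Phi> x) \<le> \<kappa>' * norm x) \<Longrightarrow> f \<in> borel_measurable borel \<Longrightarrow>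
     (\<forall>x. 0 \<le> f x) \<Longrightarrow> (\<forall>x. \<forall>q\<in>S. \<bar>(\<Phi> x + c) $ q\<bar> \<le> f x) \<Longrightarrow>
     (\<integral>\<^sup>+x. indicator (cball 0 R) x * riesz s (f x) \<partial>lborel) \<le> ennreal C"
    using riesz_integral_bound[OF R \<kappa>' S] by blast
  define V where "V = measure lborel (cball (0::real^'k) R)"
  have V: "emeasure lborel (cball (0::real^'k) R) = ennreal V" "0 \<le> V"
    using emeasure_lborel_cball_finite[of "0::real^'k" R]
    by (auto simp: V_def emeasure_eq_ennreal_measure)
  let ?ind = "indicator (cball 0 R) :: real^'k \<Rightarrow> ennreal"
  interpret product_sigma_finite "\<lambda>_::'i. lborel :: (real^'k) measure" by standard
  have "(\<integral>\<^sup>+u. (\<Prod>l\<in>I. ?ind (u l)) *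
        riesz s (norm (mprod A p *v (pt A u (i # v) - pt A u (j # w)))) \<partial>(\<Pi>\<^sub>M i\<in>I. lborel))
     \<le> ennreal (C * V ^ (card I - 1) * (1 / r powr s) ^ length p)"
    if h: "set p \<subseteq> I" "i \<in> I" "j \<in> I" "i \<noteq> j" "set v \<subseteq> I" "set w \<subseteq> I" for p i j v w
  proof -
    define k where "k = length p"
    obtain G where G: "linear G" "\<And>x. norm x \<le> \<kappa> * norm (G x)" "\<And>x. norm (G x) \<le> \<kappa> * norm x"
      "\<And>x q. q \<in> S \<Longrightarrow> r ^ k * \<bar>G x $ q\<bar> \<le> norm (mprod A p *v x)"
      using em h(1) unfolding minor_bounded_below_def k_def by blast
    define \<Psi> where "\<Psi> x = influence A i (i # v) x - influence A i (j # w) x" for x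
    have linE: "linear \<Psi>" unfolding \<Psi>_def by (intro linear_compose_sub linear_influence)
    have \<Psi>: "norm (\<Psi> x - x) \<le> 2/7 * norm x" for x
    proof -
      have "\<Psi> x - x = A i *v influence A i v x - A j *v influence A i w x" using h by (simp add: \<Psi>_def)
      also have "norm \<dots> \<le> norm (A i *v influence A i v x) + norm (A j *v influence A i w x)"
        by (rule norm_triangle_ineq4)
      also have "\<dots> \<le> (8/7 * norm x) / 8 + (8/7 * norm x) / 8"
        using A[OF h(2), of "influence A i v x"] A[OF h(3), of "influence A i w x"]
          norm_influence[of I A v i x, OF A h(5)] norm_influence[of I A w i x, OF A h(6)] by (intro add_mono) auto
      finally show ?thesis by simp
    qed
    have \<Psi>lo: "norm x \<le> 2 * norm (\<Psi> x)" and \<Psi>up: "norm (\<Psi> x) \<le> 2 * norm x" for x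
      using \<Psi>[of x] norm_triangle_ineq2[of x "\<Psi> x"] norm_triangle_ineq2[of "\<Psi> x" x]
        norm_ge_zero[of x] norm_minus_commute[of x "\<Psi> x"] by linarith+
    define \<Phi> where "\<Phi> = G \<circ> \<Psi>"
    have lin\<Phi>: "linear \<Phi>" unfolding \<Phi>_def using linE G(1) by (rule linear_compose)
    have \<Phi>lo: "norm x \<le> \<kappa>' * norm (\<Phi> x)" for x
      using \<Psi>lo[of x] G(2)[of "\<Psi> x"] by (simp add: \<Phi>_def \<kappa>'_def)
    have \<Phi>up: "norm (\<Phi> x) \<le> \<kappa>' * norm x" for x
    proof -
      have "\<kappa> * norm (\<Psi> x) \<le> \<kappa> * (2 * norm x)" using \<Psi>up \<kappa> by (intro mult_left_mono) auto
      then show ?thesis using G(3)[of "\<Psi> x"] by (simp add: \<Phi>_def \<kappa>'_def)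
    qed
    define D where "D u = pt A u (i # v) - pt A u (j # w)" for u
    have D: "D (u(i := x)) = \<Psi> x + D (u(i := 0))" for u x
      unfolding D_def \<Psi>_def by (subst (1 2) pt_update) (simp add: algebra_simps)
    (* The translation with index i is integrated first, with the others fixed. *)
    define J where "J = I - {i}"
    have IJ: "I = insert i J" "finite J" "i \<notin> J" using h I by (auto simp: J_def)
    let ?K = "\<lambda>u. riesz s (norm (mprod A p *v D u))"
    have inner: "(\<integral>\<^sup>+x. ?ind x * ?K (u(i := x)) \<partial>lborel) \<le> ennreal (C * (1 / r powr s) ^ k)" for u
    proof -
      define f where "f x = norm (mprod A p *v D (u(i := x))) / r ^ k" for x
      have rk: "0 < r ^ k" using r by simp
      have rks: "(r ^ k) powr s = (r powr s) ^ k" using r by (rule powr_power_commute[symmetric])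
      have f0: "0 \<le> f x" for x using r by (simp add: f_def)
      have Df: "\<bar>(\<Phi> x + G (D (u(i := 0)))) $ q\<bar> \<le> f x" if "q \<in> S" for x q
      proof -
        have "\<Phi> x + G (D (u(i := 0))) = G (D (u(i := x)))"
          unfolding \<Phi>_def by (subst D) (simp add: linear_add[OF G(1)])
        then show ?thesis using G(4)[OF that, of "D (u(i := x))"] rk by (simp add: f_def field_simps)
      qed
      have "continuous_on UNIV (\<lambda>x. \<Psi> x + D (u(i := 0)))"
        using linE by (intro continuous_intros linear_continuous_on) (simp add: linear_linear)
      then have "continuous_on UNIV (\<lambda>x. mprod A p *v (\<Psi> x + D (u(i := 0))))"
        by (rule continuous_on_compose2[OF matrix_vector_mult_linear_continuous_on[of UNIV]]) auto
      moreover have f: "f = (\<lambda>x. norm (mprod A p *v (\<Psi> x + D (u(i := 0)))) / r ^ k)"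
        unfolding f_def by (rule ext) (subst D, rule refl)
      ultimately have "continuous_on UNIV f"
        unfolding f using r by (intro continuous_on_divide continuous_on_norm continuous_on_const) auto
      then have fm: "f \<in> borel_measurable borel" by (rule borel_measurable_continuous_onI)
      have fin: "(\<integral>\<^sup>+x. ?ind x * riesz s (f x) \<partial>lborel) \<le> ennreal C"
        by (intro C(2)[where c = "G (D (u(i := 0)))", OF lin\<Phi> _ _ fm] allI ballI) (fact \<Phi>lo \<Phi>up f0 Df)+
      have "?K (u(i := x)) = ennreal (1 / (r ^ k) powr s) * riesz s (f x)" for x
        using r rk f0[of x] by (subst riesz_scale[symmetric]) (auto simp: f_def)
      then have "(\<integral>\<^sup>+x. ?ind x * ?K (u(i := x)) \<partial>lborel) =
         (\<integral>\<^sup>+x. ennreal (1 / (r ^ k) powr s) * (?ind x * riesz s (f x)) \<partial>lborel)"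
        by (simp add: mult_ac)
      also have "\<dots> = ennreal (1 / (r ^ k) powr s) * (\<integral>\<^sup>+x. ?ind x * riesz s (f x) \<partial>lborel)"
        using borel_measurable_times_ennreal[OF borel_measurable_indicator
            measurable_compose[OF fm borel_measurable_riesz], of "cball 0 R" s]
        by (intro nn_integral_cmult) simp
      also have "\<dots> \<le> ennreal (1 / (r ^ k) powr s) * ennreal C" using fin by (intro mult_left_mono) auto
      also have "\<dots> = ennreal (C * (1 / r powr s) ^ k)"
        using C(1) r by (simp add: ennreal_mult[symmetric] rks power_divide)
      finally show ?thesis .
    qed
    have meas: "(\<lambda>u. (\<Prod>l\<in>I. ?ind (u l)) * ?K u) \<in> borel_measurable (\<Pi>\<^sub>M i\<in>I. lborel)"
      unfolding D_def using h
      by (intro borel_measurable_times_ennreal measurable_box_indicator[OF I] measurable_pair_kernel) auto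
    have "(\<integral>\<^sup>+u. (\<Prod>l\<in>I. ?ind (u l)) * ?K u \<partial>(\<Pi>\<^sub>M i\<in>I. lborel)) =
      (\<integral>\<^sup>+u. (\<integral>\<^sup>+x. (\<Prod>l\<in>I. ?ind ((u(i := x)) l)) * ?K (u(i := x)) \<partial>lborel) \<partial>(\<Pi>\<^sub>M i\<in>J. lborel))"
      unfolding IJ(1) by (rule product_nn_integral_insert[OF IJ(2,3)]) (use meas IJ(1) in simp)
    also have "\<dots> = (\<integral>\<^sup>+u. (\<integral>\<^sup>+x. (\<Prod>l\<in>J. ?ind (u l)) * (?ind x * ?K (u(i := x))) \<partial>lborel) \<partial>(\<Pi>\<^sub>M i\<in>J. lborel))"
    proof -
      have "(\<Prod>l\<in>I. ?ind ((u(i := x)) l)) = ?ind x * (\<Prod>l\<in>J. ?ind (u l))" for u x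
      proof -
        have "(\<Prod>l\<in>J. ?ind ((u(i := x)) l)) = (\<Prod>l\<in>J. ?ind (u l))" using IJ(3) by (intro prod.cong) auto
        then show ?thesis unfolding IJ(1) using IJ by simp
      qed
      then show ?thesis by (simp add: mult_ac)
    qed
    also have "\<dots> \<le> (\<integral>\<^sup>+u. (\<Prod>l\<in>J. ?ind (u l)) * ennreal (C * (1 / r powr s) ^ k) \<partial>(\<Pi>\<^sub>M i\<in>J. lborel))"
    proof (rule nn_integral_mono)
      fix u
      define b where "b = (\<Prod>l\<in>J. ?ind (u l))"
      have "b \<in> {0, 1}" unfolding b_def using IJ(2) by (induction J) (auto simp: indicator_def)
      then show "(\<integral>\<^sup>+x. (\<Prod>l\<in>J. ?ind (u l)) * (?ind x * ?K (u(i := x))) \<partial>lborel) \<le>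
        (\<Prod>l\<in>J. ?ind (u l)) * ennreal (C * (1 / r powr s) ^ k)"
        unfolding b_def[symmetric] using inner[of u] by auto
    qed
    also have "\<dots> = (\<Prod>l\<in>J. emeasure lborel (cball (0::real^'k) R)) * ennreal (C * (1 / r powr s) ^ k)"
    proof (subst nn_integral_multc)
      show "(\<lambda>u. \<Prod>l\<in>J. ?ind (u l)) \<in> borel_measurable (\<Pi>\<^sub>M i\<in>J. lborel)"
        by (rule measurable_box_indicator[OF IJ(2)])
    qed (subst product_nn_integral_prod[OF IJ(2)], auto intro!: borel_measurable_indicator)
    also have "\<dots> = ennreal (C * V ^ (card I - 1) * (1 / r powr s) ^ k)"
    proof -
      have "card J = card I - 1" using IJ by simp
      then show ?thesis using V C(1) by (simp add: ennreal_power ennreal_mult[symmetric] mult_ac)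
    qed
    finally show ?thesis unfolding D_def k_def .
  qed
  moreover have "0 \<le> C * V ^ (card I - 1)" using C(1) V by simp
  ultimately show ?thesis by blast
qed


section \<open>Almost sure lower bounds for the dimension of attractors\<close>

lemma sum_word_pairs_le:
  fixes F :: "'i \<Rightarrow> 'i list \<Rightarrow> 'i \<Rightarrow> 'i list \<Rightarrow> ennreal"
  assumes "finite I" "\<And>i v j w. i \<in> I \<Longrightarrow> j \<in> I \<Longrightarrow> v \<in> words I n \<Longrightarrow> w \<in> words I n \<Longrightarrow> F i v j w \<le> ennreal B" "0 \<le> B"
  shows "(\<Sum>i\<in>I. \<Sum>v\<in>words I n. \<Sum>j\<in>I. \<Sum>w\<in>words I n. F i v j w) \<le> ennreal ((real (card I)) ^ (2 * n + 2) * B)"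
proof -
  have "(\<Sum>i\<in>I. \<Sum>v\<in>words I n. \<Sum>j\<in>I. \<Sum>w\<in>words I n. F i v j w) \<le>
    (\<Sum>i\<in>I. \<Sum>v\<in>words I n. \<Sum>j\<in>I. \<Sum>w\<in>words I n. ennreal B)"
    by (intro sum_mono assms)
  also have "\<dots> = of_nat (card I ^ (2 * n + 2)) * ennreal B"
    by (simp add: card_words[OF assms(1)] power_add power_mult power2_eq_square mult_ac power_mult_distrib)
  also have "\<dots> = ennreal ((real (card I)) ^ (2 * n + 2) * B)"
    using assms(3) by (subst ennreal_mult) (simp_all add: ennreal_of_nat_eq_real_of_nat)
  finally show ?thesis .
qed

text \<open>
  The energy of the points of level \<open>n\<close> after they are mapped by the product along
  the prefix \<open>p\<close>. The prefix makes a recursion over \<open>n\<close> possible.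
\<close>

definition pair_energy :: "('i \<Rightarrow> real^'k::finite^'k) \<Rightarrow> 'i set \<Rightarrow> real \<Rightarrow> 'i list \<Rightarrow> nat \<Rightarrow> ('i \<Rightarrow> real^'k) \<Rightarrow> ennreal" where
  "pair_energy A I s p n u = (\<Sum>w\<in>words I n. \<Sum>v\<in>words I n.
     if w = v then 0 else riesz s (norm (mprod A p *v (pt A u w - pt A u v))))"

text \<open>
  Pairs of words either share their first letter, which is then moved to the prefix, or they
  branch at once.
\<close>

lemma pair_energy_Suc:
  assumes I: "finite I"
  shows "pair_energy A I s p (Suc n) u = (\<Sum>i\<in>I. pair_energy A I s (p @ [i]) n u) +
    (\<Sum>i\<in>I. \<Sum>v\<in>words I n. \<Sum>j\<in>I. \<Sum>w\<in>words I n.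
       if i = j then 0 else riesz s (norm (mprod A p *v (pt A u (i # v) - pt A u (j # w)))))"
proof -
  let ?K = "\<lambda>v w. riesz s (norm (mprod A p *v (pt A u v - pt A u w)))"
  let ?X = "\<lambda>i v w. if v = w then 0 else riesz s (norm (mprod A (p @ [i]) *v (pt A u v - pt A u w)))"
  have sumw: "(\<Sum>w\<in>words I (Suc n). H w) = (\<Sum>i\<in>I. \<Sum>v\<in>words I n. H (i # v))" for H :: "'a list \<Rightarrow> ennreal"
    unfolding words_Suc sum.cartesian_product by (subst sum.reindex) (auto simp: inj_on_def split_def)
  have same: "?K (i # v) (i # w) = riesz s (norm (mprod A (p @ [i]) *v (pt A u v - pt A u w)))" for i v w
    by (simp add: affine_maps_def mprod_snoc matrix_vector_mul_assoc[symmetric] matrix_vector_mult_diff_distrib)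
  have "pair_energy A I s p (Suc n) u =
    (\<Sum>i\<in>I. \<Sum>v\<in>words I n. \<Sum>j\<in>I. \<Sum>w\<in>words I n. if i # v = j # w then 0 else ?K (i # v) (j # w))"
    unfolding pair_energy_def sumw ..
  also have "\<dots> = (\<Sum>i\<in>I. \<Sum>v\<in>words I n. \<Sum>j\<in>I. \<Sum>w\<in>words I n.
     (if i = j then ?X i v w else 0) + (if i = j then 0 else ?K (i # v) (j # w)))"
    by (intro sum.cong refl) (use same in auto)
  also have "\<dots> = (\<Sum>i\<in>I. \<Sum>v\<in>words I n. \<Sum>j\<in>I. \<Sum>w\<in>words I n. if i = j then ?X i v w else 0) +
     (\<Sum>i\<in>I. \<Sum>v\<in>words I n. \<Sum>j\<in>I. \<Sum>w\<in>words I n. if i = j then 0 else ?K (i # v) (j # w))"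
    by (simp only: sum.distrib)
  also have "(\<Sum>i\<in>I. \<Sum>v\<in>words I n. \<Sum>j\<in>I. \<Sum>w\<in>words I n. if i = j then ?X i v w else 0) =
     (\<Sum>i\<in>I. pair_energy A I s (p @ [i]) n u)"
    unfolding pair_energy_def
  proof (intro sum.cong refl)
    fix i v assume i: "i \<in> I"
    have "(\<Sum>j\<in>I. \<Sum>w\<in>words I n. if i = j then ?X i v w else 0) =
      (\<Sum>j\<in>I. if i = j then (\<Sum>w\<in>words I n. ?X i v w) else 0)"
      by (intro sum.cong refl) auto
    also have "\<dots> = (\<Sum>w\<in>words I n. ?X i v w)" using I i by simp
    finally show "(\<Sum>j\<in>I. \<Sum>w\<in>words I n. if i = j then ?X i v w else 0) = (\<Sum>w\<in>words I n. ?X i v w)" .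
  qed
  finally show ?thesis .
qed

lemma measurable_pair_energy:
  "pair_energy A I s p n \<in> borel_measurable (\<Pi>\<^sub>M i\<in>I. lborel)"
  unfolding pair_energy_def[abs_def]
proof (intro borel_measurable_sum)
  fix w v assume "w \<in> words I n" "v \<in> words I n"
  then show "(\<lambda>u. if w = v then 0 else riesz s (norm (mprod A p *v (pt A u w - pt A u v))))
    \<in> borel_measurable (\<Pi>\<^sub>M i\<in>I. lborel)"
    by (cases "w = v") (auto simp: words_def intro!: measurable_pair_kernel)
qed

text \<open>
  The pairs that branch after \<open>k\<close> further letters are at most a fraction $|I|^{-k}$
  of all pairs and have expected energy $O(q^k)$ relative to the prefix. The recursion
  \<open>pair_energy_Suc\<close> turns this into a geometric sum.
\<close>

lemma expected_pair_energy_le: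
  fixes A :: "'i \<Rightarrow> real^'k::finite^'k" and q C :: real
  assumes I: "finite I" "I \<noteq> {}" and C: "0 \<le> C" and q: "0 \<le> q"
    and tr: "\<And>p i j v w. set p \<subseteq> I \<Longrightarrow> i \<in> I \<Longrightarrow> j \<in> I \<Longrightarrow> i \<noteq> j \<Longrightarrow> set v \<subseteq> I \<Longrightarrow> set w \<subseteq> I \<Longrightarrow>
      (\<integral>\<^sup>+u. (\<Prod>l\<in>I. indicator (cball 0 R) (u l)) *
          riesz s (norm (mprod A p *v (pt A u (i # v) - pt A u (j # w)))) \<partial>(\<Pi>\<^sub>M i\<in>I. lborel))
       \<le> ennreal (C * q ^ length p)"
    and p: "set p \<subseteq> I"
  shows "(\<integral>\<^sup>+u. (\<Prod>l\<in>I. indicator (cball 0 R) (u l)) * pair_energy A I s p n u \<partial>(\<Pi>\<^sub>M i\<in>I. lborel))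
    \<le> ennreal (C * q ^ length p * real (card I) ^ (2 * n) * (\<Sum>k<n. (q / card I) ^ k))"
  using p
proof (induction n arbitrary: p)
  case 0
  then show ?case by (simp add: pair_energy_def words_0)
next
  case (Suc n)
  let ?B = "\<lambda>u. \<Prod>l\<in>I. indicator (cball 0 R) (u l) :: ennreal"
  let ?M = "\<Pi>\<^sub>M i\<in>I. (lborel :: (real^'k) measure)"
  define N where "N = real (card I)"
  have N: "0 < N" using I by (simp add: N_def card_gt_0_iff)
  define G where "G = (\<Sum>k<n. (q / N) ^ k)"
  have G: "0 \<le> G" unfolding G_def using q N by (intro sum_nonneg) auto
  let ?F = "\<lambda>i v j w u. if i = j then 0 else riesz s (norm (mprod A p *v (pt A u (i # v) - pt A u (j # w))))"
  have Fm: "(\<lambda>u. ?B u * ?F i v j w u) \<in> borel_measurable ?M"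
    if "i \<in> I" "j \<in> I" "v \<in> words I n" "w \<in> words I n" for i v j w
    using that by (cases "i = j")
      (auto simp: words_def simp del: word_map.simps intro!: borel_measurable_times_ennreal measurable_box_indicator[OF I(1)] measurable_pair_kernel)
  have Em: "(\<lambda>u. ?B u * pair_energy A I s (p @ [i]) n u) \<in> borel_measurable ?M" for i
    by (intro borel_measurable_times_ennreal measurable_box_indicator[OF I(1)] measurable_pair_energy)
  have "(\<integral>\<^sup>+u. ?B u * pair_energy A I s p (Suc n) u \<partial>?M) =
    (\<integral>\<^sup>+u. (\<Sum>i\<in>I. ?B u * pair_energy A I s (p @ [i]) n u) +
       (\<Sum>i\<in>I. \<Sum>v\<in>words I n. \<Sum>j\<in>I. \<Sum>w\<in>words I n. ?B u * ?F i v j w u) \<partial>?M)"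
    unfolding pair_energy_Suc[OF I(1)] distrib_left sum_distrib_left ..
  also have "\<dots> = (\<integral>\<^sup>+u. (\<Sum>i\<in>I. ?B u * pair_energy A I s (p @ [i]) n u) \<partial>?M) +
     (\<integral>\<^sup>+u. (\<Sum>i\<in>I. \<Sum>v\<in>words I n. \<Sum>j\<in>I. \<Sum>w\<in>words I n. ?B u * ?F i v j w u) \<partial>?M)"
    by (intro nn_integral_add borel_measurable_sum Em Fm)
  also have "(\<integral>\<^sup>+u. (\<Sum>i\<in>I. ?B u * pair_energy A I s (p @ [i]) n u) \<partial>?M) =
     (\<Sum>i\<in>I. \<integral>\<^sup>+u. ?B u * pair_energy A I s (p @ [i]) n u \<partial>?M)"
    by (intro nn_integral_sum Em)
  also have "(\<integral>\<^sup>+u. (\<Sum>i\<in>I. \<Sum>v\<in>words I n. \<Sum>j\<in>I. \<Sum>w\<in>words I n. ?B u * ?F i v j w u) \<partial>?M) =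
     (\<Sum>i\<in>I. \<Sum>v\<in>words I n. \<Sum>j\<in>I. \<Sum>w\<in>words I n. \<integral>\<^sup>+u. ?B u * ?F i v j w u \<partial>?M)"
  proof -
    have "(\<integral>\<^sup>+u. (\<Sum>i\<in>I. \<Sum>v\<in>words I n. \<Sum>j\<in>I. \<Sum>w\<in>words I n. ?B u * ?F i v j w u) \<partial>?M) =
      (\<Sum>i\<in>I. \<integral>\<^sup>+u. (\<Sum>v\<in>words I n. \<Sum>j\<in>I. \<Sum>w\<in>words I n. ?B u * ?F i v j w u) \<partial>?M)"
      by (intro nn_integral_sum borel_measurable_sum Fm)
    also have "\<dots> = (\<Sum>i\<in>I. \<Sum>v\<in>words I n. \<integral>\<^sup>+u. (\<Sum>j\<in>I. \<Sum>w\<in>words I n. ?B u * ?F i v j w u) \<partial>?M)"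
      by (intro sum.cong refl nn_integral_sum borel_measurable_sum Fm)
    also have "\<dots> = (\<Sum>i\<in>I. \<Sum>v\<in>words I n. \<Sum>j\<in>I. \<integral>\<^sup>+u. (\<Sum>w\<in>words I n. ?B u * ?F i v j w u) \<partial>?M)"
      by (intro sum.cong refl nn_integral_sum borel_measurable_sum Fm)
    also have "\<dots> = (\<Sum>i\<in>I. \<Sum>v\<in>words I n. \<Sum>j\<in>I. \<Sum>w\<in>words I n. \<integral>\<^sup>+u. ?B u * ?F i v j w u \<partial>?M)"
      by (intro sum.cong refl nn_integral_sum Fm)
    finally show ?thesis .
  qed
  also have "(\<Sum>i\<in>I. \<integral>\<^sup>+u. ?B u * pair_energy A I s (p @ [i]) n u \<partial>?M) \<le>
     (\<Sum>i\<in>I. ennreal (C * q ^ Suc (length p) * N ^ (2 * n) * G))"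
  proof (rule sum_mono)
    fix i assume "i \<in> I"
    then have "set (p @ [i]) \<subseteq> I" using Suc.prems by simp
    from Suc.IH[OF this] show "(\<integral>\<^sup>+u. ?B u * pair_energy A I s (p @ [i]) n u \<partial>?M) \<le>
      ennreal (C * q ^ Suc (length p) * N ^ (2 * n) * G)" by (simp add: N_def G_def)
  qed
  also have "\<dots> = ennreal (N * (C * q ^ Suc (length p) * N ^ (2 * n) * G))"
    using C q N G by (subst ennreal_mult) (auto simp: N_def ennreal_of_nat_eq_real_of_nat)
  also have "(\<Sum>i\<in>I. \<Sum>v\<in>words I n. \<Sum>j\<in>I. \<Sum>w\<in>words I n. \<integral>\<^sup>+u. ?B u * ?F i v j w u \<partial>?M) \<le>
     ennreal (N ^ (2 * n + 2) * (C * q ^ length p))"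
    unfolding N_def
  proof (rule sum_word_pairs_le[OF I(1)])
    fix i v j w assume h: "i \<in> I" "j \<in> I" "v \<in> words I n" "w \<in> words I n"
    show "(\<integral>\<^sup>+u. ?B u * ?F i v j w u \<partial>?M) \<le> ennreal (C * q ^ length p)"
    proof (cases "i = j")
      case False
      then show ?thesis using tr[OF Suc.prems h(1,2) False, of v w] h by (simp add: words_def del: word_map.simps)
    qed simp
  qed (use C q in simp)
  also have "ennreal (N * (C * q ^ Suc (length p) * N ^ (2 * n) * G)) + ennreal (N ^ (2 * n + 2) * (C * q ^ length p)) =
    ennreal (N * (C * q ^ Suc (length p) * N ^ (2 * n) * G) + N ^ (2 * n + 2) * (C * q ^ length p))"
    using C q N G by (intro ennreal_plus[symmetric]) auto
  also have "N * (C * q ^ Suc (length p) * N ^ (2 * n) * G) + N ^ (2 * n + 2) * (C * q ^ length p) =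
    C * q ^ length p * N ^ (2 * Suc n) * (1 + q / N * G)"
    using N by (simp add: field_simps power2_eq_square power_add)
  also have "1 + q / N * G = (\<Sum>k<Suc n. (q / N) ^ k)"
    unfolding sum.lessThan_Suc_shift G_def by (simp add: sum_distrib_left)
  finally show ?case unfolding N_def by (simp add: add_right_mono add_left_mono)
qed

text \<open>
  Lebesgue measure on the translations is infinite, so the expectation is taken over bounded
  translations only and the bound is let go to infinity through the natural numbers.
\<close>

lemma AE_hausdorff_dim_attractor_ge:
  fixes A :: "'i \<Rightarrow> real^'k::finite^'k" and s :: real
  assumes I: "finite I" "2 \<le> card I" and A: "\<And>i x. i \<in> I \<Longrightarrow> norm (A i *v x) \<le> norm x / 8"
    and s: "0 < s" "s < card S" and em: "minor_bounded_below A I S r \<kappa>" and r: "0 < r" and \<kappa>: "1 \<le> \<kappa>"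
    and big: "1 < card I * r powr s"
  shows "AE u in (\<Pi>\<^sub>M i\<in>I. lborel). ennreal s \<le> hausdorff_dim (attractor I (affine_maps A u))"
proof -
  let ?M = "\<Pi>\<^sub>M i\<in>I. (lborel :: (real^'k) measure)"
  let ?B = "\<lambda>R u. \<Prod>l\<in>I. indicator (cball 0 R) (u l) :: ennreal"
  define N where "N = real (card I)"
  have N: "2 \<le> N" using I by (simp add: N_def)
  have ne: "I \<noteq> {}" using I by auto
  define E where "E n u = pair_energy A I s [] n u / ennreal (N ^ (2 * n))" for n u
  have AE1: "AE u in ?M. (\<forall>l\<in>I. norm (u l) \<le> R) \<longrightarrow> liminf (\<lambda>n. E n u) \<noteq> \<infinity>" if R: "1 \<le> R" for R :: real
  proof -
    obtain C where C: "0 \<le> C" "\<And>p i j v w. set p \<subseteq> I \<Longrightarrow> i \<in> I \<Longrightarrow> j \<in> I \<Longrightarrow> i \<noteq> j \<Longrightarrow> set v \<subseteq> I \<Longrightarrow> set w \<subseteq> I \<Longrightarrow>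
      (\<integral>\<^sup>+u. ?B R u * riesz s (norm (mprod A p *v (pt A u (i # v) - pt A u (j # w)))) \<partial>?M)
       \<le> ennreal (C * (1 / r powr s) ^ length p)"
      using branching_integral_bound[OF I(1) A s em r \<kappa> R] by blast
    define \<theta> where "\<theta> = (1 / r powr s) / N"
    have \<theta>: "0 \<le> \<theta>" "\<theta> < 1" using big r N by (auto simp: \<theta>_def N_def field_simps)
    have bound: "(\<integral>\<^sup>+u. ?B R u * E n u \<partial>?M) \<le> ennreal (C * (1 / (1 - \<theta>)))" for n
    proof -
      have m: "(\<lambda>u. ?B R u * pair_energy A I s [] n u) \<in> borel_measurable ?M"
        by (intro borel_measurable_times_ennreal measurable_box_indicator[OF I(1)] measurable_pair_energy)
      have "(\<integral>\<^sup>+u. ?B R u * E n u \<partial>?M) = (\<integral>\<^sup>+u. ?B R u * pair_energy A I s [] n u / ennreal (N ^ (2 * n)) \<partial>?M)"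
        by (simp add: E_def ennreal_times_divide)
      also have "\<dots> = (\<integral>\<^sup>+u. ?B R u * pair_energy A I s [] n u \<partial>?M) / ennreal (N ^ (2 * n))"
        using m by (rule nn_integral_divide)
      also have "\<dots> \<le> ennreal (C * real (card I) ^ (2 * n) * (\<Sum>k<n. (1 / r powr s / card I) ^ k)) / ennreal (N ^ (2 * n))"
        
      proof (rule divide_right_mono_ennreal)
        have "0 \<le> 1 / r powr s" by simp
        from expected_pair_energy_le[where R = R and s = s and A = A and p = "[]" and n = n, OF I(1) ne C(1) this C(2)]
        show "(\<integral>\<^sup>+u. ?B R u * pair_energy A I s [] n u \<partial>?M) \<le>
          ennreal (C * real (card I) ^ (2 * n) * (\<Sum>k<n. (1 / r powr s / card I) ^ k))"
          by simp
      qed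
      also have "\<dots> = ennreal (C * (\<Sum>k<n. \<theta> ^ k))"
        unfolding N_def[symmetric] \<theta>_def[symmetric]
        using N C(1) \<theta> by (subst divide_ennreal) (auto simp: sum_nonneg)
      also have "\<dots> \<le> ennreal (C * (1 / (1 - \<theta>)))"
      proof (intro ennreal_leI mult_left_mono C(1))
        have "(\<Sum>k<n. \<theta> ^ k) \<le> (\<Sum>k. \<theta> ^ k)"
          using \<theta> by (intro sum_le_suminf summable_geometric) auto
        then show "(\<Sum>k<n. \<theta> ^ k) \<le> 1 / (1 - \<theta>)" using \<theta> by (simp add: suminf_geometric)
      qed
      finally show ?thesis .
    qed
    have Em: "(\<lambda>u. ?B R u * E n u) \<in> borel_measurable ?M" for n
      unfolding E_def by (intro borel_measurable_times_ennreal measurable_box_indicator[OF I(1)]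
          borel_measurable_divide_ennreal measurable_pair_energy borel_measurable_const)
    have "(\<integral>\<^sup>+u. liminf (\<lambda>n. ?B R u * E n u) \<partial>?M) \<le> liminf (\<lambda>n. \<integral>\<^sup>+u. ?B R u * E n u \<partial>?M)"
      using Em by (rule nn_integral_liminf)
    also have "\<dots> \<le> liminf (\<lambda>n. ennreal (C * (1 / (1 - \<theta>))))"
      using bound by (intro Liminf_mono always_eventually) auto
    also have "\<dots> = ennreal (C * (1 / (1 - \<theta>)))" by (simp add: Liminf_const)
    finally have "(\<integral>\<^sup>+u. liminf (\<lambda>n. ?B R u * E n u) \<partial>?M) \<noteq> \<infinity>" by (auto simp: top_unique)
    moreover have "(\<lambda>u. liminf (\<lambda>n. ?B R u * E n u)) \<in> borel_measurable ?M"
      using Em by (rule borel_measurable_liminf)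
    ultimately have "AE u in ?M. liminf (\<lambda>n. ?B R u * E n u) \<noteq> \<infinity>" by (intro nn_integral_PInf_AE)
    then show ?thesis
    proof (rule AE_mp, intro AE_I2 impI)
      fix u assume fin: "liminf (\<lambda>n. ?B R u * E n u) \<noteq> \<infinity>" and u: "\<forall>l\<in>I. norm (u l) \<le> R"
      have "?B R u = 1" using u by (intro prod.neutral) auto
      then show "liminf (\<lambda>n. E n u) \<noteq> \<infinity>" using fin by simp
    qed
  qed
  have "AE u in ?M. \<forall>m::nat. (\<forall>l\<in>I. norm (u l) \<le> real (Suc m)) \<longrightarrow> liminf (\<lambda>n. E n u) \<noteq> \<infinity>"
    unfolding AE_all_countable using AE1 by auto
  then show ?thesis
  proof (rule AE_mp, intro AE_I2 impI)
    fix u assume fin: "\<forall>m::nat. (\<forall>l\<in>I. norm (u l) \<le> real (Suc m)) \<longrightarrow> liminf (\<lambda>n. E n u) \<noteq> \<infinity>"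
    obtain m :: nat where m: "Max ((\<lambda>l. norm (u l)) ` I) \<le> real m" using real_arch_simple by blast
    have "norm (u l) \<le> real (Suc m)" if "l \<in> I" for l
    proof -
      have "norm (u l) \<le> Max ((\<lambda>l. norm (u l)) ` I)" using I(1) that by (intro Max_ge) auto
      then show ?thesis using m by simp
    qed
    then have "liminf (\<lambda>n. E n u) \<noteq> \<infinity>" using fin by blast
    then obtain M0 where M0: "0 \<le> M0" "liminf (\<lambda>n. E n u) = ennreal M0" by (cases "liminf (\<lambda>n. E n u)") auto
    define M where "M = M0 + 1"
    have freq: "frequently (\<lambda>n. E n u < ennreal M) sequentially"
    proof (rule ccontr)
      assume "\<not> ?thesis"
      then have "eventually (\<lambda>n. ennreal M \<le> E n u) sequentially"
        by (simp add: not_frequently not_less)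
      then have "ennreal M \<le> liminf (\<lambda>n. E n u)" by (rule Liminf_bounded)
      then show False using M0 by (simp add: M_def)
    qed
    let ?T = "affine_maps A u"
    let ?X = "attractor I ?T"
    have lip: "dist (?T i x) (?T i y) \<le> 1 / 8 * dist x y" if "i \<in> I" for i x y
      using A[OF that, of "x - y"]
      by (simp add: affine_maps_def dist_norm matrix_vector_mult_diff_distrib)
    have X: "compact ?X" "?X \<noteq> {}" "?X = (\<Union>i\<in>I. ?T i ` ?X)"
      using attractor_properties[OF I(1) ne, of ?T "1/8"] lip by auto
    show "ennreal s \<le> hausdorff_dim ?X"
    proof (rule hausdorff_dim_ge_of_energy[OF X(1) s(1), where P = "words I" and x = "\<lambda>n. pt A u" and M = M])
      show "finite (words I n)" for n using I by (simp add: finite_words)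
      have "filterlim (\<lambda>n. (2::nat) ^ n) at_top sequentially" 
        by (rule filterlim_at_top_mono[OF filterlim_ident]) (auto intro!: always_eventually less_imp_le)
      then show "filterlim (\<lambda>n. card (words I n)) at_top sequentially"
        by (rule filterlim_at_top_mono) (auto simp: card_words[OF I(1)] power_mono I(2))
      show "0 < M" using M0 by (simp add: M_def)
      show "\<exists>\<^sub>F n in sequentially. energy s (words I n) (pt A u) \<le> ennreal (M * (real (card (words I n)))\<^sup>2)"
        using freq
      proof (rule frequently_elim1)
        fix n assume *: "E n u < ennreal M"
        have Nn: "0 < N ^ (2 * n)" using N by simp
        have "energy s (words I n) (pt A u) = pair_energy A I s [] n u"
          unfolding energy_def pair_energy_def dist_norm mprod.simps matrix_vector_mul_lid ..
        also have "\<dots> = E n u * ennreal (N ^ (2 * n))"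
          using Nn unfolding E_def by (metis ennreal_divide_times ennreal_eq_0_iff ennreal_neq_top
              ennreal_mult_divide_eq ennreal_times_divide not_le)
        also have "\<dots> \<le> ennreal M * ennreal (N ^ (2 * n))" using * by (intro mult_right_mono) auto
        also have "\<dots> = ennreal (M * N ^ (2 * n))" using Nn M0 by (simp add: ennreal_mult M_def)
        also have "N ^ (2 * n) = (real (card (words I n)))\<^sup>2"
          unfolding card_words[OF I(1)] N_def of_nat_power power_mult[symmetric] by (simp only: mult.commute)
        finally show "energy s (words I n) (pt A u) \<le> ennreal (M * (real (card (words I n)))\<^sup>2)" .
      qed
      fix U :: "(real^'k) set" assume U: "open U" "?X \<subseteq> U"
      obtain e where e: "0 < e" "(\<Union>x\<in>?X. ball x e) \<subseteq> U"
        using compact_subset_open_imp_ball_epsilon_subset[OF X(1) U] .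
      obtain y where y: "y \<in> ?X" using X(2) by blast
      have "(\<lambda>n. (1/8) ^ n * norm y) \<longlonglongrightarrow> 0 * norm y"
        by (intro tendsto_intros LIMSEQ_realpow_zero) auto
      then have "eventually (\<lambda>n. (1/8) ^ n * norm y < e) sequentially"
        using e(1) by (auto dest: order_tendstoD(2))
      then show "eventually (\<lambda>n. pt A u ` words I n \<subseteq> U) sequentially"
      proof (rule eventually_mono, intro image_subsetI)
        fix n w assume n: "(1/8) ^ n * norm y < e" and w: "w \<in> words I n"
        have "word_map ?T w y \<in> (\<Union>w\<in>words I n. word_map ?T w ` ?X)" using w y by blast
        then have "word_map ?T w y \<in> ?X" by (simp only: invariant_set_words[OF X(3), of n, symmetric])
        then have "ball (word_map ?T w y) e \<subseteq> U" using e(2) by blast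
        moreover have "dist (word_map ?T w y) (pt A u w) \<le> (1/8) ^ n * dist y 0"
          using lip w by (intro word_map_lipschitz[of I]) auto
        then have "pt A u w \<in> ball (word_map ?T w y) e" using n by simp
        ultimately show "pt A u w \<in> U" by blast
      qed
    qed
  qed
qed

section \<open>Products of matrices close to a coordinate projection\<close>

text \<open>
  Distance in the operator norm for the supremum norm. This norm is used throughout for products
  of matrices, because bounds for two factors multiply under tensor products.
\<close>

definition row_close :: "real \<Rightarrow> real^'m::finite^'m \<Rightarrow> real^'m^'m \<Rightarrow> bool" where
  "row_close \<beta> g g0 \<longleftrightarrow> (\<forall>i. (\<Sum>j\<in>UNIV. \<bar>g $ i $ j - g0 $ i $ j\<bar>) \<le> \<beta>)"

lemma row_close_apply:
  assumes "row_close \<beta> g g0" "\<And>j. \<bar>x $ j\<bar> \<le> t"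
  shows "\<bar>(g *v x) $ i - (g0 *v x) $ i\<bar> \<le> \<beta> * t"
proof -
  have t: "0 \<le> t" using assms(2) by (meson abs_ge_zero order_trans)
  have "(g *v x) $ i - (g0 *v x) $ i = (\<Sum>j\<in>UNIV. (g $ i $ j - g0 $ i $ j) * x $ j)"
    by (simp add: matrix_vector_mult_def sum_subtractf algebra_simps)
  also have "\<bar>\<dots>\<bar> \<le> (\<Sum>j\<in>UNIV. \<bar>(g $ i $ j - g0 $ i $ j) * x $ j\<bar>)" by (rule sum_abs)
  also have "\<dots> \<le> (\<Sum>j\<in>UNIV. \<bar>g $ i $ j - g0 $ i $ j\<bar> * t)"
    unfolding abs_mult using assms(2) by (intro sum_mono mult_left_mono) auto
  also have "\<dots> \<le> \<beta> * t"
    unfolding sum_distrib_right[symmetric] using assms(1) t by (intro mult_right_mono) (auto simp: row_close_def)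
  finally show ?thesis .
qed

definition coord_proj :: "'m::finite \<Rightarrow> real^'m^'m" where
  "coord_proj c = (\<chi> i j. if i = c \<and> j = c then 1 else 0)"

lemma coord_proj_apply: "(coord_proj c *v x) $ i = (if i = c then x $ c else 0)"
proof -
  have "(coord_proj c *v x) $ i = (\<Sum>j\<in>UNIV. if j = c then (if i = c then x $ c else 0) else 0)"
    unfolding coord_proj_def matrix_vector_mult_def by (simp only: vec_lambda_beta) (intro sum.cong, auto)
  then show ?thesis by simp
qed

lemma transpose_coord_proj: "transpose (coord_proj c) = coord_proj c"
  by (auto simp: coord_proj_def transpose_def vec_eq_iff)

text \<open>
  Rows and columns are both controlled, since the cone argument is needed for the matrix and for
  its transpose.
\<close>

definition near_proj :: "'m::finite \<Rightarrow> real \<Rightarrow> real^'m^'m \<Rightarrow> bool" where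
  "near_proj c \<beta> g \<longleftrightarrow> row_close \<beta> g (coord_proj c) \<and> row_close \<beta> (transpose g) (coord_proj c)"

lemma near_proj_transpose: "near_proj c \<beta> (transpose g) \<longleftrightarrow> near_proj c \<beta> g"
  by (auto simp: near_proj_def)

definition near_id :: "real \<Rightarrow> real^'m::finite^'m \<Rightarrow> bool" where
  "near_id \<beta> h \<longleftrightarrow> row_close \<beta> h (mat 1)"

text \<open>
  The cone around the axis \<open>c\<close>. Matrices near \<open>coord_proj c\<close> map it into
  itself.
\<close>

definition dominant :: "'m::finite \<Rightarrow> real^'m \<Rightarrow> bool" where
  "dominant c x \<longleftrightarrow> (\<forall>i. \<bar>x $ i\<bar> \<le> \<bar>x $ c\<bar>)"

lemma near_proj_apply:
  assumes "near_proj c \<beta> g" "\<And>j. \<bar>x $ j\<bar> \<le> t"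
  shows "\<bar>(g *v x) $ i - (if i = c then x $ c else 0)\<bar> \<le> \<beta> * t"
  using row_close_apply[of \<beta> g "coord_proj c" x t i] assms by (simp add: near_proj_def coord_proj_apply)

lemma near_id_apply:
  assumes "near_id \<beta> g" "\<And>j. \<bar>x $ j\<bar> \<le> t"
  shows "\<bar>(g *v x) $ i - x $ i\<bar> \<le> \<beta> * t"
  using row_close_apply[of \<beta> g "mat 1" x t i] assms by (simp add: near_id_def)

lemma near_proj_dominant:
  assumes g: "near_proj c \<beta> g" and \<beta>: "\<beta> \<le> 1/2" and x: "dominant c x"
  shows "dominant c (g *v x)" "\<bar>x $ c\<bar> / 2 \<le> \<bar>(g *v x) $ c\<bar>"
proof -
  have *: "\<bar>(g *v x) $ i - (if i = c then x $ c else 0)\<bar> \<le> \<bar>x $ c\<bar> / 2" for i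
  proof -
    have "\<bar>(g *v x) $ i - (if i = c then x $ c else 0)\<bar> \<le> \<beta> * \<bar>x $ c\<bar>"
      using x by (intro near_proj_apply[OF g]) (auto simp: dominant_def)
    also have "\<dots> \<le> 1/2 * \<bar>x $ c\<bar>" using \<beta> by (intro mult_right_mono) auto
    finally show ?thesis by simp
  qed
  show 1: "\<bar>x $ c\<bar> / 2 \<le> \<bar>(g *v x) $ c\<bar>" using *[of c] by (simp add: abs_if split: if_splits)
  show "dominant c (g *v x)" unfolding dominant_def
  proof
    fix i show "\<bar>(g *v x) $ i\<bar> \<le> \<bar>(g *v x) $ c\<bar>"
      using *[of i] 1 by (cases "i = c") auto
  qed
qed

text \<open>
  All coordinates of $g x$ except the one at \<open>c\<close> are small. If the largest coordinate
  is not at \<open>c\<close>, then all of them are small.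
\<close>

lemma near_proj_not_dominant:
  assumes g: "near_proj c \<beta> g" and x: "\<And>j. \<bar>x $ j\<bar> \<le> t" and nd: "\<not> dominant c (g *v x)"
  shows "\<bar>(g *v x) $ i\<bar> \<le> \<beta> * t"
proof -
  have *: "\<bar>(g *v x) $ i\<bar> \<le> \<beta> * t" if "i \<noteq> c" for i
    using near_proj_apply[OF g x, of i] that by simp
  obtain k where k: "\<bar>(g *v x) $ c\<bar> < \<bar>(g *v x) $ k\<bar>" using nd by (auto simp: dominant_def not_le)
  then have "k \<noteq> c" by auto
  then show ?thesis using *[of k] *[of i] k by (cases "i = c") auto
qed

lemma mprod_Cons_apply: "mprod g (i # w) *v x = g i *v (mprod g w *v x)"
  by (simp add: matrix_vector_mul_assoc)

text \<open>
  Once an image vector lies in the cone it stays there. As long as it does not, each factor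
  contracts by \<open>\<beta>\<close>.
\<close>

lemma mprod_dominant_or_small:
  assumes g: "\<And>i. i \<in> I \<Longrightarrow> near_proj c \<beta> (g i)" and \<beta>: "0 \<le> \<beta>" "\<beta> \<le> 1/2"
    and w: "set w \<subseteq> I" and x: "\<And>j. \<bar>x $ j\<bar> \<le> t"
  shows "dominant c (mprod g w *v x) \<or> (\<forall>i. \<bar>(mprod g w *v x) $ i\<bar> \<le> \<beta> ^ length w * t)"
  using w
proof (induction w)
  case Nil then show ?case using x by simp
next
  case (Cons a w)
  let ?y = "mprod g w *v x"
  have ga: "near_proj c \<beta> (g a)" using g Cons.prems by simp
  show ?case
  proof (cases "dominant c ?y")
    case True then show ?thesis using near_proj_dominant(1)[OF ga \<beta>(2)] unfolding mprod_Cons_apply by blast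
  next
    case False
    then have y: "\<And>i. \<bar>?y $ i\<bar> \<le> \<beta> ^ length w * t" using Cons by auto
    show ?thesis using near_proj_not_dominant[OF ga y] by (auto simp only: mprod_Cons_apply list.size power_Suc add_Suc_right add_0_right mult.assoc)
  qed
qed

lemma mprod_dominant:
  assumes g: "\<And>i. i \<in> I \<Longrightarrow> near_proj c \<beta> (g i)" and \<beta>: "\<beta> \<le> 1/2"
    and w: "set w \<subseteq> I" and x: "dominant c x"
  shows "dominant c (mprod g w *v x)" "\<bar>x $ c\<bar> * (1/2) ^ length w \<le> \<bar>(mprod g w *v x) $ c\<bar>"
proof -
  have "dominant c (mprod g w *v x) \<and> \<bar>x $ c\<bar> * (1/2) ^ length w \<le> \<bar>(mprod g w *v x) $ c\<bar>"
    using w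
  proof (induction w)
    case Nil then show ?case using x by simp
  next
    case (Cons a w)
    have ga: "near_proj c \<beta> (g a)" using g Cons.prems by simp
    have IH: "dominant c (mprod g w *v x)" "\<bar>x $ c\<bar> * (1/2) ^ length w \<le> \<bar>(mprod g w *v x) $ c\<bar>"
      using Cons by auto
    then show ?case using near_proj_dominant[OF ga \<beta> IH(1)] by (simp only: mprod_Cons_apply) simp
  qed
  then show "dominant c (mprod g w *v x)" "\<bar>x $ c\<bar> * (1/2) ^ length w \<le> \<bar>(mprod g w *v x) $ c\<bar>" by auto
qed

lemma mprod_transpose_dominant:
  assumes g: "\<And>i. i \<in> I \<Longrightarrow> near_proj c \<beta> (g i)" and \<beta>: "\<beta> \<le> 1/2"
    and w: "set w \<subseteq> I" and x: "dominant c x"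
  shows "dominant c (transpose (mprod g w) *v x) \<and> \<bar>x $ c\<bar> * (1/2) ^ length w \<le> \<bar>(transpose (mprod g w) *v x) $ c\<bar>"
  using w x
proof (induction w arbitrary: x)
  case Nil then show ?case by (simp add: transpose_mat)
next
  case (Cons a w)
  have ga: "near_proj c \<beta> (transpose (g a))" using g Cons.prems by (simp add: near_proj_transpose)
  have eq: "transpose (mprod g (a # w)) *v x = transpose (mprod g w) *v (transpose (g a) *v x)"
    by (simp only: mprod.simps matrix_transpose_mul matrix_vector_mul_assoc)
  have 1: "dominant c (transpose (g a) *v x)" "\<bar>x $ c\<bar> / 2 \<le> \<bar>(transpose (g a) *v x) $ c\<bar>"
    using near_proj_dominant[OF ga \<beta> Cons.prems(2)] .
  have "(\<bar>x $ c\<bar> / 2) * (1/2) ^ length w \<le> \<bar>(transpose (g a) *v x) $ c\<bar> * (1/2) ^ length w"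
    using 1(2) by (intro mult_right_mono) auto
  moreover have "(\<bar>x $ c\<bar> / 2) * (1/2) ^ length w = \<bar>x $ c\<bar> * (1/2) ^ length (a # w)" by simp
  moreover have "set w \<subseteq> I" using Cons.prems by simp
  ultimately show ?case unfolding eq using Cons.IH[OF _ 1(1)] order_trans by metis
qed

lemma mprod_upper:
  assumes g: "\<And>i. i \<in> I \<Longrightarrow> near_proj c \<beta> (g i) \<or> near_id \<beta> (g i)" and \<beta>: "\<beta> \<le> 1/2"
    and w: "set w \<subseteq> I" and x: "\<And>j. \<bar>x $ j\<bar> \<le> t"
  shows "\<bar>(mprod g w *v x) $ i\<bar> \<le> 2 ^ length w * t"
  using w
proof (induction w arbitrary: i)
  case Nil then show ?case using x by simp
next
  case (Cons a w)
  let ?y = "mprod g w *v x" and ?t = "2 ^ length w * t"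
  have y: "\<bar>?y $ j\<bar> \<le> ?t" for j using Cons by simp
  have t: "0 \<le> ?t" using y by (meson abs_ge_zero order_trans)
  have bt: "\<beta> * ?t \<le> ?t"
    using mult_right_mono[of \<beta> 1 ?t] \<beta> t by simp
  have "near_proj c \<beta> (g a) \<or> near_id \<beta> (g a)" using g Cons.prems by simp
  then have "\<bar>(g a *v ?y) $ i\<bar> \<le> ?t + \<beta> * ?t"
  proof
    assume "near_proj c \<beta> (g a)"
    from near_proj_apply[OF this y, of i] show ?thesis using y[of c] t by (auto split: if_splits)
  next
    assume "near_id \<beta> (g a)"
    from near_id_apply[OF this y, of i] show ?thesis using y[of i] by simp
  qed
  then show ?case using bt unfolding mprod_Cons_apply list.size by (simp only: add_Suc_right add_0_right power_Suc)
qed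

lemma mprod_lower:
  assumes h: "\<And>i. i \<in> I \<Longrightarrow> near_id \<beta> (h i)" and \<beta>: "\<beta> \<le> 1/2"
    and w: "set w \<subseteq> I" and x: "\<And>j. \<bar>(mprod h w *v x) $ j\<bar> \<le> t"
  shows "\<bar>x $ i\<bar> \<le> 2 ^ length w * t"
  using w x
proof (induction w arbitrary: i t)
  case Nil then show ?case by simp
next
  case (Cons a w)
  let ?y = "mprod h w *v x"
  define T where "T = Max (range (\<lambda>j. \<bar>?y $ j\<bar>))"
  have yT: "\<bar>?y $ j\<bar> \<le> T" for j unfolding T_def by (intro Max_ge) auto
  have "T \<in> range (\<lambda>j. \<bar>?y $ j\<bar>)" unfolding T_def by (intro Max_in) auto
  then obtain k where k: "T = \<bar>?y $ k\<bar>" by blast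
  have "near_id \<beta> (h a)" using h Cons.prems by simp
  from near_id_apply[OF this yT, of k] have "\<bar>(h a *v ?y) $ k - ?y $ k\<bar> \<le> \<beta> * T" .
  moreover have "\<beta> * T \<le> 1/2 * T" using \<beta> k by (intro mult_right_mono) auto
  moreover have "\<bar>(h a *v ?y) $ k\<bar> \<le> t" using Cons.prems(2)[of k] by (simp only: mprod_Cons_apply)
  ultimately have "T \<le> 2 * t" using k by linarith
  then have "\<bar>?y $ j\<bar> \<le> 2 * t" for j using yT[of j] by simp
  then have "\<bar>x $ i\<bar> \<le> 2 ^ length w * (2 * t)" using Cons.prems(1) by (intro Cons.IH) auto
  then show ?case by simp
qed

section \<open>Products of tensors\<close>

lemma kronecker_apply1:
  "(kronecker g h *v y) $ (i, k) = (g *v (\<chi> j. (h *v (\<chi> l. y $ (j, l))) $ k)) $ i"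
  by (simp add: kronecker_def matrix_vector_mult_def sum_distrib_left
      sum.cartesian_product UNIV_Times_UNIV [symmetric] case_prod_unfold mult_ac del: UNIV_Times_UNIV)

lemma kronecker_apply2:
  "(kronecker g h *v y) $ (i, k) = (h *v (\<chi> l. (g *v (\<chi> j. y $ (j, l))) $ i)) $ k"
proof -
  have "(kronecker g h *v y) $ (i, k) = (\<Sum>j\<in>UNIV. \<Sum>l\<in>UNIV. g $ i $ j * (h $ k $ l * y $ (j, l)))"
    unfolding kronecker_apply1 by (simp add: matrix_vector_mult_def sum_distrib_left)
  also have "\<dots> = (\<Sum>l\<in>UNIV. \<Sum>j\<in>UNIV. g $ i $ j * (h $ k $ l * y $ (j, l)))" by (rule sum.swap)
  finally show ?thesis by (simp add: matrix_vector_mult_def sum_distrib_left mult_ac)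
qed

lemma kronecker_mult: "kronecker (a ** b) (c ** d) = kronecker a c ** kronecker b d"
  by (simp add: kronecker_def matrix_matrix_mult_def vec_eq_iff sum_product
      sum.cartesian_product UNIV_Times_UNIV [symmetric] case_prod_unfold mult_ac del: UNIV_Times_UNIV)

lemma kronecker_mat_1: "kronecker (mat 1) (mat 1) = mat 1"
  by (auto simp: kronecker_def mat_def vec_eq_iff)

lemma mprod_kronecker:
  assumes "\<And>i. i \<in> set w \<Longrightarrow> A i = \<mu> *\<^sub>R kronecker (g i) (h i)"
  shows "mprod A w *v x = \<mu> ^ length w *\<^sub>R (kronecker (mprod g w) (mprod h w) *v x)"
  using assms
proof (induction w)
  case Nil then show ?case by (simp add: kronecker_mat_1)
next
  case (Cons a w)
  have "mprod A (a # w) *v x = A a *v (mprod A w *v x)" by (rule mprod_Cons_apply)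
  also have "\<dots> = (\<mu> *\<^sub>R kronecker (g a) (h a)) *v (\<mu> ^ length w *\<^sub>R (kronecker (mprod g w) (mprod h w) *v x))"
    using Cons by simp
  also have "\<dots> = \<mu> ^ length (a # w) *\<^sub>R (kronecker (mprod g (a # w)) (mprod h (a # w)) *v x)"
    by (simp add: kronecker_mult matrix_vector_mul_assoc[symmetric] matrix_vector_mult_scaleR scaleR_matrix_vector_assoc[symmetric])
  finally show ?case .
qed

text \<open>
  The isomorphism between the two orders of the tensor factors. It transfers the statements from
  families near $P \otimes \mathrm{id}$ to families near $\mathrm{id} \otimes P'$.
\<close>

definition swap_vec :: "real^('m::finite \<times> 'n::finite) \<Rightarrow> real^('n \<times> 'm)" where
  "swap_vec y = (\<chi> p. y $ prod.swap p)"

lemma swap_vec_nth [simp]: "swap_vec y $ (k, i) = y $ (i, k)" by (simp add: swap_vec_def)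

lemma swap_swap_vec [simp]: "swap_vec (swap_vec y) = y" by (simp add: swap_vec_def vec_eq_iff)

lemma linear_swap_vec: "linear swap_vec" by (simp add: linear_iff swap_vec_def vec_eq_iff)

lemma norm_swap_vec [simp]: "norm (swap_vec (y :: real^('m::finite \<times> 'n::finite))) = norm y"
proof -
  have "(\<Sum>p\<in>UNIV. (norm (y $ prod.swap p))\<^sup>2) = (\<Sum>p\<in>UNIV. (norm (y $ p))\<^sup>2)"
    by (rule sum.reindex_bij_betw[of prod.swap UNIV UNIV "\<lambda>p. (norm (y $ p))\<^sup>2"])
      (simp add: bij_betw_def inj_swap)
  then show ?thesis by (simp add: norm_vec_def L2_set_def swap_vec_def)
qed

lemma kronecker_swap_vec: "kronecker h g *v swap_vec y = swap_vec (kronecker g h *v y)"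
proof -
  have "(kronecker h g *v swap_vec y) $ (k, i) = swap_vec (kronecker g h *v y) $ (k, i)" for k i
    by (simp add: kronecker_apply1[of h] kronecker_apply2[of g])
  then show ?thesis by (simp add: vec_eq_iff split_paired_all)
qed


text \<open>
  The order of the arguments says which factor is near the projection: for maps near $\mathrm{id}
  \otimes P'$ the roles of \<open>g\<close> and \<open>h\<close> are exchanged.
\<close>

definition tensor_family :: "'i set \<Rightarrow> real \<Rightarrow> 'm::finite \<Rightarrow> real \<Rightarrow> ('i \<Rightarrow> real^'m^'m) \<Rightarrow> ('i \<Rightarrow> real^'n::finite^'n) \<Rightarrow> bool" where
  "tensor_family I \<mu> c \<beta> g h \<longleftrightarrow> 0 < \<mu> \<and> 0 \<le> \<beta> \<and> \<beta> \<le> 1/2 \<and>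
     (\<forall>i\<in>I. near_proj c \<beta> (g i)) \<and> (\<forall>i\<in>I. near_id \<beta> (h i))"

lemma kronecker_word_upper:
  fixes g :: "'i \<Rightarrow> real^'m::finite^'m" and h :: "'i \<Rightarrow> real^'n::finite^'n"
  assumes F: "tensor_family I \<mu> c \<beta> g h" and w: "set w \<subseteq> I" and y: "\<And>p. \<bar>y $ p\<bar> \<le> t"
  shows "\<bar>(kronecker (mprod g w) (mprod h w) *v y) $ p\<bar> \<le> 4 ^ length w * t"
proof -
  obtain i k where p: "p = (i, k)" by (cases p)
  have "\<bar>(mprod h w *v (\<chi> l. y $ (j, l))) $ k\<bar> \<le> 2 ^ length w * t" for j
    using F w y by (intro mprod_upper[of I _ \<beta>]) (auto simp: tensor_family_def)
  then have "\<bar>(mprod g w *v (\<chi> j. (mprod h w *v (\<chi> l. y $ (j, l))) $ k)) $ i\<bar> \<le> 2 ^ length w * (2 ^ length w * t)"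
    using F w by (intro mprod_upper[of I _ \<beta>]) (auto simp: tensor_family_def)
  then show ?thesis unfolding p kronecker_apply1 by (simp add: power_mult_distrib[symmetric] mult.assoc[symmetric])
qed

text \<open>
  The coordinates with first index \<open>c\<close> of $(g_w \otimes h_w) y$ are the image under
  $h_w$ of the contraction of \<open>y\<close> with the row \<open>c\<close> of $g_w$. By the cone
  property for the transpose, this row is a multiple of a vector whose entry at \<open>c\<close>
  is \<open>1\<close> and whose other entries are at most \<open>1\<close>. So the contraction
  with it is a shear \<open>G\<close> with bounded inverse.
\<close>

lemma kronecker_word_shear:
  fixes g :: "'i \<Rightarrow> real^'m::finite^'m" and h :: "'i \<Rightarrow> real^'n::finite^'n"
  assumes F: "tensor_family I \<mu> c \<beta> g h" and w: "set w \<subseteq> I" and d: "d = real CARD('m \<times> 'n)"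
  shows "\<exists>G :: real^('m \<times> 'n) \<Rightarrow> real^('m \<times> 'n). linear G \<and> (\<forall>y. norm y \<le> d\<^sup>2 * norm (G y)) \<and> (\<forall>y. norm (G y) \<le> d\<^sup>2 * norm y) \<and>
     (\<forall>y k. (\<mu> / 4) ^ length w * \<bar>G y $ (c, k)\<bar> \<le> norm (\<mu> ^ length w *\<^sub>R (kronecker (mprod g w) (mprod h w) *v y)))"
proof -
  define n where "n = length w"
  define l where "l = transpose (mprod g w) *v axis c 1"
  have l: "l $ j = mprod g w $ c $ j" for j
    by (simp add: l_def matrix_vector_mult_def transpose_def axis_def if_distrib cong: if_cong)
  have "dominant c (axis c 1 :: real^'m)" by (simp add: dominant_def axis_def)
  then have "dominant c l \<and> \<bar>axis c 1 $ c\<bar> * (1/2) ^ length w \<le> \<bar>l $ c\<bar>"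
    unfolding l_def using F w by (intro mprod_transpose_dominant[of I _ \<beta>]) (auto simp: tensor_family_def)
  then have dom: "\<And>j. \<bar>l $ j\<bar> \<le> \<bar>l $ c\<bar>" and lc: "(1/2) ^ n \<le> \<bar>l $ c\<bar>"
    by (auto simp: dominant_def n_def)
  have lc0: "0 < \<bar>l $ c\<bar>" using lc by (rule less_le_trans[rotated]) simp
  (* The row c of the product, normalised to have the entry 1 at c. *)
  define q where "q j = l $ j / l $ c" for j
  have q: "\<bar>q j\<bar> \<le> 1" for j using dom[of j] lc0 by (simp add: q_def abs_divide)
  have qc: "q c = 1" using lc0 by (simp add: q_def)
  define G where "G y = (\<chi> p. if fst p = c then \<Sum>j\<in>UNIV. q j * y $ (j, snd p) else y $ p)" for y :: "real^('m \<times> 'n)"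
  have dd: "d = real (CARD('m) * CARD('n))" unfolding d by simp
  have n0: "1 \<le> CARD('n)" "1 \<le> CARD('m)" using zero_less_card_finite by (metis Suc_leI One_nat_def)+
  have d0: "1 \<le> d" unfolding dd using of_nat_mono[OF mult_le_mono[OF n0(2,1)], where 'a = real] by simp
  have d1: "real CARD('m) \<le> d" unfolding dd using mult_le_mono2[OF n0(1), of "CARD('m)"] of_nat_mono by fastforce
  have lin: "linear G"
    by (auto simp: linear_iff G_def vec_eq_iff sum.distrib algebra_simps sum_distrib_left)
  have up: "norm (G y) \<le> d\<^sup>2 * norm y" for y
  proof -
    have "\<bar>G y $ p\<bar> \<le> d * norm y" for p :: "'m \<times> 'n"
    proof (cases "fst p = c")
      case True
      have "\<bar>\<Sum>j\<in>UNIV. q j * y $ (j, snd p)\<bar> \<le> (\<Sum>j\<in>(UNIV::'m set). norm y)"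
        using q component_le_norm_cart[of y]
        by (intro order_trans[OF sum_abs] sum_mono) (auto simp: abs_mult intro: mult_le_one order_trans[OF mult_left_le_one_le])
      also have "\<dots> \<le> d * norm y" using d1 by (simp add: mult_right_mono)
      finally show ?thesis using True by (simp add: G_def)
    next
      case False
      then show ?thesis using component_le_norm_cart[of y p] mult_right_mono[OF d0, of "norm y"] by (simp add: G_def)
    qed
    from norm_le_card_mult[OF this] show ?thesis by (simp add: d power2_eq_square mult.assoc)
  qed
  have lo: "norm y \<le> d\<^sup>2 * norm (G y)" for y
  proof -
    have "\<bar>y $ (i, k)\<bar> \<le> d * norm (G y)" for i k
    proof (cases "i = c")
      case True
      have "G y $ (c, k) = (\<Sum>j\<in>UNIV. q j * y $ (j, k))" by (simp add: G_def)
      also have "\<dots> = q c * y $ (c, k) + (\<Sum>j\<in>UNIV - {c}. q j * y $ (j, k))"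
        by (rule sum.remove) auto
      finally have "y $ (c, k) = G y $ (c, k) - (\<Sum>j\<in>UNIV - {c}. q j * G y $ (j, k))"
        by (simp add: qc) (intro sum.cong, auto simp: G_def)
      then have "\<bar>y $ (c, k)\<bar> \<le> \<bar>G y $ (c, k)\<bar> + \<bar>\<Sum>j\<in>UNIV - {c}. q j * G y $ (j, k)\<bar>" by linarith
      also have "\<dots> \<le> norm (G y) + (\<Sum>j\<in>UNIV - {c}. norm (G y))"
        using q component_le_norm_cart[of "G y"]
        by (intro add_mono order_trans[OF sum_abs] sum_mono) (auto simp: abs_mult intro: order_trans[OF mult_left_le_one_le])
      also have "\<dots> = real CARD('m) * norm (G y)"
        by (simp add: card_Diff_singleton algebra_simps of_nat_diff card_gt_0_iff Suc_leI)
      also have "\<dots> \<le> d * norm (G y)" using d1 by (intro mult_right_mono) auto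
      finally show ?thesis using True by simp
    next
      case False
      then have "y $ (i, k) = G y $ (i, k)" by (simp add: G_def)
      then show ?thesis using component_le_norm_cart[of "G y" "(i, k)"] mult_right_mono[OF d0, of "norm (G y)"] by simp
    qed
    then have "\<bar>y $ p\<bar> \<le> d * norm (G y)" for p by (cases p) simp
    from norm_le_card_mult[OF this] show ?thesis by (simp add: d power2_eq_square mult.assoc)
  qed
  have key: "(\<mu> / 4) ^ n * \<bar>G y $ (c, k)\<bar> \<le> norm (\<mu> ^ n *\<^sub>R (kronecker (mprod g w) (mprod h w) *v y))" for y k
  proof -
    define T where "T = norm (kronecker (mprod g w) (mprod h w) *v y)"
    define z where "z = (\<chi> k. (mprod g w *v (\<chi> j. y $ (j, k))) $ c)"
    have "\<bar>(mprod h w *v z) $ k\<bar> \<le> T" for k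
      using component_le_norm_cart[of "kronecker (mprod g w) (mprod h w) *v y" "(c, k)"]
      by (simp add: T_def z_def kronecker_apply2)
    then have zk: "\<bar>z $ k\<bar> \<le> 2 ^ n * T"
      unfolding n_def using F w by (intro mprod_lower[of I \<beta> h]) (auto simp: tensor_family_def)
    have "z $ k = l $ c * G y $ (c, k)"
      using lc0 by (simp add: z_def G_def matrix_vector_mult_def l[symmetric] q_def sum_distrib_left)
    then have "(1/2) ^ n * \<bar>G y $ (c, k)\<bar> \<le> 2 ^ n * T"
      using zk mult_right_mono[OF lc, of "\<bar>G y $ (c, k)\<bar>"] by (simp add: abs_mult)
    then have "(1/2) ^ n * ((1/2) ^ n * \<bar>G y $ (c, k)\<bar>) \<le> (1/2) ^ n * (2 ^ n * T)"
      by (intro mult_left_mono) auto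
    moreover have "(1/2::real) ^ n * (2 ^ n * T) = T" by (simp add: mult.assoc[symmetric] power_mult_distrib[symmetric])
    moreover have "(1/2::real) ^ n * ((1/2) ^ n * \<bar>G y $ (c, k)\<bar>) = (1/4) ^ n * \<bar>G y $ (c, k)\<bar>"
      by (simp add: mult.assoc[symmetric] power_mult_distrib[symmetric])
    ultimately have "(1/4) ^ n * \<bar>G y $ (c, k)\<bar> \<le> T" by simp
    then have "\<mu> ^ n * ((1/4) ^ n * \<bar>G y $ (c, k)\<bar>) \<le> \<mu> ^ n * T"
      using F by (intro mult_left_mono) (auto simp: tensor_family_def)
    then show ?thesis using F by (simp add: tensor_family_def T_def mult.assoc[symmetric] power_mult_distrib[symmetric])
  qed
  show ?thesis unfolding n_def[symmetric]
    by (intro exI[of _ G] conjI allI) (rule lin up lo key)+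
qed

lemma minor_bounded_below_first:
  fixes g :: "'i \<Rightarrow> real^'m::finite^'m" and h :: "'i \<Rightarrow> real^'n::finite^'n"
  assumes F: "tensor_family I \<mu> c \<beta> g h" and A: "\<And>i. i \<in> I \<Longrightarrow> A i = \<mu> *\<^sub>R kronecker (g i) (h i)"
  shows "minor_bounded_below A I ({c} \<times> UNIV) (\<mu> / 4) ((real CARD('m \<times> 'n))\<^sup>2)"
  unfolding minor_bounded_below_def
proof (intro allI impI)
  fix p assume p: "set p \<subseteq> I"
  have eq: "mprod A p *v x = \<mu> ^ length p *\<^sub>R (kronecker (mprod g p) (mprod h p) *v x)" for x
    using p A by (intro mprod_kronecker) auto
  show "\<exists>G :: real^('m \<times> 'n) \<Rightarrow> real^('m \<times> 'n). linear G \<and> (\<forall>x. norm x \<le> (real CARD('m \<times> 'n))\<^sup>2 * norm (G x)) \<and>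
      (\<forall>x. norm (G x) \<le> (real CARD('m \<times> 'n))\<^sup>2 * norm x) \<and>
      (\<forall>x. \<forall>q\<in>{c} \<times> UNIV. (\<mu> / 4) ^ length p * \<bar>G x $ q\<bar> \<le> norm (mprod A p *v x))"
    using kronecker_word_shear[OF F p refl] unfolding eq by blast
qed

lemma minor_bounded_below_second:
  fixes g :: "'i \<Rightarrow> real^'m::finite^'m" and h :: "'i \<Rightarrow> real^'n::finite^'n"
  assumes F: "tensor_family I \<mu> e \<beta> h g" and A: "\<And>i. i \<in> I \<Longrightarrow> A i = \<mu> *\<^sub>R kronecker (g i) (h i)"
  shows "minor_bounded_below A I (UNIV \<times> {e}) (\<mu> / 4) ((real CARD('m \<times> 'n))\<^sup>2)"
  unfolding minor_bounded_below_def
proof (intro allI impI)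
  fix p assume p: "set p \<subseteq> I"
  have d: "real CARD('m \<times> 'n) = real CARD('n \<times> 'm)" by simp
  obtain G :: "real^('n \<times> 'm) \<Rightarrow> real^('n \<times> 'm)" where
    G: "linear G" "\<And>y. norm y \<le> (real CARD('m \<times> 'n))\<^sup>2 * norm (G y)"
     "\<And>y. norm (G y) \<le> (real CARD('m \<times> 'n))\<^sup>2 * norm y"
     "\<And>y k. (\<mu> / 4) ^ length p * \<bar>G y $ (e, k)\<bar> \<le> norm (\<mu> ^ length p *\<^sub>R (kronecker (mprod h p) (mprod g p) *v y))"
    using kronecker_word_shear[OF F p d] by blast
  define G' where "G' = swap_vec \<circ> G \<circ> swap_vec"
  have eq: "mprod A p *v x = \<mu> ^ length p *\<^sub>R (kronecker (mprod g p) (mprod h p) *v x)" for x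
    using p A by (intro mprod_kronecker) auto
  have lin: "linear G'" unfolding G'_def using G(1) by (intro linear_compose linear_swap_vec)
  have bd: "norm x \<le> (real CARD('m \<times> 'n))\<^sup>2 * norm (G' x)"
    "norm (G' x) \<le> (real CARD('m \<times> 'n))\<^sup>2 * norm x" for x
    using G(2,3)[of "swap_vec x"] by (auto simp: G'_def)
  have key: "(\<mu> / 4) ^ length p * \<bar>G' x $ (i, e)\<bar> \<le> norm (mprod A p *v x)" for x i
    using G(4)[of "swap_vec x" i] by (simp add: G'_def eq kronecker_swap_vec)
  show "\<exists>G :: real^('m \<times> 'n) \<Rightarrow> real^('m \<times> 'n). linear G \<and> (\<forall>x. norm x \<le> (real CARD('m \<times> 'n))\<^sup>2 * norm (G x)) \<and>
      (\<forall>x. norm (G x) \<le> (real CARD('m \<times> 'n))\<^sup>2 * norm x) \<and>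
      (\<forall>x. \<forall>q\<in>UNIV \<times> {e}. (\<mu> / 4) ^ length p * \<bar>G x $ q\<bar> \<le> norm (mprod A p *v x))"
    by (intro exI[of _ G'] conjI allI ballI) ((rule lin bd)+, metis key mem_Times_iff singletonD prod.collapse)
qed

text \<open>
  The vector \<open>v\<close> is the normalised image of the axis \<open>c\<close>. Subtracting a
  multiple of this axis from \<open>x\<close> makes the coordinate at \<open>c\<close> of the
  image vanish. The image is then outside the cone, or zero, and
  \<open>mprod_dominant_or_small\<close> applies. The factor $4^n$ comes from the crude bounds
  $2^n$ and $2^{-n}$ for the product along the axis.
\<close>

lemma mprod_near_rank_one:
  fixes g :: "'i \<Rightarrow> real^'m::finite^'m"
  assumes g: "\<And>i. i \<in> I \<Longrightarrow> near_proj c \<beta> (g i)" and \<beta>: "0 \<le> \<beta>" "\<beta> \<le> 1/2" and w: "set w \<subseteq> I"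
  shows "\<exists>v. (\<forall>i. \<bar>v $ i\<bar> \<le> 1) \<and> (\<forall>x t i. (\<forall>j. \<bar>x $ j\<bar> \<le> t) \<longrightarrow>
     \<bar>(mprod g w *v x) $ i - v $ i * (mprod g w *v x) $ c\<bar> \<le> 2 * (4 * \<beta>) ^ length w * t)"
proof -
  define n where "n = length w"
  define u where "u = mprod g w *v axis c 1"
  have "dominant c (axis c 1 :: real^'m)" by (simp add: dominant_def axis_def)
  from mprod_dominant[OF g \<beta>(2) w this]
  have dom: "\<And>j. \<bar>u $ j\<bar> \<le> \<bar>u $ c\<bar>" and uc: "(1/2) ^ n \<le> \<bar>u $ c\<bar>"
    by (auto simp: dominant_def n_def u_def)
  have uc0: "0 < \<bar>u $ c\<bar>" using uc by (rule less_le_trans[rotated]) simp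
  define v where "v = (\<chi> i. u $ i / u $ c)"
  have v: "\<bar>v $ i\<bar> \<le> 1" for i using dom[of i] uc0 by (simp add: v_def abs_divide)
  have "\<bar>(mprod g w *v x) $ i - v $ i * (mprod g w *v x) $ c\<bar> \<le> 2 * (4 * \<beta>) ^ n * t"
    if x: "\<forall>j. \<bar>x $ j\<bar> \<le> t" for x t i
  proof -
    have t: "0 \<le> t" using x by (meson abs_ge_zero order_trans)
    define \<tau> where "\<tau> = (mprod g w *v x) $ c / u $ c"
    have "\<bar>(mprod g w *v x) $ c\<bar> \<le> 2 ^ n * t"
      unfolding n_def using g x by (intro mprod_upper[OF _ \<beta>(2) w]) auto
    then have "\<bar>\<tau>\<bar> * \<bar>u $ c\<bar> \<le> 2 ^ n * t" using uc0 by (simp add: \<tau>_def abs_divide)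
    moreover have "\<bar>\<tau>\<bar> * (1/2) ^ n \<le> \<bar>\<tau>\<bar> * \<bar>u $ c\<bar>" using uc by (intro mult_left_mono) auto
    ultimately have "2 ^ n * (\<bar>\<tau>\<bar> * (1/2) ^ n) \<le> 2 ^ n * (2 ^ n * t)" by (intro mult_left_mono) auto
    moreover have "2 ^ n * (\<bar>\<tau>\<bar> * (1/2) ^ n) = \<bar>\<tau>\<bar>" by (simp add: power_divide)
    moreover have "(2::real) ^ n * (2 ^ n * t) = 4 ^ n * t" by (simp add: mult.assoc[symmetric] power_mult_distrib[symmetric])
    ultimately have \<tau>: "\<bar>\<tau>\<bar> \<le> 4 ^ n * t" by simp
    define y where "y = x - \<tau> *\<^sub>R axis c 1"
    have y: "\<bar>y $ j\<bar> \<le> 2 * 4 ^ n * t" for j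
    proof -
      have "\<bar>y $ j\<bar> \<le> \<bar>x $ j\<bar> + \<bar>\<tau>\<bar>" by (auto simp: y_def axis_def)
      also have "\<dots> \<le> t + 4 ^ n * t" using x \<tau> by (intro add_mono) auto
      also have "\<dots> \<le> 2 * 4 ^ n * t" using t mult_right_mono[of 1 "4 ^ n" t] by (simp add: mult.commute)
      finally show ?thesis .
    qed
    have gy: "mprod g w *v y = mprod g w *v x - \<tau> *\<^sub>R u"
      by (simp add: y_def u_def matrix_vector_mult_diff_distrib matrix_vector_mult_scaleR)
    have "(mprod g w *v y) $ c = 0" using uc0 by (simp add: gy \<tau>_def)
    moreover have "dominant c (mprod g w *v y) \<or> (\<forall>i. \<bar>(mprod g w *v y) $ i\<bar> \<le> \<beta> ^ n * (2 * 4 ^ n * t))"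
      unfolding n_def by (rule mprod_dominant_or_small[of I c \<beta> g]) (use g \<beta> w y in \<open>auto simp: n_def\<close>)
    moreover have "0 \<le> \<beta> ^ n * (2 * 4 ^ n * t)" using t \<beta> by simp
    ultimately have "\<bar>(mprod g w *v y) $ i\<bar> \<le> \<beta> ^ n * (2 * 4 ^ n * t)"
      unfolding dominant_def by (metis abs_le_zero_iff abs_zero)
    also have "\<beta> ^ n * (2 * 4 ^ n * t) = 2 * (4 * \<beta>) ^ n * t" by (simp add: power_mult_distrib)
    also have "(mprod g w *v y) $ i = (mprod g w *v x) $ i - v $ i * (mprod g w *v x) $ c"
      by (simp add: gy \<tau>_def v_def)
    finally show ?thesis .
  qed
  then show ?thesis using v unfolding n_def by blast
qed

section \<open>Cylinders lie close to linear subspaces of tensors\<close>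

text \<open>
  This is the map $(\mathrm{id} - v e_c^T) \otimes (\mathrm{id} - v' e_e^T)$, where $e_c$ and
  $e_e$ are standard basis vectors. If the entries $v_c$ and $v'_e$ are \<open>1\<close>, its
  kernel is $v \otimes R^{d_2} + R^{d_1} \otimes v'$, and an element of the kernel is determined
  by its entries in row \<open>c\<close> and column \<open>e\<close>.
\<close>

definition residual :: "'m::finite \<Rightarrow> 'n::finite \<Rightarrow> real^'m \<Rightarrow> real^'n \<Rightarrow> real^('m \<times> 'n) \<Rightarrow> real^('m \<times> 'n)" where
  "residual c e v v' x = (\<chi> p. x $ p - v $ fst p * x $ (c, snd p) - v' $ snd p * x $ (fst p, e)
      + v $ fst p * v' $ snd p * x $ (c, e))"

lemma linear_residual: "linear (residual c e v v')"
  by (simp add: linear_iff residual_def vec_eq_iff algebra_simps)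

lemma residual_swap_vec: "residual e c v' v (swap_vec x) = swap_vec (residual c e v v' x)"
  by (simp add: residual_def vec_eq_iff split_paired_all mult_ac)

text \<open>
  The cross of row \<open>c\<close> and column \<open>e\<close> has $d_1 + d_2 - 1$ positions.
  This is where the dimension $d_1 + d_2 - 1$ of the sum of the two subspaces enters.
\<close>

lemma coords_le_residual:
  assumes "\<And>i. \<bar>v $ i\<bar> \<le> 1" "\<And>k. \<bar>v' $ k\<bar> \<le> 1" "\<And>p. \<bar>residual c e v v' x $ p\<bar> \<le> b"
    and "\<And>p. fst p = c \<or> snd p = e \<Longrightarrow> \<bar>x $ p\<bar> \<le> \<rho>"
  shows "\<bar>x $ p\<bar> \<le> b + 3 * \<rho>"
proof -
  have \<rho>: "0 \<le> \<rho>" using assms(4)[of "(c, e)"] by (meson abs_ge_zero fst_conv order_trans)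
  have m: "\<bar>a * z\<bar> \<le> \<rho>" if "\<bar>a\<bar> \<le> 1" "\<bar>z\<bar> \<le> \<rho>" for a z :: real
    using mult_mono[OF that] by (simp add: abs_mult)
  have "\<bar>v $ fst p * x $ (c, snd p)\<bar> \<le> \<rho>" "\<bar>v' $ snd p * x $ (fst p, e)\<bar> \<le> \<rho>"
    "\<bar>v $ fst p * v' $ snd p * x $ (c, e)\<bar> \<le> \<rho>"
    using assms(1,2) by (auto intro!: m assms(4) mult_le_one simp: abs_mult[of "v $ fst p" "v' $ snd p"])
  then show ?thesis using assms(3)[of p] unfolding residual_def by simp
qed

text \<open>
  The first tensor factor of the residual map removes from $g_w$ its rank one part by
  \<open>mprod_near_rank_one\<close>. The bound holds for every \<open>v'\<close>, so that it can
  be combined with the corresponding bound for the other family.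
\<close>

lemma residual_word_first:
  fixes g :: "'i \<Rightarrow> real^'m::finite^'m" and h :: "'i \<Rightarrow> real^'n::finite^'n"
  assumes F: "tensor_family I \<mu> c \<beta> g h" and w: "set w \<subseteq> I"
    and A: "\<And>i. i \<in> I \<Longrightarrow> A i = \<mu> *\<^sub>R kronecker (g i) (h i)"
  shows "\<exists>v. (\<forall>i. \<bar>v $ i\<bar> \<le> 1) \<and> (\<forall>v' e x t p. (\<forall>k. \<bar>v' $ k\<bar> \<le> 1) \<longrightarrow> (\<forall>p. \<bar>x $ p\<bar> \<le> t) \<longrightarrow>
     \<bar>residual c e v v' (mprod A w *v x) $ p\<bar> \<le> 4 * (8 * \<mu> * \<beta>) ^ length w * t)"
proof -
  define n where "n = length w"
  obtain v where v: "\<And>i. \<bar>v $ i\<bar> \<le> 1" "\<And>x t i. (\<forall>j. \<bar>x $ j\<bar> \<le> t) \<Longrightarrow>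
     \<bar>(mprod g w *v x) $ i - v $ i * (mprod g w *v x) $ c\<bar> \<le> 2 * (4 * \<beta>) ^ n * t"
  proof -
    have "\<And>i. i \<in> I \<Longrightarrow> near_proj c \<beta> (g i)" "0 \<le> \<beta>" "\<beta> \<le> 1/2" using F by (auto simp: tensor_family_def)
    from mprod_near_rank_one[of I c \<beta> g w, OF this w] show ?thesis using that unfolding n_def by blast
  qed
  have "\<bar>residual c e v v' (mprod A w *v x) $ p\<bar> \<le> 4 * (8 * \<mu> * \<beta>) ^ n * t"
    if v': "\<forall>k. \<bar>v' $ k\<bar> \<le> 1" and x: "\<forall>p. \<bar>x $ p\<bar> \<le> t" for v' e x t p
  proof -
    define X where "X = kronecker (mprod g w) (mprod h w) *v x"
    define B where "B = 2 * (4 * \<beta>) ^ n * (2 ^ n * t)"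
    have eq: "mprod A w *v x = \<mu> ^ n *\<^sub>R X"
      unfolding X_def n_def using w A by (intro mprod_kronecker) auto
    have s: "\<bar>(mprod h w *v (\<chi> l. x $ (j, l))) $ k\<bar> \<le> 2 ^ n * t" for j k
      unfolding n_def using F w x by (intro mprod_upper[of I _ \<beta>]) (auto simp: tensor_family_def)
    have q: "\<bar>X $ (i, k) - v $ i * X $ (c, k)\<bar> \<le> B" for i k
      unfolding X_def kronecker_apply1 B_def using s by (intro v(2)) auto
    obtain i k where p: "p = (i, k)" by (cases p)
    have "residual c e v v' X $ p = (X $ (i, k) - v $ i * X $ (c, k)) - v' $ k * (X $ (i, e) - v $ i * X $ (c, e))"
      by (simp add: residual_def p algebra_simps)
    moreover have "\<bar>v' $ k * (X $ (i, e) - v $ i * X $ (c, e))\<bar> \<le> 1 * B"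
      unfolding abs_mult using v' q by (intro mult_mono) auto
    ultimately have "\<bar>residual c e v v' X $ p\<bar> \<le> 2 * B" using q[of i k] by linarith
    then have "\<mu> ^ n * \<bar>residual c e v v' X $ p\<bar> \<le> \<mu> ^ n * (2 * B)"
      using F by (intro mult_left_mono) (auto simp: tensor_family_def)
    moreover have "\<mu> ^ n * (2 * B) = 4 * (8 * \<mu> * \<beta>) ^ n * t"
    proof -
      have "(8::real) ^ n = 4 ^ n * 2 ^ n" by (simp add: power_mult_distrib[symmetric])
      then show ?thesis by (simp add: B_def power_mult_distrib)
    qed
    moreover have "\<bar>residual c e v v' (mprod A w *v x) $ p\<bar> = \<mu> ^ n * \<bar>residual c e v v' X $ p\<bar>"
      using F by (simp add: eq linear_scale[OF linear_residual] abs_mult tensor_family_def)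
    ultimately show ?thesis by simp
  qed
  then show ?thesis using v(1) unfolding n_def by blast
qed

lemma residual_word_second:
  fixes g :: "'i \<Rightarrow> real^'m::finite^'m" and h :: "'i \<Rightarrow> real^'n::finite^'n"
  assumes F: "tensor_family I \<mu> e \<beta> h g" and w: "set w \<subseteq> I"
    and A: "\<And>i. i \<in> I \<Longrightarrow> A i = \<mu> *\<^sub>R kronecker (g i) (h i)"
  shows "\<exists>v'. (\<forall>k. \<bar>v' $ k\<bar> \<le> 1) \<and> (\<forall>v c x t p. (\<forall>i. \<bar>v $ i\<bar> \<le> 1) \<longrightarrow> (\<forall>p. \<bar>x $ p\<bar> \<le> t) \<longrightarrow>
     \<bar>residual c e v v' (mprod A w *v x) $ p\<bar> \<le> 4 * (8 * \<mu> * \<beta>) ^ length w * t)"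
proof -
  define A' where "A' i = \<mu> *\<^sub>R kronecker (h i) (g i)" for i
  obtain v' where v': "\<And>k. \<bar>v' $ k\<bar> \<le> 1" "\<And>v c x t p. (\<forall>i. \<bar>v $ i\<bar> \<le> 1) \<Longrightarrow> (\<forall>p. \<bar>x $ p\<bar> \<le> t) \<Longrightarrow>
     \<bar>residual e c v' v (mprod A' w *v x) $ p\<bar> \<le> 4 * (8 * \<mu> * \<beta>) ^ length w * t"
    using residual_word_first[OF F w, of A'] unfolding A'_def by blast
  have "\<bar>residual c e v v' (mprod A w *v x) $ p\<bar> \<le> 4 * (8 * \<mu> * \<beta>) ^ length w * t"
    if v: "\<forall>i. \<bar>v $ i\<bar> \<le> 1" and x: "\<forall>p. \<bar>x $ p\<bar> \<le> t" for v c x t p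
  proof -
    have "mprod A' w *v swap_vec x = swap_vec (mprod A w *v x)"
      using mprod_kronecker[of w A' \<mu> h g "swap_vec x"] mprod_kronecker[of w A \<mu> g h x] A w
      by (simp add: A'_def kronecker_swap_vec linear_scale[OF linear_swap_vec] subset_iff)
    then have "residual e c v' v (mprod A' w *v swap_vec x) = swap_vec (residual c e v v' (mprod A w *v x))"
      by (simp add: residual_swap_vec)
    moreover obtain i k where "p = (i, k)" by (cases p)
    moreover have "\<forall>p. \<bar>swap_vec x $ p\<bar> \<le> t" using x by (simp add: split_paired_all)
    ultimately show ?thesis using v'(2)[OF v, of "swap_vec x" t c "(k, i)"] by simp
  qed
  then show ?thesis using v'(1) by blast
qed

section \<open>Upper bounds for the dimensions of attractors and their sum\<close>

lemma hausdorff_dim_attractor_le: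
  fixes T :: "'i \<Rightarrow> 'a::euclidean_space \<Rightarrow> 'a" and s :: real
  assumes I: "finite I" "I \<noteq> {}"
    and lip: "\<And>i x y. i \<in> I \<Longrightarrow> dist (T i x) (T i y) \<le> a * dist x y" and a: "0 < a" "a < 1"
    and s: "0 < s" "card I * a powr s < 1"
  shows "hausdorff_dim (attractor I T) \<le> ennreal s"
proof (rule hausdorff_dim_le_of_covers[OF s(1)])
  fix \<epsilon> :: real assume \<epsilon>: "0 < \<epsilon>"
  let ?X = "attractor I T"
  have X: "compact ?X" "?X \<noteq> {}" "?X = (\<Union>i\<in>I. T i ` ?X)"
    using attractor_properties[OF I, of T a] lip a by auto
  obtain K where K: "0 < K" "\<And>x. x \<in> ?X \<Longrightarrow> norm x \<le> K"
    using compact_imp_bounded[OF X(1)] by (auto simp: bounded_pos)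
  define q where "q = card I * a powr s"
  have q: "0 \<le> q" "q < 1" using s by (auto simp: q_def)
  have "(\<lambda>n. q ^ n * (2 * K) powr s) \<longlonglongrightarrow> 0 * (2 * K) powr s"
    using q by (intro tendsto_intros LIMSEQ_realpow_zero) auto
  then have "eventually (\<lambda>n. q ^ n * (2 * K) powr s < \<epsilon>) sequentially" using \<epsilon> by (auto dest: order_tendstoD(2))
  then obtain n where n: "q ^ n * (2 * K) powr s < \<epsilon>" by (auto simp: eventually_sequentially)
  define P where "P = (\<lambda>w. word_map T w ` ?X) ` words I n"
  define \<rho> where "\<rho> = a ^ n * (2 * K)"
  have fw: "finite (words I n)" using I by (simp add: finite_words)
  have "finite P" using fw by (simp add: P_def)
  moreover have "?X \<subseteq> \<Union>P" using invariant_set_words[OF X(3), of n] by (auto simp: P_def)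
  moreover have "bounded C \<and> diameter C \<le> \<rho>" if C: "C \<in> P" for C
  proof -
    obtain w where w: "w \<in> words I n" "C = word_map T w ` ?X" using C by (auto simp: P_def)
    have "C \<subseteq> ?X" using w invariant_set_words[OF X(3), of n] by blast
    then have "bounded C" using compact_imp_bounded[OF X(1)] bounded_subset by blast
    moreover have "diameter C \<le> \<rho>"
    proof (rule diameter_le)
      show "C \<noteq> {} \<or> 0 \<le> \<rho>" using a K by (simp add: \<rho>_def)
      fix x y assume "x \<in> C" "y \<in> C"
      then obtain x' y' where xy: "x' \<in> ?X" "y' \<in> ?X" "x = word_map T w x'" "y = word_map T w y'" using w by auto
      have "dist x y \<le> a ^ n * dist x' y'"
        unfolding xy(3,4) using lip a w by (intro word_map_lipschitz[of I]) auto
      also have "\<dots> \<le> a ^ n * (2 * K)"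
      proof (rule mult_left_mono)
        show "dist x' y' \<le> 2 * K" using K(2)[OF xy(1)] K(2)[OF xy(2)] norm_triangle_ineq4[of x' y'] by (simp add: dist_norm)
      qed (use a in simp)
      finally show "norm (x - y) \<le> \<rho>" by (simp add: dist_norm \<rho>_def)
    qed
    ultimately show ?thesis by blast
  qed
  moreover have "0 < \<rho>" using a K by (simp add: \<rho>_def)
  moreover have "real (card P) * \<rho> powr s < \<epsilon>"
  proof -
    have "card P \<le> card I ^ n" unfolding P_def using card_image_le[OF fw] card_words[OF I(1), of n] by metis
    then have "real (card P) \<le> real (card I) ^ n" by (metis of_nat_mono of_nat_power)
    moreover have "\<rho> powr s = (a powr s) ^ n * (2 * K) powr s"
      using a K by (simp add: \<rho>_def powr_mult powr_power_commute)
    ultimately have "real (card P) * \<rho> powr s \<le> real (card I) ^ n * ((a powr s) ^ n * (2 * K) powr s)"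
      by (simp add: mult_right_mono)
    also have "\<dots> = q ^ n * (2 * K) powr s"
      by (simp add: q_def power_mult_distrib)
    finally show ?thesis using n by simp
  qed
  ultimately show "\<exists>P \<rho>. finite P \<and> ?X \<subseteq> \<Union>P \<and> (\<forall>C\<in>P. bounded C \<and> diameter C \<le> \<rho>) \<and>
      0 < \<rho> \<and> real (card P) * \<rho> powr s < \<epsilon>" by blast
qed

lemma norm_mprod_le:
  assumes "\<And>i x. i \<in> I \<Longrightarrow> norm (A i *v x) \<le> a * norm x" "0 \<le> a" "set w \<subseteq> I"
  shows "norm (mprod A w *v x) \<le> a ^ length w * norm x"
  using assms(3)
proof (induction w)
  case (Cons i w)
  have "norm (A i *v (mprod A w *v x)) \<le> a * norm (mprod A w *v x)" using assms(1) Cons.prems by simp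
  also have "\<dots> \<le> a * (a ^ length w * norm x)" using Cons assms(2) by (intro mult_left_mono) auto
  finally show ?case by (simp only: mprod_Cons_apply) (simp add: mult_ac)
qed simp

text \<open>
  By the two residual lemmas, points of a sum of cylinders are determined up to $O(a^{2 n})$ by
  their entries on the cross, which have size $O(a^n)$. A grid of mesh $8 R a^{2 n}$ on the cross
  therefore gives cells of diameter $O(a^{2 n})$.
\<close>

lemma cylinder_sum_cover:
  fixes A B :: "'i \<Rightarrow> real^('m::finite \<times> 'n::finite)^('m \<times> 'n)"
  assumes FA: "tensor_family I \<mu> c \<beta> g h" and A: "\<And>i. i \<in> I \<Longrightarrow> A i = \<mu> *\<^sub>R kronecker (g i) (h i)"
    and FB: "tensor_family J \<nu> e \<gamma> h' g'" and B: "\<And>i. i \<in> J \<Longrightarrow> B i = \<nu> *\<^sub>R kronecker (g' i) (h' i)"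
    and a: "0 < a" "a \<le> 1/8" "\<And>i x. i \<in> I \<Longrightarrow> norm (A i *v x) \<le> a * norm x" "8 * \<mu> * \<beta> \<le> a\<^sup>2"
    and b: "0 < b" "\<And>i x. i \<in> J \<Longrightarrow> norm (B i *v x) \<le> b * norm x" "8 * \<nu> * \<gamma> \<le> b\<^sup>2"
    and w: "w \<in> words I n" "w' \<in> words J m" "b ^ m \<le> a ^ n" "1 \<le> n"
    and R: "0 < R" "X \<subseteq> cball 0 R" "Y \<subseteq> cball 0 R"
  shows "\<exists>P. finite P \<and> {word_map (affine_maps A u) w x + word_map (affine_maps B v) w' y | x y. x \<in> X \<and> y \<in> Y} = \<Union>P \<and>
     real (card P) \<le> (1 / a ^ n) ^ card {p::'m \<times> 'n. fst p = c \<or> snd p = e} \<and>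
     (\<forall>C\<in>P. bounded C \<and> diameter C \<le> 40 * real CARD('m \<times> 'n) * R * (a ^ n)\<^sup>2)"
proof -
  define Z where "Z = {word_map (affine_maps A u) w x + word_map (affine_maps B v) w' y | x y. x \<in> X \<and> y \<in> Y}"
  define k where "k = pt A u w + pt B v w'"
  define Q where "Q = {p::'m \<times> 'n. fst p = c \<or> snd p = e}"
  define r where "r = 2 * R * a ^ n"
  define \<rho> where "\<rho> = 8 * R * (a ^ n)\<^sup>2"
  have lw: "set w \<subseteq> I" "length w = n" "set w' \<subseteq> J" "length w' = m" using w by (auto simp: words_def)
  have an: "0 < a ^ n" using a by simp
  have bn: "0 \<le> b ^ m" using b by simp
  have an8: "a ^ n \<le> 1/8"
  proof -
    have "a ^ n \<le> a ^ 1" using a w(4) by (intro power_decreasing) auto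
    then show ?thesis using a by simp
  qed
  have \<rho>r: "0 < \<rho>" "\<rho> \<le> r"
  proof -
    show "0 < \<rho>" using R(1) zero_less_power[OF an, of 2] by (simp add: \<rho>_def)
    have "(a ^ n)\<^sup>2 \<le> a ^ n * (1/8)" unfolding power2_eq_square using an an8 by (intro mult_left_mono) auto
    then have "R * (a ^ n)\<^sup>2 \<le> R * (a ^ n * (1/8))" using R by (intro mult_left_mono) auto
    moreover have "0 \<le> R * a ^ n" using R an by simp
    ultimately show "\<rho> \<le> r" unfolding \<rho>_def r_def by (simp add: mult.assoc)
  qed
  obtain v1 where v1: "\<And>i. \<bar>v1 $ i\<bar> \<le> 1" "\<And>v' e x t p. (\<forall>k. \<bar>v' $ k\<bar> \<le> 1) \<Longrightarrow> (\<forall>p. \<bar>x $ p\<bar> \<le> t) \<Longrightarrow>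
     \<bar>residual c e v1 v' (mprod A w *v x) $ p\<bar> \<le> 4 * (8 * \<mu> * \<beta>) ^ length w * t"
    using residual_word_first[OF FA lw(1) A] by blast
  obtain v2 where v2: "\<And>k. \<bar>v2 $ k\<bar> \<le> 1" "\<And>v c x t p. (\<forall>i. \<bar>v $ i\<bar> \<le> 1) \<Longrightarrow> (\<forall>p. \<bar>x $ p\<bar> \<le> t) \<Longrightarrow>
     \<bar>residual c e v v2 (mprod B w' *v x) $ p\<bar> \<le> 4 * (8 * \<nu> * \<gamma>) ^ length w' * t"
    using residual_word_second[OF FB lw(3) B] by blast
  have size: "\<bar>(z - k) $ p\<bar> \<le> r" and res: "\<bar>residual c e v1 v2 (z - k) $ p\<bar> \<le> \<rho>" if z: "z \<in> Z" for z p
  proof -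
    obtain x y where xy: "x \<in> X" "y \<in> Y" "z = word_map (affine_maps A u) w x + word_map (affine_maps B v) w' y"
      using z by (auto simp: Z_def)
    have zk: "z - k = mprod A w *v x + mprod B w' *v y"
      unfolding xy(3) k_def word_map_affine[of A u w x] word_map_affine[of B v w' y] by simp
    have nx: "norm x \<le> R" "norm y \<le> R" using xy R by auto
    have cx: "\<forall>p. \<bar>x $ p\<bar> \<le> R" "\<forall>p. \<bar>y $ p\<bar> \<le> R" using nx component_le_norm_cart order_trans by blast+
    have "norm (mprod A w *v x) \<le> a ^ n * norm x"
      using norm_mprod_le[OF a(3) _ lw(1)] a lw(2) by auto
    also have "\<dots> \<le> a ^ n * R" using nx an by (intro mult_left_mono) auto
    finally have 1: "norm (mprod A w *v x) \<le> a ^ n * R" .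
    have "norm (mprod B w' *v y) \<le> b ^ m * norm y"
      using norm_mprod_le[OF b(2) _ lw(3)] b lw(4) by auto
    also have "\<dots> \<le> a ^ n * R" using nx w(3) bn by (intro mult_mono) auto
    finally have 2: "norm (mprod B w' *v y) \<le> a ^ n * R" .
    have "\<bar>(z - k) $ p\<bar> \<le> norm (z - k)" by (rule component_le_norm_cart)
    also have "\<dots> \<le> r" unfolding zk r_def using norm_triangle_le[OF add_mono[OF 1 2]] by simp
    finally show "\<bar>(z - k) $ p\<bar> \<le> r" .
    have "\<bar>residual c e v1 v2 (mprod A w *v x) $ p\<bar> \<le> 4 * (8 * \<mu> * \<beta>) ^ n * R"
      using v1(2)[of v2 x R e p] v2(1) cx lw by auto
    also have "\<dots> \<le> 4 * (a\<^sup>2) ^ n * R"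
      using a(4) FA R by (intro mult_right_mono mult_left_mono power_mono) (auto simp: tensor_family_def)
    finally have 3: "\<bar>residual c e v1 v2 (mprod A w *v x) $ p\<bar> \<le> 4 * (a ^ n)\<^sup>2 * R" by (metis power_mult mult.commute)
    have "\<bar>residual c e v1 v2 (mprod B w' *v y) $ p\<bar> \<le> 4 * (8 * \<nu> * \<gamma>) ^ m * R"
      using v2(2)[of v1 y R c p] v1(1) cx lw by auto
    also have "\<dots> \<le> 4 * (b\<^sup>2) ^ m * R"
      using b(3) FB R by (intro mult_right_mono mult_left_mono power_mono) (auto simp: tensor_family_def)
    also have "(b\<^sup>2) ^ m = (b ^ m)\<^sup>2" by (metis power_mult mult.commute)
    also have "4 * (b ^ m)\<^sup>2 * R \<le> 4 * (a ^ n)\<^sup>2 * R"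
      using w(3) bn R by (intro mult_right_mono mult_left_mono power_mono) auto
    finally have 4: "\<bar>residual c e v1 v2 (mprod B w' *v y) $ p\<bar> \<le> 4 * (a ^ n)\<^sup>2 * R" .
    show "\<bar>residual c e v1 v2 (z - k) $ p\<bar> \<le> \<rho>"
      unfolding zk linear_add[OF linear_residual] vector_add_component \<rho>_def
      using abs_triangle_ineq[of "residual c e v1 v2 (mprod A w *v x) $ p" "residual c e v1 v2 (mprod B w' *v y) $ p"] 3 4
      by (simp add: mult_ac)
  qed
  obtain P where P: "finite P" "Z = \<Union>P" "{} \<notin> P" "real (card P) \<le> (4 * r / \<rho>) ^ card Q"
     "\<And>C x y q. C \<in> P \<Longrightarrow> x \<in> C \<Longrightarrow> y \<in> C \<Longrightarrow> q \<in> Q \<Longrightarrow> \<bar>(x - k) $ q - (y - k) $ q\<bar> \<le> \<rho>"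
    using grid_cover[of Q Z "\<lambda>z p. (z - k) $ p" r \<rho>] size \<rho>r by (auto simp: ac_simps)
  have "4 * r / \<rho> = 1 / a ^ n" using R an by (simp add: r_def \<rho>_def power2_eq_square field_simps)
  then have "real (card P) \<le> (1 / a ^ n) ^ card Q" using P(4) by simp
  moreover have "bounded C \<and> diameter C \<le> 40 * real CARD('m \<times> 'n) * R * (a ^ n)\<^sup>2" if C: "C \<in> P" for C
  proof -
    have d: "norm (x - y) \<le> 40 * real CARD('m \<times> 'n) * R * (a ^ n)\<^sup>2" if xy: "x \<in> C" "y \<in> C" for x y
    proof -
      have Zxy: "x \<in> Z" "y \<in> Z" using C xy P(2) by auto
      have eq: "x - y = (x - k) - (y - k)" by simp
      have "\<bar>residual c e v1 v2 (x - y) $ p\<bar> \<le> 2 * \<rho>" for p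
        unfolding eq linear_diff[OF linear_residual, of c e v1 v2 "x - k" "y - k"] vector_minus_component[of "residual c e v1 v2 (x - k)"]
        using res[OF Zxy(1), of p] res[OF Zxy(2), of p] by linarith
      moreover have "\<bar>(x - y) $ p\<bar> \<le> \<rho>" if "fst p = c \<or> snd p = e" for p
        using P(5)[OF C xy, of p] that by (simp add: Q_def)
      ultimately have "\<bar>(x - y) $ p\<bar> \<le> 2 * \<rho> + 3 * \<rho>" for p
        by (intro coords_le_residual[of v1 v2 c e]) (use v1(1) v2(1) in auto)
      from norm_le_card_mult[OF this] show ?thesis by (simp add: \<rho>_def mult_ac)
    qed
    obtain x where "x \<in> C" using C P(3) by fastforce
    then have "bounded C" unfolding bounded_def using d by (intro exI[of _ x]) (auto simp: dist_norm)
    moreover have "diameter C \<le> 40 * real CARD('m \<times> 'n) * R * (a ^ n)\<^sup>2"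
      using \<open>x \<in> C\<close> d by (intro diameter_le) auto
    ultimately show ?thesis ..
  qed
  ultimately show ?thesis using P(1,2) unfolding Z_def Q_def by blast
qed

text \<open>
  The length \<open>m\<close> of the words of the second system is the least one with $b^m \le
  a^n$, so that both cylinders have comparable size. The number of pairs of words is then $O(a^{-
  n (\sigma + \theta)})$, and the covers of \<open>cylinder_sum_cover\<close> add up to $O(a^{n
  \delta})$ with $\delta = 2 \tau - D - \sigma - \theta$.
\<close>

lemma hausdorff_dim_sum_le:
  fixes A B :: "'i \<Rightarrow> real^('m::finite \<times> 'n::finite)^('m \<times> 'n)" and \<sigma> \<theta> \<tau> :: real
  assumes FA: "tensor_family I \<mu> c \<beta> g h" and A: "\<And>i. i \<in> I \<Longrightarrow> A i = \<mu> *\<^sub>R kronecker (g i) (h i)"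
    and FB: "tensor_family J \<nu> e \<gamma> h' g'" and B: "\<And>i. i \<in> J \<Longrightarrow> B i = \<nu> *\<^sub>R kronecker (g' i) (h' i)"
    and a: "0 < a" "a \<le> 1/8" "\<And>i x. i \<in> I \<Longrightarrow> norm (A i *v x) \<le> a * norm x" "8 * \<mu> * \<beta> \<le> a\<^sup>2"
    and b: "0 < b" "b < 1" "\<And>i x. i \<in> J \<Longrightarrow> norm (B i *v x) \<le> b * norm x" "8 * \<nu> * \<gamma> \<le> b\<^sup>2"
    and I: "finite I" "finite J" "card I \<le> a powr (- \<sigma>)" "card J \<le> b powr (- \<theta>)" "0 \<le> \<theta>"
    and X: "bounded X" "X = (\<Union>i\<in>I. affine_maps A u i ` X)"
    and Y: "bounded Y" "Y = (\<Union>i\<in>J. affine_maps B v i ` Y)"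
    and \<tau>: "0 < \<tau>" "card {p::'m \<times> 'n. fst p = c \<or> snd p = e} + \<sigma> + \<theta> < 2 * \<tau>"
  shows "hausdorff_dim {x + y | x y. x \<in> X \<and> y \<in> Y} \<le> ennreal \<tau>"
proof (rule hausdorff_dim_le_of_covers[OF \<tau>(1)])
  fix \<epsilon> :: real assume \<epsilon>: "0 < \<epsilon>"
  define D where "D = card {p::'m \<times> 'n. fst p = c \<or> snd p = e}"
  define d where "d = real CARD('m \<times> 'n)"
  have d0: "0 < d" unfolding d_def by (simp only: of_nat_0_less_iff zero_less_card_finite)
  obtain R where R: "0 < R" "X \<subseteq> cball 0 R" "Y \<subseteq> cball 0 R"
  proof -
    obtain R where "0 < R" "\<And>x. x \<in> X \<union> Y \<Longrightarrow> norm x \<le> R"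
      using X(1) Y(1) bounded_Un[of X Y] bounded_pos[of "X \<union> Y"] by auto
    then show ?thesis using that[of R] by (auto simp: subset_iff)
  qed
  define K where "K = 40 * d * R"
  have K: "0 < K" using d0 R by (simp add: K_def)
  define \<delta> where "\<delta> = 2 * \<tau> - D - \<sigma> - \<theta>"
  have \<delta>: "0 < \<delta>" using \<tau> by (simp add: \<delta>_def D_def)
  define C where "C = K powr \<tau> * b powr (- \<theta>)"
  have "a powr \<delta> < a powr 0" using a \<delta> by (intro powr_less_mono') auto
  then have q: "0 \<le> a powr \<delta>" "a powr \<delta> < 1" using a by auto
  have "(\<lambda>n. C * (a powr \<delta>) ^ n) \<longlonglongrightarrow> C * 0"
    using q by (intro tendsto_intros LIMSEQ_realpow_zero) auto
  then have "eventually (\<lambda>n. C * (a powr \<delta>) ^ n < \<epsilon>) sequentially" using \<epsilon> by (auto dest: order_tendstoD(2))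
  moreover have "eventually (\<lambda>n::nat. 1 \<le> n) sequentially" by (rule eventually_ge_at_top)
  ultimately obtain n where n: "C * (a powr \<delta>) ^ n < \<epsilon>" "1 \<le> n"
    using eventually_conj eventually_happens trivial_limit_sequentially by (metis (mono_tags, lifting))
  define x where "x = a ^ n"
  have x: "0 < x" "x < 1"
    using a n(2) by (auto simp: x_def power_less_one_iff)
  define m where "m = (LEAST m. b ^ m \<le> x)"
  have "\<exists>m. b ^ m \<le> x" using real_arch_pow_inv[OF x(1) b(2)] less_imp_le by blast
  then have m: "b ^ m \<le> x" unfolding m_def by (rule LeastI_ex)
  have "m \<noteq> 0" using m x by (intro notI) simp
  then obtain m' where m': "m = Suc m'" by (cases m) auto
  have "\<not> b ^ m' \<le> x" using not_less_Least[of m' "\<lambda>m. b ^ m \<le> x"] m' unfolding m_def by simp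
  then have mlo: "b * x \<le> b ^ m" using b by (simp add: m')
  let ?Z = "\<lambda>w w'. {word_map (affine_maps A u) w x + word_map (affine_maps B v) w' y | x y. x \<in> X \<and> y \<in> Y}"
  define good where "good w w' P \<longleftrightarrow> finite P \<and> ?Z w w' = \<Union>P \<and> real (card P) \<le> (1 / x) ^ D \<and>
     (\<forall>C\<in>P. bounded C \<and> diameter C \<le> K * x\<^sup>2)" for w w' P
  define P where "P w w' = (SOME P. good w w' P)" for w w'
  have good: "good w w' (P w w')" if "w \<in> words I n" "w' \<in> words J m" for w w'
    unfolding P_def
  proof (rule someI_ex)
    show "\<exists>P. good w w' P"
      using cylinder_sum_cover[OF FA A FB B a b(1,3,4) that m[unfolded x_def] n(2) R, of u v]
      unfolding good_def x_def D_def K_def d_def .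
  qed
  have P: "\<And>w w'. w \<in> words I n \<Longrightarrow> w' \<in> words J m \<Longrightarrow> finite (P w w')"
    "\<And>w w'. w \<in> words I n \<Longrightarrow> w' \<in> words J m \<Longrightarrow> ?Z w w' = \<Union>(P w w')"
    "\<And>w w'. w \<in> words I n \<Longrightarrow> w' \<in> words J m \<Longrightarrow> real (card (P w w')) \<le> (1 / x) ^ D"
    "\<And>w w' C. w \<in> words I n \<Longrightarrow> w' \<in> words J m \<Longrightarrow> C \<in> P w w' \<Longrightarrow> bounded C \<and> diameter C \<le> K * x\<^sup>2"
    using good unfolding good_def by blast+
  define PP where "PP = (\<Union>w\<in>words I n. \<Union>w'\<in>words J m. P w w')"
  have fin: "finite (words I n)" "finite (words J m)" using I by (auto simp: finite_words)
  have "finite PP" unfolding PP_def using fin P(1) by blast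
  moreover have "{x + y | x y. x \<in> X \<and> y \<in> Y} \<subseteq> \<Union>PP"
  proof clarify
    fix x0 y0 assume xy: "x0 \<in> X" "y0 \<in> Y"
    obtain w x' where w: "w \<in> words I n" "x' \<in> X" "x0 = word_map (affine_maps A u) w x'"
      using invariant_set_words[OF X(2), of n] xy(1) by blast
    obtain w' y' where w': "w' \<in> words J m" "y' \<in> Y" "y0 = word_map (affine_maps B v) w' y'"
      using invariant_set_words[OF Y(2), of m] xy(2) by blast
    have "x0 + y0 \<in> ?Z w w'" using w w' by blast
    then have "x0 + y0 \<in> \<Union>(P w w')" using P(2)[OF w(1) w'(1)] by simp
    then show "x0 + y0 \<in> \<Union>PP" using w(1) w'(1) unfolding PP_def by blast
  qed
  moreover have "\<forall>C\<in>PP. bounded C \<and> diameter C \<le> K * x\<^sup>2" unfolding PP_def using P(4) by blast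
  moreover have "0 < K * x\<^sup>2" using K x by simp
  moreover have "real (card PP) * (K * x\<^sup>2) powr \<tau> < \<epsilon>"
  proof -
    have "card PP \<le> (\<Sum>w\<in>words I n. card (\<Union>w'\<in>words J m. P w w'))"
      unfolding PP_def using fin by (intro card_UN_le)
    also have "\<dots> \<le> (\<Sum>w\<in>words I n. \<Sum>w'\<in>words J m. card (P w w'))"
      using fin by (intro sum_mono card_UN_le)
    finally have "real (card PP) \<le> real (\<Sum>w\<in>words I n. \<Sum>w'\<in>words J m. card (P w w'))" by (rule of_nat_mono)
    also have "\<dots> = (\<Sum>w\<in>words I n. \<Sum>w'\<in>words J m. real (card (P w w')))" by simp
    also have "\<dots> \<le> (\<Sum>w\<in>words I n. \<Sum>w'\<in>words J m. (1 / x) ^ D)"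
      using P(3) by (intro sum_mono) auto
    also have "\<dots> = real (card I) ^ n * (real (card J) ^ m * (1 / x) ^ D)"
      by (simp add: card_words I)
    also have "\<dots> \<le> x powr (- \<sigma>) * (b powr (- \<theta>) * x powr (- \<theta>) * x powr (- real D))"
    proof (intro mult_mono)
      have "real (card I) ^ n \<le> (a powr (- \<sigma>)) ^ n" using I by (intro power_mono) auto
      also have "\<dots> = x powr (- \<sigma>)"
        unfolding x_def using a(1) by (rule powr_power_commute)
      finally show "real (card I) ^ n \<le> x powr (- \<sigma>)" .
      have "real (card J) ^ m \<le> (b powr (- \<theta>)) ^ m" using I by (intro power_mono) auto
      also have "\<dots> = (b ^ m) powr (- \<theta>)"
        using b(1) by (rule powr_power_commute)
      also have "\<dots> \<le> (b * x) powr (- \<theta>)"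
        using mlo b x I by (intro powr_mono2') auto
      also have "\<dots> = b powr (- \<theta>) * x powr (- \<theta>)" using b x by (simp add: powr_mult)
      finally show "real (card J) ^ m \<le> b powr (- \<theta>) * x powr (- \<theta>)" .
      show "(1 / x) ^ D \<le> x powr (- real D)"
        using x by (simp add: powr_minus_divide powr_realpow power_one_over)
    qed (use x in auto)
    finally have "real (card PP) * (K * x\<^sup>2) powr \<tau> \<le>
      x powr (- \<sigma>) * (b powr (- \<theta>) * x powr (- \<theta>) * x powr (- real D)) * (K * x\<^sup>2) powr \<tau>"
      by (intro mult_right_mono) auto
    also have Kx: "(K * x\<^sup>2) powr \<tau> = K powr \<tau> * x powr (2 * \<tau>)"
    proof -
      have "(x\<^sup>2) powr \<tau> = x powr (2 * \<tau>)" using powr_powr[of x 2 \<tau>] x by simp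
      then show ?thesis using K x by (simp add: powr_mult)
    qed
    also have "x powr (- \<sigma>) * (b powr (- \<theta>) * x powr (- \<theta>) * x powr (- real D)) * (K powr \<tau> * x powr (2 * \<tau>)) =
      C * (x powr (- \<sigma>) * x powr (- \<theta>) * x powr (- real D) * x powr (2 * \<tau>))"
      by (simp add: C_def mult_ac)
    also have "x powr (- \<sigma>) * x powr (- \<theta>) * x powr (- real D) * x powr (2 * \<tau>) = x powr \<delta>"
      unfolding powr_add[symmetric] by (simp add: \<delta>_def algebra_simps)
    also have "x powr \<delta> = (a powr \<delta>) ^ n"
      unfolding x_def using a(1) by (rule powr_power_commute[symmetric])
    finally show ?thesis using n(1) unfolding Kx by simp
  qed
  ultimately show "\<exists>P \<rho>. finite P \<and> {x + y | x y. x \<in> X \<and> y \<in> Y} \<subseteq> \<Union>P \<and>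
      (\<forall>C\<in>P. bounded C \<and> diameter C \<le> \<rho>) \<and> 0 < \<rho> \<and> real (card P) * \<rho> powr \<tau> < \<epsilon>" by blast
qed

section \<open>The open set of linearisations\<close>

definition tensor_box :: "real \<Rightarrow> real \<Rightarrow> real^('m::finite \<times> 'n::finite)^('m \<times> 'n) \<Rightarrow> (real^('m \<times> 'n)^('m \<times> 'n)) set" where
  "tensor_box \<mu> \<delta> Z = {A \<in> tensor_GL. \<forall>p q. \<bar>A $ p $ q - \<mu> * Z $ p $ q\<bar> < \<mu> * \<delta>}"

lemma openin_tensor_box:
  fixes Z :: "real^('m::finite \<times> 'n::finite)^('m \<times> 'n)"
  shows "openin (top_of_set tensor_GL) (tensor_box \<mu> \<delta> Z)"
proof -
  have "open {A :: real^('m \<times> 'n)^('m \<times> 'n). \<forall>p q. \<bar>A $ p $ q - \<mu> * Z $ p $ q\<bar> < \<mu> * \<delta>}"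
  proof -
    have "{A :: real^('m \<times> 'n)^('m \<times> 'n). \<forall>p q. \<bar>A $ p $ q - \<mu> * Z $ p $ q\<bar> < \<mu> * \<delta>} =
      (\<Inter>p. \<Inter>q. {A. \<bar>A $ p $ q - \<mu> * Z $ p $ q\<bar> < \<mu> * \<delta>})" by auto
    moreover have "open {A :: real^('m \<times> 'n)^('m \<times> 'n). \<bar>A $ p $ q - \<mu> * Z $ p $ q\<bar> < \<mu> * \<delta>}" for p q
      by (intro open_Collect_less continuous_intros)
    ultimately show ?thesis by (auto intro!: open_INT)
  qed
  then show ?thesis unfolding tensor_box_def openin_open by (intro exI) (auto intro: exI)
qed

text \<open>
  The factors of an elementary tensor are only determined up to a scalar. It is fixed by giving
  \<open>h\<close> the entry \<open>1\<close> at \<open>(e, e)\<close>; both factors can then be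
  read off from entries of \<open>A\<close>.
\<close>

lemma tensor_box_factors:
  fixes G :: "real^'m::finite^'m" and H :: "real^'n::finite^'n"
  assumes A: "A \<in> tensor_box \<mu> \<delta> (kronecker G H)" and \<mu>: "0 < \<mu>" and \<delta>: "0 < \<delta>" "\<delta> \<le> 1/2"
    and G: "G $ c $ c = 1" and H: "H $ e $ e = 1" "\<And>k l. \<bar>H $ k $ l\<bar> \<le> 1"
  shows "\<exists>g h. A = \<mu> *\<^sub>R kronecker g h \<and> (\<forall>i j. \<bar>g $ i $ j - G $ i $ j\<bar> \<le> 4 * \<delta>) \<and> (\<forall>k l. \<bar>h $ k $ l - H $ k $ l\<bar> \<le> 4 * \<delta>)"
proof -
  obtain g0 h0 where A0: "A = kronecker g0 h0" using A by (auto simp: tensor_box_def tensor_GL_def)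
  have near: "\<bar>g0 $ i $ j * h0 $ k $ l - \<mu> * (G $ i $ j * H $ k $ l)\<bar> < \<mu> * \<delta>" for i j k l
    using A unfolding tensor_box_def A0 kronecker_def by simp
  define b where "b = h0 $ e $ e"
  define g where "g = (b / \<mu>) *\<^sub>R g0"
  define h where "h = (1 / b) *\<^sub>R h0"
  have gn: "\<bar>g $ i $ j - G $ i $ j\<bar> < \<delta>" for i j
  proof -
    have "\<mu> * \<bar>g $ i $ j - G $ i $ j\<bar> = \<bar>\<mu> * (g $ i $ j - G $ i $ j)\<bar>" using \<mu> by (simp add: abs_mult)
    also have "\<dots> = \<bar>g0 $ i $ j * b - \<mu> * G $ i $ j\<bar>" using \<mu> by (simp add: g_def algebra_simps)
    also have "\<dots> < \<mu> * \<delta>" using near[of i j e e] by (simp add: H b_def)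
    finally show ?thesis using \<mu> by simp
  qed
  have gc: "1/2 \<le> g $ c $ c" "\<bar>1 - g $ c $ c\<bar> \<le> \<delta>" using gn[of c c] \<delta> G by auto
  then have b0: "b \<noteq> 0" by (auto simp: g_def)
  have gh: "g $ i $ j * h $ k $ l = g0 $ i $ j * h0 $ k $ l / \<mu>" for i j k l
    using b0 by (simp add: g_def h_def)
  have "A = \<mu> *\<^sub>R kronecker g h"
    using \<mu> gh by (simp add: A0 vec_eq_iff kronecker_def)
  moreover have "\<bar>h $ k $ l - H $ k $ l\<bar> \<le> 4 * \<delta>" for k l
  proof -
    have "\<mu> * \<bar>g $ c $ c * h $ k $ l - H $ k $ l\<bar> = \<bar>\<mu> * (g $ c $ c * h $ k $ l - H $ k $ l)\<bar>"
      using \<mu> by (simp add: abs_mult)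
    also have "\<dots> = \<bar>g0 $ c $ c * h0 $ k $ l - \<mu> * H $ k $ l\<bar>" using \<mu> by (simp add: gh right_diff_distrib)
    also have "\<dots> < \<mu> * \<delta>" using near[of c c k l] by (simp add: G)
    finally have 1: "\<bar>g $ c $ c * h $ k $ l - H $ k $ l\<bar> < \<delta>" using \<mu> by simp
    have 2: "\<bar>H $ k $ l * (1 - g $ c $ c)\<bar> \<le> 1 * \<delta>"
      unfolding abs_mult using H gc by (intro mult_mono) auto
    have "g $ c $ c * (h $ k $ l - H $ k $ l) = (g $ c $ c * h $ k $ l - H $ k $ l) + H $ k $ l * (1 - g $ c $ c)"
      by (simp add: algebra_simps)
    then have "\<bar>g $ c $ c * (h $ k $ l - H $ k $ l)\<bar> \<le> 2 * \<delta>" using 1 2 by linarith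
    then have "g $ c $ c * \<bar>h $ k $ l - H $ k $ l\<bar> \<le> 2 * \<delta>" using gc by (simp add: abs_mult)
    moreover have "1/2 * \<bar>h $ k $ l - H $ k $ l\<bar> \<le> g $ c $ c * \<bar>h $ k $ l - H $ k $ l\<bar>"
      using gc by (intro mult_right_mono) auto
    ultimately have "1/2 * \<bar>h $ k $ l - H $ k $ l\<bar> \<le> 2 * \<delta>" by (rule order_trans[rotated])
    then show ?thesis by simp
  qed
  moreover have "\<bar>g $ i $ j - G $ i $ j\<bar> \<le> 4 * \<delta>" for i j using gn[of i j] \<delta> by linarith
  ultimately show ?thesis by blast
qed

lemma row_close_entries:
  fixes g :: "real^'m::finite^'m" and \<eta> :: real
  assumes "\<And>i j. \<bar>g $ i $ j - G $ i $ j\<bar> \<le> \<eta>" "CARD('m) * \<eta> \<le> \<beta>"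
  shows "row_close \<beta> g G" "row_close \<beta> (transpose g) (transpose G)"
proof -
  have c: "(\<Sum>j\<in>(UNIV::'m set). \<eta>) \<le> \<beta>" using assms(2) by simp
  have "(\<Sum>j\<in>UNIV. \<bar>g $ i $ j - G $ i $ j\<bar>) \<le> \<beta>" for i
    by (rule order_trans[OF sum_mono c]) (rule assms(1))
  then show "row_close \<beta> g G" by (simp add: row_close_def)
  have "(\<Sum>j\<in>UNIV. \<bar>g $ j $ i - G $ j $ i\<bar>) \<le> \<beta>" for i
    by (rule order_trans[OF sum_mono c]) (rule assms(1))
  then show "row_close \<beta> (transpose g) (transpose G)" by (simp add: row_close_def transpose_def)
qed

lemma invertible_diagonal:
  fixes x :: "'m::finite \<Rightarrow> real"
  assumes "\<And>i. x i \<noteq> 0"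
  shows "invertible (\<chi> i j. if i = j then x i else 0)"
proof -
  have "(\<chi> i j. if i = j then x i else 0) ** (\<chi> i j. if i = j then 1 / x i else 0) = mat 1"
    using assms by (simp add: vec_eq_iff matrix_matrix_mult_def mat_def if_distrib[of "\<lambda>t. t * _"] cong: if_cong)
  then show ?thesis using invertible_right_inverse by blast
qed

text \<open>
  The projection at the centre of a box is singular in dimension at least two. This nearby
  invertible matrix shows that the box still meets the tensor group.
\<close>

definition thin_diag :: "'m::finite \<Rightarrow> real \<Rightarrow> real \<Rightarrow> real^'m^'m" where
  "thin_diag c \<mu> \<delta> = (\<chi> i j. if i = j then (if i = c then \<mu> else \<mu> * \<delta> / 2) else 0)"

lemma thin_diag_near:
  assumes "0 < \<mu>" "0 < \<delta>"
  shows "\<bar>thin_diag c \<mu> \<delta> $ i $ j - \<mu> * coord_proj c $ i $ j\<bar> < \<mu> * \<delta>"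
  using assms by (auto simp: thin_diag_def coord_proj_def abs_mult)

lemma invertible_thin_diag:
  assumes "0 < \<mu>" "0 < \<delta>"
  shows "invertible (thin_diag c \<mu> \<delta>)"
  unfolding thin_diag_def using assms by (intro invertible_diagonal) auto

lemma invertible_mat_1: "invertible (mat 1 :: real^'m::finite^'m)"
  unfolding invertible_def by (intro exI[of _ "mat 1"]) simp

lemma tensor_box_nonempty:
  assumes "0 < \<mu>" "0 < \<delta>"
  shows "tensor_box \<mu> \<delta> (kronecker (coord_proj c) (mat 1)) \<noteq> {}" "tensor_box \<mu> \<delta> (kronecker (mat 1) (coord_proj e)) \<noteq> {}"
proof -
  have pos: "0 < \<mu> * \<delta>" using assms by simp
  have GL: "kronecker (thin_diag c \<mu> \<delta>) (mat 1) \<in> tensor_GL" "kronecker (mat 1) (thin_diag e \<mu> \<delta>) \<in> tensor_GL"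
    unfolding tensor_GL_def using invertible_thin_diag[OF assms] invertible_mat_1 by blast+
  have "kronecker (thin_diag c \<mu> \<delta>) (mat 1) \<in> tensor_box \<mu> \<delta> (kronecker (coord_proj c) (mat 1))"
    using thin_diag_near[OF assms, of c] GL(1) pos
    unfolding tensor_box_def by (auto simp: kronecker_def mat_def)
  moreover have "kronecker (mat 1) (thin_diag e \<mu> \<delta>) \<in> tensor_box \<mu> \<delta> (kronecker (mat 1) (coord_proj e))"
    using thin_diag_near[OF assms, of e] GL(2) pos
    unfolding tensor_box_def by (auto simp: kronecker_def mat_def)
  ultimately show "tensor_box \<mu> \<delta> (kronecker (coord_proj c) (mat 1)) \<noteq> {}"
    "tensor_box \<mu> \<delta> (kronecker (mat 1) (coord_proj e)) \<noteq> {}" by blast+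
qed

text \<open>
  Row and column sums inherit the entrywise tolerance, at the cost of the number of entries.
\<close>

lemma tensor_box_row_close:
  fixes G :: "real^'m::finite^'m" and H :: "real^'n::finite^'n" and \<delta> :: real
  assumes A: "\<forall>i\<in>I. A i \<in> tensor_box \<mu> \<delta> (kronecker G H)"
    and \<mu>: "0 < \<mu>" and \<delta>: "0 < \<delta>" "\<delta> \<le> 1/2"
    and \<beta>: "CARD('m) * (4 * \<delta>) \<le> \<beta>" "CARD('n) * (4 * \<delta>) \<le> \<beta>"
    and GH: "G $ c $ c = 1" "H $ e $ e = 1" "\<And>k l. \<bar>H $ k $ l\<bar> \<le> 1"
  obtains g h where "\<And>i. i \<in> I \<Longrightarrow> A i = \<mu> *\<^sub>R kronecker (g i) (h i)"
    "\<And>i. i \<in> I \<Longrightarrow> row_close \<beta> (g i) G \<and> row_close \<beta> (transpose (g i)) (transpose G)"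
    "\<And>i. i \<in> I \<Longrightarrow> row_close \<beta> (h i) H \<and> row_close \<beta> (transpose (h i)) (transpose H)"
    "0 \<le> \<beta>"
proof -
  have "\<exists>g h. A i = \<mu> *\<^sub>R kronecker g h \<and>
      (row_close \<beta> g G \<and> row_close \<beta> (transpose g) (transpose G)) \<and>
      (row_close \<beta> h H \<and> row_close \<beta> (transpose h) (transpose H))" if i: "i \<in> I" for i
  proof -
    obtain g h where gh: "A i = \<mu> *\<^sub>R kronecker g h" "\<And>i j. \<bar>g $ i $ j - G $ i $ j\<bar> \<le> 4 * \<delta>"
      "\<And>k l. \<bar>h $ k $ l - H $ k $ l\<bar> \<le> 4 * \<delta>"
      using tensor_box_factors[OF bspec[OF A i] \<mu> \<delta> GH] by blast
    show ?thesis using gh(1) row_close_entries[OF gh(2) \<beta>(1)] row_close_entries[OF gh(3) \<beta>(2)] by blast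
  qed
  then obtain g h where "\<And>i. i \<in> I \<Longrightarrow> A i = \<mu> *\<^sub>R kronecker (g i) (h i) \<and>
      (row_close \<beta> (g i) G \<and> row_close \<beta> (transpose (g i)) (transpose G)) \<and>
      (row_close \<beta> (h i) H \<and> row_close \<beta> (transpose (h i)) (transpose H))"
    by metis
  moreover have "0 \<le> \<beta>"
    using \<beta>(1) \<delta> by (meson mult_nonneg_nonneg of_nat_0_le_iff order_trans less_imp_le zero_le_numeral)
  ultimately show ?thesis using that[of g h] by blast
qed

lemma tensor_family_first:
  fixes c :: "'m::finite" and \<delta> :: real and A :: "'i \<Rightarrow> real^('m \<times> 'n::finite)^('m \<times> 'n)"
  assumes A: "\<forall>i\<in>I. A i \<in> tensor_box \<mu> \<delta> (kronecker (coord_proj c) (mat 1))"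
    and par: "0 < \<mu>" "0 < \<delta>" "\<delta> \<le> 1/2" "CARD('m) * (4 * \<delta>) \<le> \<beta>" "CARD('n) * (4 * \<delta>) \<le> \<beta>" and \<beta>: "\<beta> \<le> 1/2"
  shows "\<exists>g h. tensor_family I \<mu> c \<beta> g h \<and> (\<forall>i\<in>I. A i = \<mu> *\<^sub>R kronecker (g i) (h i))"
proof -
  have GH: "coord_proj c $ c $ c = (1::real)" "(mat 1 :: real^'n^'n) $ (undefined::'n) $ (undefined::'n) = (1::real)" "\<And>k l. \<bar>(mat 1 :: real^'n^'n) $ k $ l\<bar> \<le> (1::real)"
    by (auto simp: coord_proj_def mat_def)
  obtain g h where gh: "\<And>i. i \<in> I \<Longrightarrow> A i = \<mu> *\<^sub>R kronecker (g i) (h i)"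
    "\<And>i. i \<in> I \<Longrightarrow> row_close \<beta> (g i) (coord_proj c) \<and> row_close \<beta> (transpose (g i)) (transpose (coord_proj c))"
    "\<And>i. i \<in> I \<Longrightarrow> row_close \<beta> (h i) ((mat 1 :: real^'n^'n)) \<and> row_close \<beta> (transpose (h i)) (transpose ((mat 1 :: real^'n^'n)))"
    "0 \<le> \<beta>"
    by (rule tensor_box_row_close[OF A par GH]) blast
  have "tensor_family I \<mu> c \<beta> g h"
    unfolding tensor_family_def near_proj_def near_id_def using gh(2-4) par(1) \<beta> by (simp add: transpose_coord_proj)
  then show ?thesis using gh(1) by blast
qed

lemma tensor_family_second:
  fixes e :: "'n::finite" and \<delta> :: real and A :: "'i \<Rightarrow> real^('m::finite \<times> 'n)^('m \<times> 'n)"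
  assumes A: "\<forall>i\<in>I. A i \<in> tensor_box \<mu> \<delta> (kronecker (mat 1) (coord_proj e))"
    and par: "0 < \<mu>" "0 < \<delta>" "\<delta> \<le> 1/2" "CARD('m) * (4 * \<delta>) \<le> \<beta>" "CARD('n) * (4 * \<delta>) \<le> \<beta>" and \<beta>: "\<beta> \<le> 1/2"
  shows "\<exists>g h. tensor_family I \<mu> e \<beta> h g \<and> (\<forall>i\<in>I. A i = \<mu> *\<^sub>R kronecker (g i) (h i))"
proof -
  have GH: "(mat 1 :: real^'m^'m) $ (undefined::'m) $ (undefined::'m) = (1::real)" "coord_proj e $ e $ e = (1::real)" "\<And>k l. \<bar>coord_proj e $ k $ l\<bar> \<le> (1::real)"
    by (auto simp: coord_proj_def mat_def)
  obtain g h where gh: "\<And>i. i \<in> I \<Longrightarrow> A i = \<mu> *\<^sub>R kronecker (g i) (h i)"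
    "\<And>i. i \<in> I \<Longrightarrow> row_close \<beta> (g i) ((mat 1 :: real^'m^'m)) \<and> row_close \<beta> (transpose (g i)) (transpose ((mat 1 :: real^'m^'m)))"
    "\<And>i. i \<in> I \<Longrightarrow> row_close \<beta> (h i) (coord_proj e) \<and> row_close \<beta> (transpose (h i)) (transpose (coord_proj e))"
    "0 \<le> \<beta>"
    by (rule tensor_box_row_close[OF A par GH]) blast
  have "tensor_family I \<mu> e \<beta> h g"
    unfolding tensor_family_def near_proj_def near_id_def using gh(2-4) par(1) \<beta> by (simp add: transpose_coord_proj)
  then show ?thesis using gh(1) by blast
qed

lemma norm_tensor_family:
  fixes g :: "'i \<Rightarrow> real^'m::finite^'m" and h :: "'i \<Rightarrow> real^'n::finite^'n"
  assumes F: "tensor_family I \<mu> c \<beta> g h" and i: "i \<in> I"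
  shows "norm ((\<mu> *\<^sub>R kronecker (g i) (h i)) *v x) \<le> real CARD('m \<times> 'n) * (4 * \<mu>) * norm x"
    "norm ((\<mu> *\<^sub>R kronecker (h i) (g i)) *v y) \<le> real CARD('m \<times> 'n) * (4 * \<mu>) * norm y"
proof -
  have *: "norm ((\<mu> *\<^sub>R kronecker (g i) (h i)) *v x) \<le> real CARD('m \<times> 'n) * (4 * \<mu>) * norm x" for x
  proof -
    have "\<bar>(kronecker (mprod g [i]) (mprod h [i]) *v x) $ p\<bar> \<le> 4 ^ length [i] * norm x" for p
      using i by (intro kronecker_word_upper[OF F]) (auto simp: component_le_norm_cart)
    then have "\<bar>(kronecker (g i) (h i) *v x) $ p\<bar> \<le> 4 * norm x" for p by simp
    from norm_le_card_mult[OF this]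
    have "\<mu> * norm (kronecker (g i) (h i) *v x) \<le> \<mu> * (real CARD('m \<times> 'n) * (4 * norm x))"
      using F by (intro mult_left_mono) (auto simp: tensor_family_def)
    then show ?thesis using F by (simp add: tensor_family_def scaleR_matrix_vector_assoc[symmetric] mult_ac)
  qed
  show "norm ((\<mu> *\<^sub>R kronecker (g i) (h i)) *v x) \<le> real CARD('m \<times> 'n) * (4 * \<mu>) * norm x" by (rule *)
  have "(\<mu> *\<^sub>R kronecker (h i) (g i)) *v y = swap_vec ((\<mu> *\<^sub>R kronecker (g i) (h i)) *v swap_vec y)"
    by (simp add: scaleR_matrix_vector_assoc[symmetric] linear_scale[OF linear_swap_vec] kronecker_swap_vec[symmetric])
  then show "norm ((\<mu> *\<^sub>R kronecker (h i) (g i)) *v y) \<le> real CARD('m \<times> 'n) * (4 * \<mu>) * norm y"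
    using *[of "swap_vec y"] by simp
qed

text \<open>
  With at least this many maps, the rate \<open>a\<close> of
  \<open>contraction_rate_exists\<close> is so small that $a^{1/8}$ absorbs all constants lost in
  the crude bounds for products.
\<close>

definition ifs_threshold :: "nat \<Rightarrow> nat" where
  "ifs_threshold d = (2 * (16 * d) ^ (8 * d)) ^ d"

text \<open>
  For \<open>M\<close> maps with rate \<open>a\<close>, the equation gives similarity dimension $e
  - 1/8$. The first inequality states that the lower rate $a / (16 d)$, which enters the energy
  bound, still gives more than $e - 1/4$, and the second one that the dimension is below $e -
  1/16$.
\<close>

lemma contraction_rate_exists:
  assumes e: "1 \<le> e" "e \<le> d" and M: "ifs_threshold d \<le> M"
  shows "\<exists>a>0. a \<le> 1/8 \<and> real M = a powr (- (real e - 1/8)) \<and> 1 < real M * (a / (16 * d)) powr (real e - 1/4) \<and>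
     real M * a powr (real e - 1/16) < 1 \<and> 2 \<le> M"
proof -
  define q where "q = real e - 1/8"
  have q: "0 < q" "q \<le> d" using e by (auto simp: q_def)
  (* The eighth root of L exceeds (16 d)^d, which bounds the loss in the lower rate. *)
  define L where "L = 2 * (16 * real d) ^ (8 * d)"
  have d1: "1 \<le> real d" using e by simp
  have "1 \<le> (16 * real d) ^ (8 * d)" using d1 by (intro one_le_power) auto
  then have L1: "1 \<le> L" by (simp add: L_def)
  have "16 * real d \<le> (16 * real d) ^ (8 * d)"
    using d1 e by (intro self_le_power) auto
  then have L8: "8 \<le> L" unfolding L_def using d1 by linarith
  have LM: "L powr d \<le> M"
  proof -
    have "L powr d = real (ifs_threshold d)" using L1 by (simp add: powr_realpow ifs_threshold_def L_def)
    then show ?thesis using M by simp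
  qed
  have M0: "0 < real M" using LM L1 powr_gt_zero[of L d] by linarith
  define a where "a = real M powr (- 1 / q)"
  have a0: "0 < a" using M0 by (simp add: a_def)
  have Ma: "real M = a powr (- q)" using M0 q by (simp add: a_def powr_powr)
  have aL: "a \<le> 1 / L"
  proof -
    have "L powr q \<le> L powr d" using q L1 by (intro powr_mono) auto
    then have "L powr q \<le> M" using LM by simp
    then have "real M powr (- 1 / q) \<le> (L powr q) powr (- 1 / q)"
      using q L1 by (intro powr_mono2') auto
    also have "\<dots> = 1 / L" using q L1 by (simp add: powr_powr powr_minus_divide)
    finally show ?thesis by (simp add: a_def)
  qed
  have a8: "a \<le> 1/8"
  proof -
    have "1 / L \<le> 1 / 8" using L8 by (intro divide_left_mono) auto
    then show ?thesis using aL by simp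
  qed
  have low: "1 < real M * (a / (16 * d)) powr (real e - 1/4)"
  proof -
    let ?s = "real e - 1/4"
    have s: "0 < ?s" "?s \<le> d" using e by auto
    have "(16 * real d) powr ?s \<le> (16 * real d) powr d" by (rule powr_mono) (use s d1 in linarith)+
    also have "\<dots> = ((16 * real d) ^ (8 * d)) powr (1/8)"
    proof -
      have "(16 * real d) ^ (8 * d) = (16 * real d) powr (8 * real d)"
        using d1 powr_realpow[of "16 * real d" "8 * d"] by simp
      then show ?thesis by (simp add: powr_powr)
    qed
    also have "\<dots> < L powr (1/8)"
    proof (rule powr_less_mono2)
      show "(16 * real d) ^ (8 * d) < L" unfolding L_def using \<open>1 \<le> (16 * real d) ^ (8 * d)\<close> by linarith
    qed auto
    also have "\<dots> \<le> (1 / a) powr (1/8)"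
      using aL a0 L1 by (intro powr_mono2) (auto simp: field_simps)
    also have "\<dots> = a powr (- 1/8)" using a0 by (simp add: powr_divide powr_minus_divide)
    finally have lt: "(16 * real d) powr ?s < a powr (- 1/8)" .
    have "real M * (a / (16 * d)) powr ?s = a powr (- q) * (a powr ?s / (16 * real d) powr ?s)"
      using a0 d1 by (simp add: Ma powr_divide)
    also have "\<dots> = a powr (- q + ?s) / (16 * real d) powr ?s" by (simp only: powr_add times_divide_eq_right)
    also have "- q + ?s = - 1/8" by (simp add: q_def)
    finally have "real M * (a / (16 * d)) powr ?s = a powr (- 1/8) / (16 * real d) powr ?s" .
    moreover have "0 < (16 * real d) powr ?s" using d1 by simp
    ultimately show ?thesis using lt by (simp only: less_divide_eq if_True mult_1)
  qed
  have up: "real M * a powr (real e - 1/16) < 1"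
  proof -
    have "real M * a powr (real e - 1/16) = a powr (1/16)"
      unfolding Ma powr_add[symmetric] by (simp add: q_def)
    also have "\<dots> < a powr 0" using a0 a8 by (intro powr_less_mono') auto
    finally show ?thesis using a0 by simp
  qed
  have "8 \<le> real M"
  proof -
    have "L powr 1 \<le> L powr d" using L1 d1 by (intro powr_mono) auto
    then show ?thesis using LM L1 L8 by simp
  qed
  then have "2 \<le> M" by simp
  then show ?thesis using a0 a8 Ma low up unfolding q_def by blast
qed


lemma card_cross:
  "card {p::'m::finite \<times> 'n::finite. fst p = c \<or> snd p = e} + 1 = CARD('m) + CARD('n)"
proof -
  have "{p::'m \<times> 'n. fst p = c \<or> snd p = e} = {c} \<times> UNIV \<union> UNIV \<times> {e}" by auto
  moreover have "({c} \<times> UNIV) \<inter> (UNIV \<times> {e}) = {(c, e)}" by auto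
  ultimately show ?thesis
    using card_Un_Int[of "{c} \<times> (UNIV::'n set)" "(UNIV::'m set) \<times> {e}"] by (simp add: card_cartesian_product)
qed

lemma affine_ifs_of_norm_bound:
  fixes A :: "'i \<Rightarrow> real^'k::finite^'k"
  assumes "\<And>i x. i \<in> I \<Longrightarrow> norm (A i *v x) \<le> a * norm x" "0 \<le> a" "a < 1"
  shows "is_ifs I (affine_maps A u)" "\<And>i x y. i \<in> I \<Longrightarrow> dist (affine_maps A u i x) (affine_maps A u i y) \<le> a * dist x y"
proof -
  have *: "norm (affine_maps A u i x - affine_maps A u i y) \<le> a * norm (x - y)" if "i \<in> I" for i x y
    using assms(1)[OF that, of "x - y"] by (simp add: affine_maps_def matrix_vector_mult_diff_distrib)
  have "is_norm (norm :: real^'k \<Rightarrow> real)" by (simp add: is_norm_def norm_triangle_ineq)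
  then show "is_ifs I (affine_maps A u)" unfolding is_ifs_def using * assms(2,3) by blast
  show "dist (affine_maps A u i x) (affine_maps A u i y) \<le> a * dist x y" if "i \<in> I" for i x y
    using *[OF that] by (simp add: dist_norm)
qed

text \<open>
  The scale $a / (4 d)$ makes \<open>a\<close> a bound for the Euclidean norms of the maps, and
  the tolerance $a / (32 d)$ makes both factors close to their models up to \<open>a / 8\<close>,
  which gives thinness $a^2$ relative to the rate \<open>a\<close>.
\<close>

lemma box_parameters:
  fixes d :: nat and a :: real
  assumes d: "d = CARD('m::finite \<times> 'n::finite)" and a: "0 < a" "a \<le> 1/8"
  shows "0 < a / (4 * d)" "0 < a / (32 * d)" "a / (32 * d) \<le> 1/2"
    "CARD('m) * (4 * (a / (32 * d))) \<le> a / 8" "CARD('n) * (4 * (a / (32 * d))) \<le> a / 8" "a / 8 \<le> 1/2"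
    "8 * (a / (4 * d)) * (a / 8) \<le> a\<^sup>2" "real CARD('m \<times> 'n) * (4 * (a / (4 * d))) = a"
proof -
  have n0: "1 \<le> CARD('n)" "1 \<le> CARD('m)" using zero_less_card_finite by (metis Suc_leI One_nat_def)+
  have dd: "d = CARD('m) * CARD('n)" using d by simp
  have d0: "1 \<le> d" and dm: "CARD('m) \<le> d" and dn: "CARD('n) \<le> d"
    unfolding dd using mult_le_mono[OF n0(2,1)] mult_le_mono2[OF n0(1), of "CARD('m)"] mult_le_mono1[OF n0(2), of "CARD('n)"] by auto
  have r: "1 \<le> real d" "real CARD('m) \<le> real d" "real CARD('n) \<le> real d" using d0 dm dn by linarith+
  show "0 < a / (4 * d)" "0 < a / (32 * d)" "a / 8 \<le> 1/2" using a r by auto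
  have "a / (32 * d) \<le> a / 1" using a r by (intro divide_left_mono) auto
  then show "a / (32 * d) \<le> 1/2" using a by simp
  have "real k * (4 * (a / (32 * d))) \<le> a / 8" if "real k \<le> real d" for k
  proof -
    have "real k * (4 * (a / (32 * d))) \<le> real d * (4 * (a / (32 * d)))" using that a by (intro mult_right_mono) auto
    then show ?thesis using r by simp
  qed
  then show "CARD('m) * (4 * (a / (32 * d))) \<le> a / 8" "CARD('n) * (4 * (a / (32 * d))) \<le> a / 8" using r by auto
  have "8 * (a / (4 * d)) * (a / 8) = a\<^sup>2 / (4 * d)" by (simp add: power2_eq_square)
  also have "\<dots> \<le> a\<^sup>2 / 1" using r by (intro divide_left_mono) auto
  finally show "8 * (a / (4 * d)) * (a / 8) \<le> a\<^sup>2" by simp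
  show "real CARD('m \<times> 'n) * (4 * (a / (4 * d))) = a" using r unfolding d[symmetric] by simp
qed

lemma attractor_dim_bounds:
  fixes A :: "'i \<Rightarrow> real^'k::finite^'k"
  assumes I: "finite I" "2 \<le> card I" and a: "0 < a" "a \<le> 1/8"
    and A: "\<forall>i\<in>I. \<forall>x. norm (A i *v x) \<le> a * norm x"
    and em: "minor_bounded_below A I S r \<kappa>" "card S = k" "1 \<le> k" "0 < r" "1 \<le> \<kappa>"
    and lo: "1 < real (card I) * r powr (real k - 1/4)" and up: "real (card I) * a powr (real k - 1/16) < 1"
  shows "AE u in (\<Pi>\<^sub>M i\<in>I. lborel). ennreal (real k - 1/4) \<le> hausdorff_dim (attractor I (affine_maps A u))"
    "hausdorff_dim (attractor I (affine_maps A u)) \<le> ennreal (real k - 1/16)"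
proof -
  have A8: "norm (A i *v x) \<le> norm x / 8" if "i \<in> I" for i x
  proof -
    have "norm (A i *v x) \<le> a * norm x" using A that by blast
    also have "\<dots> \<le> 1/8 * norm x" using a(2) by (rule mult_right_mono) simp
    finally show ?thesis by simp
  qed
  show "AE u in (\<Pi>\<^sub>M i\<in>I. lborel). ennreal (real k - 1/4) \<le> hausdorff_dim (attractor I (affine_maps A u))"
    using em lo by (intro AE_hausdorff_dim_attractor_ge[OF I A8 _ _ em(1)]) auto
  have lip: "dist (affine_maps A u i x) (affine_maps A u i y) \<le> a * dist x y" if "i \<in> I" for i x y
    by (rule affine_ifs_of_norm_bound(2)[of I A a]) (use A a that in auto)
  have "I \<noteq> {}" using I by auto
  then show "hausdorff_dim (attractor I (affine_maps A u)) \<le> ennreal (real k - 1/16)"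
    using a em(2,3) up lip by (intro hausdorff_dim_attractor_le[OF I(1), of "affine_maps A u" a]) auto
qed

theorem theorem2:
  assumes "CARD('m::finite) \<ge> 2" and "CARD('n::finite) \<ge> 2"
  shows "\<exists>N::nat. \<forall>(I::nat set) (J::nat set).
    finite I \<and> finite J \<and> N \<le> card I \<and> N \<le> card J \<longrightarrow>
    (\<exists>U :: ((nat \<Rightarrow> real ^ ('m \<times> 'n) ^ ('m \<times> 'n)) \<times> (nat \<Rightarrow> real ^ ('m \<times> 'n) ^ ('m \<times> 'n))) set.
      U \<noteq> {} \<and>
      openin (prod_topology (product_topology (\<lambda>_. top_of_set tensor_GL) I)
                            (product_topology (\<lambda>_. top_of_set tensor_GL) J)) U \<and>
      (\<forall>(A, B)\<in>U.
        (\<forall>u. is_ifs I (affine_maps A u)) \<and> (\<forall>v. is_ifs J (affine_maps B v)) \<and>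
        (AE u in (\<Pi>\<^sub>M i\<in>I. lborel). AE v in (\<Pi>\<^sub>M j\<in>J. lborel).
          let X = attractor I (affine_maps A u); Y = attractor J (affine_maps B v) in
            hausdorff_dim {x + y | x y. x \<in> X \<and> y \<in> Y} < hausdorff_dim X + hausdorff_dim Y \<and>
            hausdorff_dim X + hausdorff_dim Y < of_nat (CARD('m) * CARD('n)))))"
proof (intro exI[of _ "ifs_threshold CARD('m \<times> 'n)"] allI impI, elim conjE)
  define d where "d = CARD('m \<times> 'n)"
  define d1 where "d1 = CARD('m)"
  define d2 where "d2 = CARD('n)"
  fix I J :: "nat set"
  assume IJ: "finite I" "finite J" "ifs_threshold CARD('m \<times> 'n) \<le> card I" "ifs_threshold CARD('m \<times> 'n) \<le> card J"
  then have I: "finite I" "ifs_threshold d \<le> card I" and J: "finite J" "ifs_threshold d \<le> card J" by (auto simp: d_def)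
  let ?dims = "\<lambda>A B u v. let X = attractor I (affine_maps A u); Y = attractor J (affine_maps B v) in
            hausdorff_dim {x + y | x y. x \<in> X \<and> y \<in> Y} < hausdorff_dim X + hausdorff_dim Y \<and>
            hausdorff_dim X + hausdorff_dim Y < of_nat (CARD('m) * CARD('n))"
  let ?good = "\<lambda>A B. (\<forall>u. is_ifs I (affine_maps A u)) \<and> (\<forall>v. is_ifs J (affine_maps B v)) \<and>
        (AE u in (\<Pi>\<^sub>M i\<in>I. lborel). AE v in (\<Pi>\<^sub>M j\<in>J. lborel).
          ?dims A B u v)"
  let ?top = "prod_topology (product_topology (\<lambda>_. top_of_set tensor_GL) I)
                            (product_topology (\<lambda>_. top_of_set tensor_GL) J)"
  have d12: "2 \<le> d1" "2 \<le> d2" "d = d1 * d2" using assms by (auto simp: d1_def d2_def d_def)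
  have dsum: "d1 + d2 \<le> d"
  proof -
    have "(d1 - 1) * (d2 - 1) \<ge> 1 * 1" using d12 by (intro mult_le_mono) auto
    moreover obtain k1 k2 where "d1 = Suc k1" "d2 = Suc k2" using d12 by (metis Suc_le_D numeral_2_eq_2)
    ultimately show ?thesis using d12(3) by simp
  qed
  obtain a where a: "0 < a" "a \<le> 1/8" "real (card I) = a powr (- (real d2 - 1/8))"
     "1 < real (card I) * (a / (16 * d)) powr (real d2 - 1/4)"
     "real (card I) * a powr (real d2 - 1/16) < 1" "2 \<le> card I"
    using contraction_rate_exists[OF _ _ I(2), of d2] d12 dsum by auto
  obtain b where b: "0 < b" "b \<le> 1/8" "real (card J) = b powr (- (real d1 - 1/8))"
     "1 < real (card J) * (b / (16 * d)) powr (real d1 - 1/4)"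
     "real (card J) * b powr (real d1 - 1/16) < 1" "2 \<le> card J"
    using contraction_rate_exists[OF _ _ J(2), of d1] d12 dsum by auto
  note pa = box_parameters[OF d_def a(1,2)] and pb = box_parameters[OF d_def b(1,2)]
  (* The distinguished coordinates are arbitrary. *)
  define c :: 'm where "c = undefined"
  define e :: 'n where "e = undefined"
  define VA where "VA = tensor_box (a / (4 * d)) (a / (32 * d)) (kronecker (coord_proj c) (mat 1 :: real^'n^'n))"
  define VB where "VB = tensor_box (b / (4 * d)) (b / (32 * d)) (kronecker (mat 1 :: real^'m^'m) (coord_proj e))"
  define U where "U = (\<Pi>\<^sub>E i\<in>I. VA) \<times> (\<Pi>\<^sub>E i\<in>J. VB)"
  have "VA \<noteq> {}" unfolding VA_def by (rule tensor_box_nonempty(1)[OF pa(1,2)])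
  moreover have "VB \<noteq> {}" unfolding VB_def by (rule tensor_box_nonempty(2)[OF pb(1,2)])
  ultimately have "U \<noteq> {}" unfolding U_def by (simp add: PiE_eq_empty_iff)
  moreover have "openin ?top U"
    unfolding U_def openin_prod_Times_iff openin_PiE[OF I(1)] openin_PiE[OF J(1)]
    by (simp add: VA_def VB_def openin_tensor_box)
  moreover have "?good A B" if AB: "(A, B) \<in> U" for A B
  proof -
    have AV: "\<forall>i\<in>I. A i \<in> VA" using AB by (auto simp: U_def)
    have BV: "\<forall>i\<in>J. B i \<in> VB" using AB by (auto simp: U_def)
    obtain g :: "nat \<Rightarrow> real^'m^'m" and h :: "nat \<Rightarrow> real^'n^'n"
      where "tensor_family I (a / (4 * d)) c (a / 8) g h \<and> (\<forall>i\<in>I. A i = (a / (4 * d)) *\<^sub>R kronecker (g i) (h i))"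
      using tensor_family_first[OF AV[unfolded VA_def] pa(1-6)] by (elim exE) (rule that)
    then have FA: "tensor_family I (a / (4 * d)) c (a / 8) g h"
      and A: "\<And>i. i \<in> I \<Longrightarrow> A i = (a / (4 * d)) *\<^sub>R kronecker (g i) (h i)" by auto
    obtain g' :: "nat \<Rightarrow> real^'m^'m" and h' :: "nat \<Rightarrow> real^'n^'n"
      where "tensor_family J (b / (4 * d)) e (b / 8) h' g' \<and> (\<forall>i\<in>J. B i = (b / (4 * d)) *\<^sub>R kronecker (g' i) (h' i))"
      using tensor_family_second[OF BV[unfolded VB_def] pb(1-6)] by (elim exE) (rule that)
    then have FB: "tensor_family J (b / (4 * d)) e (b / 8) h' g'"
      and B: "\<And>i. i \<in> J \<Longrightarrow> B i = (b / (4 * d)) *\<^sub>R kronecker (g' i) (h' i)" by auto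
    have nA: "norm (A i *v x) \<le> a * norm x" if "i \<in> I" for i x
      using norm_tensor_family(1)[OF FA that, of x] unfolding A[OF that] pa(8) .
    have nB: "norm (B i *v x) \<le> b * norm x" if "i \<in> J" for i x
    proof -
      have "CARD('n \<times> 'm) = CARD('m \<times> 'n)" by simp
      then have "real CARD('n \<times> 'm) * (4 * (b / (4 * d))) = b" using pb(8) by (simp only:)
      then show ?thesis using norm_tensor_family(2)[OF FB that, of x] unfolding B[OF that] by simp
    qed
    have \<kappa>: "1 \<le> (real CARD('m \<times> 'n))\<^sup>2"
    proof -
      have "1 \<le> real d" using d12 dsum by linarith
      then show ?thesis unfolding d_def by (rule one_le_power)
    qed
    have emA: "minor_bounded_below A I ({c} \<times> UNIV) (a / (16 * d)) ((real CARD('m \<times> 'n))\<^sup>2)"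
      using minor_bounded_below_first[OF FA A] by simp
    have emB: "minor_bounded_below B J (UNIV \<times> {e}) (b / (16 * d)) ((real CARD('m \<times> 'n))\<^sup>2)"
      using minor_bounded_below_second[OF FB B] by simp
    have cS: "card ({c} \<times> (UNIV::'n set)) = d2" "card ((UNIV::'m set) \<times> {e}) = d1"
      by (simp_all add: d1_def d2_def card_cartesian_product)
    have r0: "0 < a / (16 * d)" "0 < b / (16 * d)" using pa(1) pb(1) by (auto simp: zero_less_divide_iff)
    have nA': "\<forall>i\<in>I. \<forall>x. norm (A i *v x) \<le> a * norm x" and nB': "\<forall>i\<in>J. \<forall>x. norm (B i *v x) \<le> b * norm x"
      using nA nB by auto
    have lipA: "dist (affine_maps A u i x) (affine_maps A u i y) \<le> a * dist x y" if "i \<in> I" for u i x y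
      by (rule affine_ifs_of_norm_bound(2)[of I A a]) (use a nA that in auto)
    have lipB: "dist (affine_maps B u i x) (affine_maps B u i y) \<le> b * dist x y" if "i \<in> J" for u i x y
      by (rule affine_ifs_of_norm_bound(2)[of J B b]) (use b nB that in auto)
    note dimA = attractor_dim_bounds[OF I(1) a(6) a(1,2) nA' emA cS(1) _ r0(1) \<kappa> a(4,5)]
    note dimB = attractor_dim_bounds[OF J(1) b(6) b(1,2) nB' emB cS(2) _ r0(2) \<kappa> b(4,5)]
    have dom: "1 \<le> d1" "1 \<le> d2" using d12 by auto
    have main: "?dims A B u v"
      if u: "ennreal (real d2 - 1/4) \<le> hausdorff_dim (attractor I (affine_maps A u))"
        and v: "ennreal (real d1 - 1/4) \<le> hausdorff_dim (attractor J (affine_maps B v))" for u v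
    proof -
      define X where "X = attractor I (affine_maps A u)"
      define Y where "Y = attractor J (affine_maps B v)"
      have ne: "I \<noteq> {}" "J \<noteq> {}" using a(6) b(6) by auto
      have X: "bounded X" "X = (\<Union>i\<in>I. affine_maps A u i ` X)"
        using attractor_properties[of I "affine_maps A u" a, OF I(1) ne(1) lipA] a compact_imp_bounded
        unfolding X_def by auto
      have Y: "bounded Y" "Y = (\<Union>i\<in>J. affine_maps B v i ` Y)"
        using attractor_properties[of J "affine_maps B v" b, OF J(1) ne(2) lipB] b compact_imp_bounded
        unfolding Y_def by auto
      (* With D = d1 + d2 - 1 the exponent is D + 7/16. It lies between D + 3/8, the bound from the covers, and D + 1/2. *)
      have "hausdorff_dim {x + y | x y. x \<in> X \<and> y \<in> Y} \<le> ennreal (real d1 + real d2 - 9/16)"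
      proof (rule hausdorff_dim_sum_le[OF FA A FB B a(1,2) nA pa(7) b(1) _ nB pb(7) I(1) J(1) _ _ _ X Y])
        show "real (card I) \<le> a powr (- (real d2 - 1/8))" "real (card J) \<le> b powr (- (real d1 - 1/8))"
          using a(3) b(3) by simp_all
        have eq: "real (card {p::'m \<times> 'n. fst p = c \<or> snd p = e}) = real d1 + real d2 - 1"
          using card_cross[of c e] unfolding d1_def d2_def by linarith
        show "real (card {p::'m \<times> 'n. fst p = c \<or> snd p = e}) + (real d2 - 1/8) + (real d1 - 1/8) < 2 * (real d1 + real d2 - 9/16)"
          unfolding eq by (simp add: algebra_simps)
      qed (use b d12 in auto)
      also have "\<dots> < ennreal ((real d2 - 1/4) + (real d1 - 1/4))" using d12 by (intro ennreal_lessI) auto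
      also have "\<dots> = ennreal (real d2 - 1/4) + ennreal (real d1 - 1/4)" using d12 by (intro ennreal_plus) auto
      also have "\<dots> \<le> hausdorff_dim X + hausdorff_dim Y" unfolding X_def Y_def using u v by (rule add_mono)
      finally have 1: "hausdorff_dim {x + y | x y. x \<in> X \<and> y \<in> Y} < hausdorff_dim X + hausdorff_dim Y" .
      have "hausdorff_dim X + hausdorff_dim Y \<le> ennreal (real d2 - 1/16) + ennreal (real d1 - 1/16)"
        unfolding X_def Y_def using dimA(2) dimB(2) dom by (intro add_mono) auto
      also have "\<dots> = ennreal ((real d2 - 1/16) + (real d1 - 1/16))" using d12 by (intro ennreal_plus[symmetric]) auto
      also have "\<dots> < ennreal (real d)"
      proof (rule ennreal_lessI)
        have "real d1 + real d2 \<le> real d" "0 < real d" using dsum d12(1) by linarith+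
        then show "(real d2 - 1/16) + (real d1 - 1/16) < real d" "0 < real d" by simp_all
      qed
      also have "\<dots> = of_nat (CARD('m) * CARD('n))" by (simp add: d_def ennreal_of_nat_eq_real_of_nat)
      finally show ?thesis using 1 unfolding Let_def X_def Y_def by blast
    qed
    have "AE u in (\<Pi>\<^sub>M i\<in>I. lborel). AE v in (\<Pi>\<^sub>M j\<in>J. lborel).
          ?dims A B u v"
      using dimA(1)[OF dom(2)]
    proof (rule eventually_mono)
      fix u assume u: "ennreal (real d2 - 1/4) \<le> hausdorff_dim (attractor I (affine_maps A u))"
      show "AE v in (\<Pi>\<^sub>M j\<in>J. lborel).
          ?dims A B u v"
        using dimB(1)[OF dom(1)]
        by (rule eventually_mono) (rule main[OF u])
    qed
    moreover have "is_ifs I (affine_maps A u)" for u by (rule affine_ifs_of_norm_bound(1)[of I A a]) (use a nA in auto)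
    moreover have "is_ifs J (affine_maps B v)" for v by (rule affine_ifs_of_norm_bound(1)[of J B b]) (use b nB in auto)
    ultimately show ?thesis by blast
  qed
  ultimately show "\<exists>U :: ((nat \<Rightarrow> real ^ ('m \<times> 'n) ^ ('m \<times> 'n)) \<times> (nat \<Rightarrow> real ^ ('m \<times> 'n) ^ ('m \<times> 'n))) set.
      U \<noteq> {} \<and> openin ?top U \<and> (\<forall>(A, B)\<in>U. ?good A B)"
    by blast
qed

end
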